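(* There is an algorithm which, given an $n$-vertex graph $G$ with maximum degree $\Delta=\Delta(G)$ and minimum degree $\delta(G)\geq 7$, determines whether $G$ is $3$-colorable in time $O(1.32^{\,n-0.73\Delta})$.
   Context: All graphs are finite and simple. A graph is $3$-colorable if its vertices can be assigned colors from a set of $3$ colors so that adjacent vertices receive different colors. $\Delta(G)$ and $\delta(G)$ denote the maximum and minimum vertex degree of $G$. *)

theory Defs
  imports Complex_Main "HOL-Library.Log_Nat"
begin

section \<open>Finite simple graphs\<close>

definition simple_graph :: "'a set \<Rightarrow> 'a set set \<Rightarrow> bool" where
  "simple_graph V E \<longleftrightarrow> finite V \<and> V \<noteq> {} \<and> (\<forall>e\<in>E. e \<subseteq> V \<and> card e = 2)"

definition degree :: "'a set set \<Rightarrow> 'a \<Rightarrow> nat" where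
  "degree E v = card {e \<in> E. v \<in> e}"

definition max_degree :: "'a set \<Rightarrow> 'a set set \<Rightarrow> nat" where
  "max_degree V E = Max (degree E ` V)"

definition min_degree :: "'a set \<Rightarrow> 'a set set \<Rightarrow> nat" where
  "min_degree V E = Min (degree E ` V)"

definition three_colorable :: "'a set \<Rightarrow> 'a set set \<Rightarrow> bool" where
  "three_colorable V E \<longleftrightarrow>
     (\<exists>f. f ` V \<subseteq> {0, 1, 2 :: nat} \<and> (\<forall>u v. {u, v} \<in> E \<longrightarrow> f u \<noteq> f v))"


section \<open>Random access machines with logarithmic cost\<close>

text \<open>
  Algorithms are deterministic programs for a random access machine. A program refers to
  finitely many registers by name; all other storage is an infinite memory
  with natural numbers as addresses and contents, accessed indirectly. Control flow is
  structured, which changes running times by constant factors only compared with jumps.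

  The only arithmetic operations are addition and truncated subtraction, and time is
  measured by the logarithmic cost criterion: every step is charged for the bit
  lengths of the numbers and addresses it handles. Hence no computational power is
  gained from operating on huge numbers.
\<close>

datatype opd = Const nat | Reg nat

datatype test = Less opd opd | Equal opd opd | Neg test

datatype com =
    Skip
  | Move nat opd
  | Add nat opd opd
  | Sub nat opd opd
  | Load nat opd
  | Store opd opd
  | Seq com com
  | Cond test com com
  | While test com

text \<open>A state consists of the register contents and the memory contents.\<close>

type_synonym state = "(nat \<Rightarrow> nat) \<times> (nat \<Rightarrow> nat)"

fun val :: "opd \<Rightarrow> (nat \<Rightarrow> nat) \<Rightarrow> nat" where
  "val (Const k) R = k"
| "val (Reg x) R = R x"

text \<open>The number of binary digits (which is 0 for the number 0).\<close>

abbreviation len :: "nat \<Rightarrow> nat" where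
  "len k \<equiv> floorlog 2 k"

fun holds :: "test \<Rightarrow> (nat \<Rightarrow> nat) \<Rightarrow> bool" where
  "holds (Less a b) R \<longleftrightarrow> val a R < val b R"
| "holds (Equal a b) R \<longleftrightarrow> val a R = val b R"
| "holds (Neg b) R \<longleftrightarrow> \<not> holds b R"

fun test_cost :: "test \<Rightarrow> (nat \<Rightarrow> nat) \<Rightarrow> nat" where
  "test_cost (Less a b) R = 1 + len (val a R) + len (val b R)"
| "test_cost (Equal a b) R = 1 + len (val a R) + len (val b R)"
| "test_cost (Neg b) R = 1 + test_cost b R"

text \<open>
  \<open>exec c s t s'\<close>: started in state \<open>s\<close>, the program \<open>c\<close> halts in
  state \<open>s'\<close> after time exactly \<open>t\<close>.
\<close>

inductive exec :: "com \<Rightarrow> state \<Rightarrow> nat \<Rightarrow> state \<Rightarrow> bool" where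
  Skip: "exec Skip s 1 s"
| Move: "exec (Move x a) (R, M) (1 + len (val a R)) (R(x := val a R), M)"
| Add: "exec (Add x a b) (R, M) (1 + len (val a R) + len (val b R))
          (R(x := val a R + val b R), M)"
| Sub: "exec (Sub x a b) (R, M) (1 + len (val a R) + len (val b R))
          (R(x := val a R - val b R), M)"
| Load: "exec (Load x a) (R, M) (1 + len (val a R) + len (M (val a R)))
          (R(x := M (val a R)), M)"
| Store: "exec (Store a b) (R, M) (1 + len (val a R) + len (val b R))
          (R, M(val a R := val b R))"
| Seq: "exec c1 s1 t1 s2 \<Longrightarrow> exec c2 s2 t2 s3 \<Longrightarrow> exec (Seq c1 c2) s1 (t1 + t2) s3"
| CondTrue: "holds b (fst s) \<Longrightarrow> exec c1 s t s' \<Longrightarrow>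
     exec (Cond b c1 c2) s (test_cost b (fst s) + t) s'"
| CondFalse: "\<not> holds b (fst s) \<Longrightarrow> exec c2 s t s' \<Longrightarrow>
     exec (Cond b c1 c2) s (test_cost b (fst s) + t) s'"
| WhileFalse: "\<not> holds b (fst s) \<Longrightarrow> exec (While b c) s (test_cost b (fst s)) s"
| WhileTrue: "holds b (fst s1) \<Longrightarrow> exec c s1 t1 s2 \<Longrightarrow> exec (While b c) s2 t2 s3 \<Longrightarrow>
     exec (While b c) s1 (test_cost b (fst s1) + t1 + t2) s3"

inductive_cases exec_SkipE: "exec Skip s t s'"
inductive_cases exec_MoveE: "exec (Move x a) s t s'"
inductive_cases exec_AddE: "exec (Add x a b) s t s'"
inductive_cases exec_SubE: "exec (Sub x a b) s t s'"
inductive_cases exec_LoadE: "exec (Load x a) s t s'"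
inductive_cases exec_StoreE: "exec (Store a b) s t s'"
inductive_cases exec_SeqE: "exec (Seq c1 c2) s t s'"
inductive_cases exec_CondE: "exec (Cond b c1 c2) s t s'"
inductive_cases exec_WhileE: "exec (While b c) s t s'"

text \<open>
  Running time and final state are unique, so exhibiting one terminating
  run of a program describes its behaviour on the given input completely.
\<close>

lemma exec_deterministic:
  "exec c s t s' \<Longrightarrow> exec c s u s'' \<Longrightarrow> t = u \<and> s' = s''"
proof (induction arbitrary: u s'' rule: exec.induct)
  case Skip then show ?case by (auto elim: exec_SkipE)
next
  case Move then show ?case by (auto elim: exec_MoveE)
next
  case Add then show ?case by (auto elim: exec_AddE)
next
  case Sub then show ?case by (auto elim: exec_SubE)
next
  case Load then show ?case by (auto elim: exec_LoadE)
next
  case Store then show ?case by (auto elim: exec_StoreE)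
next
  case Seq
  from Seq.prems show ?case by (rule exec_SeqE) (use Seq.IH in blast)
next
  case CondTrue
  from CondTrue.prems show ?case by (rule exec_CondE) (use CondTrue in blast)+
next
  case CondFalse
  from CondFalse.prems show ?case by (rule exec_CondE) (use CondFalse in blast)+
next
  case WhileFalse
  from WhileFalse.prems show ?case by (rule exec_WhileE) (use WhileFalse in auto)
next
  case WhileTrue
  from WhileTrue.prems show ?case
    by (rule exec_WhileE) (use WhileTrue.hyps WhileTrue.IH in blast)+
qed

text \<open>
  The input graph has vertex set \<open>{..<n}\<close>. Initially register 0 contains \<open>n\<close>, the first
  \<open>n * n\<close> memory cells contain the adjacency matrix row by row, and everything else is 0.
\<close>

definition input :: "nat \<Rightarrow> nat set set \<Rightarrow> state" where
  "input n E =
     ((\<lambda>x. 0)(0 := n), (\<lambda>k. if k < n * n \<and> {k div n, k mod n} \<in> E then 1 else 0))"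

lemma input_matrix:
  assumes "i < n" "j < n"
  shows "snd (input n E) (i * n + j) = (if {i, j} \<in> E then 1 else 0)"
proof -
  have "i * n + j < Suc i * n" using assms by simp
  also have "\<dots> \<le> n * n" using assms by (intro mult_le_mono1) simp
  finally show ?thesis using assms by (simp add: input_def)
qed

text \<open>The answer of a halted program is read from register 0.\<close>

definition decides_in_time :: "com \<Rightarrow> state \<Rightarrow> bool \<Rightarrow> real \<Rightarrow> bool" where
  "decides_in_time p s b T \<longleftrightarrow>
     (\<exists>t R M. exec p s t (R, M) \<and> R 0 = (if b then 1 else 0) \<and> real t \<le> T)"

end

theory Submission
  imports Defs
begin

text \<open>
  A depth-first search keeps, for every vertex, one forbidden colour or none. The vertices
  without a forbidden colour are called unset. Once every vertex has a forbidden colour, a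
  proper colouring avoiding these colours is a 2-satisfiability problem. Guessing the colour of
  a vertex forbids it at its unset neighbours: this gives three branches for an unset vertex
  and two for the others.

  Let an unset vertex weigh 1 and any other vertex with an unset neighbour weigh 1/4. Guessing
  at unset vertices with at least four unset neighbours removes at least 4, at other vertices
  with at least three unset neighbours at least 2.5. As \<open>3 \<le> \<beta>^4\<close> and \<open>2 = \<beta>^(5/2)\<close> for
  \<open>\<beta> = 2^(2/5) < 1.32\<close>, removing weight \<open>w\<close> here costs a factor of at most \<open>\<beta>^w\<close> in the number
  of branches. Afterwards, since all degrees are at least 7, double counting bounds the remaining
  weight below by \<open>15/8\<close> for each unset vertex minus \<open>1/4\<close> for each edge between unset vertices.
  This pays for guessing at vertices with two or three unset neighbours, for two branches at each
  isolated edge, and for eight branches at each group of four isolated vertices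
  (\<open>8 = \<beta>^(4 * 15/8)\<close>).

  The first guess is made at a vertex of maximum degree, which leaves weight at most
  \<open>n - 1 - 3/4 * \<Delta>\<close>. The gap between \<open>\<beta>\<close> and 1.32 absorbs all polynomial factors.
\<close>

section \<open>A language with bounded loops\<close>

text \<open>The coefficients 15/8 and 1/4 come from the edges leaving the unset vertices. When no
  guess of the first kind is left, a vertex with a forbidden colour has at most two unset
  neighbours. With \<open>u\<close> unset vertices and \<open>e\<close> edges among them, at least
  \<open>7 * u - 2 * e\<close> edges lead to other vertices, hence to at least
  \<open>(7 * u - 2 * e) / 2\<close> of them, and the weight is at least
  \<open>u + (7 * u - 2 * e) / 8\<close>. Isolated vertices are grouped because two branches for a
  single one cost more than its 15/8 allows. For the same reason an isolated edge, worth 7/2, cannot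
  afford three branches. The machine model is a separate obstacle. The work at one node of the
  search tree is written in a language with bounded loops only, so that its runs are total functions
  and its cost is a polynomial read off the syntax. Only the loop over the nodes is unbounded, and
  its rounds are counted by the size of the tree. The gap between \<beta> and 1.32 is tiny, but it
  is raised to the power \<open>n - 0.73 * \<Delta>\<close>, which is at least
  \<open>0.27 * n\<close>; so it gains an exponential factor.\<close>

datatype exp =
    Num nat | Var nat | Plus exp exp | Minus exp exp | Times exp exp
  | Mem exp | Eq exp exp | Lt exp exp | Ite exp exp exp

fun eval :: "exp \<Rightarrow> state \<Rightarrow> nat" where
  "eval (Num c) s = c"
| "eval (Var x) s = fst s x"
| "eval (Plus a b) s = eval a s + eval b s"
| "eval (Minus a b) s = eval a s - eval b s"
| "eval (Times a b) s = eval a s * eval b s"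
| "eval (Mem a) s = snd s (eval a s)"
| "eval (Eq a b) s = (if eval a s = eval b s then 1 else 0)"
| "eval (Lt a b) s = (if eval a s < eval b s then 1 else 0)"
| "eval (Ite c a b) s = (if eval c s = 0 then eval b s else eval a s)"

datatype stm =
    Assign nat exp | Write exp exp | Sq stm stm | Ifnz exp stm stm | For nat exp stm

text \<open>The number of rounds of a \<open>For\<close> is fixed on entry, and every round resets
  the loop variable, so the body may overwrite it. Hence every program terminates.\<close>

primrec run :: "stm \<Rightarrow> state \<Rightarrow> state" where
  "run (Assign x e) = (\<lambda>s. ((fst s)(x := eval e s), snd s))"
| "run (Write a e) = (\<lambda>s. (fst s, (snd s)(eval a s := eval e s)))"
| "run (Sq p q) = (\<lambda>s. run q (run p s))"
| "run (Ifnz e p q) = (\<lambda>s. if eval e s = 0 then run q s else run p s)"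
| "run (For x e p) = (\<lambda>s. fold (\<lambda>i s. run p ((fst s)(x := i), snd s)) [0..<eval e s] s)"

text \<open>\<open>B\<close> limits what is stored in registers and memory and how often a loop
  runs. Addresses and intermediate results may be larger; they are computed from stored values and
  controlled by \<open>exp_bound\<close>.\<close>

primrec safe :: "nat \<Rightarrow> stm \<Rightarrow> state \<Rightarrow> bool" where
  "safe B (Assign x e) = (\<lambda>s. eval e s \<le> B)"
| "safe B (Write a e) = (\<lambda>s. eval e s \<le> B)"
| "safe B (Sq p q) = (\<lambda>s. safe B p s \<and> safe B q (run p s))"
| "safe B (Ifnz e p q) = (\<lambda>s. if eval e s = 0 then safe B q s else safe B p s)"
| "safe B (For x e p) = (\<lambda>s. eval e s \<le> B \<and> (\<forall>i<eval e s.
     safe B p ((\<lambda>s. ((fst s)(x := i), snd s))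
       (fold (\<lambda>i s. run p ((fst s)(x := i), snd s)) [0..<i] s))))"

section \<open>Total correctness together with the bound on stored values\<close>

definition wp :: "nat \<Rightarrow> stm \<Rightarrow> (state \<Rightarrow> bool) \<Rightarrow> state \<Rightarrow> bool" where
  "wp B p Q s \<longleftrightarrow> safe B p s \<and> Q (run p s)"

lemma wp_Assign: "wp B (Assign x e) Q (R, M) \<longleftrightarrow>
    eval e (R, M) \<le> B \<and> Q (R(x := eval e (R, M)), M)"
  by (simp add: wp_def)

lemma wp_Write: "wp B (Write a e) Q (R, M) \<longleftrightarrow>
    eval e (R, M) \<le> B \<and> Q (R, M(eval a (R, M) := eval e (R, M)))"
  by (simp add: wp_def)

lemma wp_Sq: "wp B (Sq p q) Q s \<longleftrightarrow> wp B p (wp B q Q) s"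
  by (auto simp: wp_def)

lemma wp_Ifnz: "wp B (Ifnz e p q) Q s \<longleftrightarrow> (if eval e s = 0 then wp B q Q s else wp B p Q s)"
  by (auto simp: wp_def)

lemmas wp_simps = wp_Assign wp_Write wp_Sq wp_Ifnz

lemma wp_mono: "wp B p Q s \<Longrightarrow> (\<And>R M. Q (R, M) \<Longrightarrow> Q' (R, M)) \<Longrightarrow> wp B p Q' s"
  by (cases "run p s") (auto simp: wp_def)

lemma wp_For:
  assumes N: "eval e (R, M) = N" "N \<le> B"
    and init: "I 0 R M"
    and step: "\<And>i R M. i < N \<Longrightarrow> I i R M \<Longrightarrow>
                 wp B p (\<lambda>(R, M). I (Suc i) R M) (R(x := i), M)"
    and post: "\<And>R M. I N R M \<Longrightarrow> Q (R, M)"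
  shows "wp B (For x e p) Q (R, M)"
proof -
  define st where
    "st i = fold (\<lambda>i s. run p ((fst s)(x := i), snd s)) [0..<i] (R, M)" for i
  have inv: "I i (fst (st i)) (snd (st i))" if "i \<le> N" for i
    using that
  proof (induction i)
    case 0
    then show ?case using init by (simp add: st_def)
  next
    case (Suc i)
    then have "wp B p (\<lambda>(R, M). I (Suc i) R M) ((fst (st i))(x := i), snd (st i))"
      by (intro step) auto
    then show ?case by (auto simp: st_def wp_def split: prod.splits)
  qed
  have "safe B p ((fst (st i))(x := i), snd (st i))" if "i < N" for i
    using step[OF that inv] that by (auto simp: wp_def)
  moreover have "Q (st N)" using post[OF inv[of N]] by simp
  ultimately show ?thesis using N by (auto simp: wp_def st_def)
qed

section \<open>Compilation\<close>

text \<open>The result is left in register \<open>k\<close>, with scratch space above it. The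
  machine cannot multiply, so a product is a repeated addition with one round for each unit of the
  second factor. This is affordable because all values stay polynomial in the stored
  numbers.\<close>

primrec compile_exp :: "nat \<Rightarrow> exp \<Rightarrow> com" where
  "compile_exp k (Num c) = Move k (Const c)"
| "compile_exp k (Var x) = Move k (Reg x)"
| "compile_exp k (Plus a b) = Seq (compile_exp k a) (Seq (compile_exp (k+1) b)
     (Add k (Reg k) (Reg (k+1))))"
| "compile_exp k (Minus a b) = Seq (compile_exp k a) (Seq (compile_exp (k+1) b)
     (Sub k (Reg k) (Reg (k+1))))"
| "compile_exp k (Times a b) = Seq (compile_exp (k+1) a) (Seq (compile_exp (k+2) b)
     (Seq (Move k (Const 0)) (While (Less (Const 0) (Reg (k+2)))
       (Seq (Add k (Reg k) (Reg (k+1))) (Sub (k+2) (Reg (k+2)) (Const 1))))))"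
| "compile_exp k (Mem a) = Seq (compile_exp k a) (Load k (Reg k))"
| "compile_exp k (Eq a b) = Seq (compile_exp k a) (Seq (compile_exp (k+1) b)
     (Cond (Equal (Reg k) (Reg (k+1))) (Move k (Const 1)) (Move k (Const 0))))"
| "compile_exp k (Lt a b) = Seq (compile_exp k a) (Seq (compile_exp (k+1) b)
     (Cond (Less (Reg k) (Reg (k+1))) (Move k (Const 1)) (Move k (Const 0))))"
| "compile_exp k (Ite c a b) = Seq (compile_exp k c)
     (Cond (Equal (Reg k) (Const 0)) (compile_exp k b) (compile_exp k a))"

text \<open>Loop bound and counter live in \<open>k\<close> and \<open>k+1\<close>. The body is
  compiled from \<open>k+2\<close> on and sees only a copy of the counter in \<open>x\<close>, so it
  cannot influence the number of rounds.\<close>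

primrec compile :: "nat \<Rightarrow> stm \<Rightarrow> com" where
  "compile k (Assign x e) = Seq (compile_exp k e) (Move x (Reg k))"
| "compile k (Write a e) = Seq (compile_exp k a) (Seq (compile_exp (k+1) e)
     (Store (Reg k) (Reg (k+1))))"
| "compile k (Sq p q) = Seq (compile k p) (compile k q)"
| "compile k (Ifnz e p q) = Seq (compile_exp k e)
     (Cond (Equal (Reg k) (Const 0)) (compile k q) (compile k p))"
| "compile k (For x e p) = Seq (compile_exp k e) (Seq (Move (k+1) (Const 0))
     (While (Less (Reg (k+1)) (Reg k)) (Seq (Move x (Reg (k+1)))
       (Seq (compile (k+2) p) (Add (k+1) (Reg (k+1)) (Const 1))))))"

primrec exp_vars :: "exp \<Rightarrow> nat set" where
  "exp_vars (Num c) = {}"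
| "exp_vars (Var x) = {x}"
| "exp_vars (Plus a b) = exp_vars a \<union> exp_vars b"
| "exp_vars (Minus a b) = exp_vars a \<union> exp_vars b"
| "exp_vars (Times a b) = exp_vars a \<union> exp_vars b"
| "exp_vars (Mem a) = exp_vars a"
| "exp_vars (Eq a b) = exp_vars a \<union> exp_vars b"
| "exp_vars (Lt a b) = exp_vars a \<union> exp_vars b"
| "exp_vars (Ite c a b) = exp_vars c \<union> exp_vars a \<union> exp_vars b"

primrec vars :: "stm \<Rightarrow> nat set" where
  "vars (Assign x e) = insert x (exp_vars e)"
| "vars (Write a e) = exp_vars a \<union> exp_vars e"
| "vars (Sq p q) = vars p \<union> vars q"
| "vars (Ifnz e p q) = exp_vars e \<union> vars p \<union> vars q"
| "vars (For x e p) = insert x (exp_vars e \<union> vars p)"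

section \<open>Cost of compiled programs\<close>

text \<open>
  Bit lengths are generously estimated by the numbers themselves: polynomial factors in
  the running time are irrelevant.
\<close>

lemma len_le: "len k \<le> k"
proof (cases "k = 0")
  case False
  then have "2 ^ (len k - 1) \<le> k" using floorlog_leD[of 2 k "len k"]
    by (metis One_nat_def Suc_1 bitlen_bounds floorlog_bounds gr0I lessI)
  moreover have "len k - 1 < 2 ^ (len k - 1)" by (rule less_exp)
  ultimately show ?thesis by linarith
qed (simp add: floorlog_def)

text \<open>Presupposes that variables and memory cells hold at most \<open>B\<close>. A conditional
  takes the sum of its branches rather than the maximum, which keeps the bound an expression in sums
  and products.\<close>

primrec exp_bound :: "exp \<Rightarrow> nat \<Rightarrow> nat" where
  "exp_bound (Num c) B = c"
| "exp_bound (Var x) B = B"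
| "exp_bound (Plus a b) B = exp_bound a B + exp_bound b B"
| "exp_bound (Minus a b) B = exp_bound a B"
| "exp_bound (Times a b) B = exp_bound a B * exp_bound b B"
| "exp_bound (Mem a) B = B"
| "exp_bound (Eq a b) B = 1"
| "exp_bound (Lt a b) B = 1"
| "exp_bound (Ite c a b) B = exp_bound a B + exp_bound b B"

primrec exp_cost :: "exp \<Rightarrow> nat \<Rightarrow> nat" where
  "exp_cost (Num c) B = 1 + c"
| "exp_cost (Var x) B = 1 + B"
| "exp_cost (Plus a b) B = exp_cost a B + exp_cost b B + (1 + exp_bound a B + exp_bound b B)"
| "exp_cost (Minus a b) B = exp_cost a B + exp_cost b B + (1 + exp_bound a B + exp_bound b B)"
| "exp_cost (Times a b) B = exp_cost a B + exp_cost b B + 2 + exp_bound b B +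
     exp_bound b B * (4 + 2 * exp_bound b B + exp_bound a B * exp_bound b B + exp_bound a B)"
| "exp_cost (Mem a) B = exp_cost a B + (1 + exp_bound a B + B)"
| "exp_cost (Eq a b) B = exp_cost a B + exp_cost b B + (3 + exp_bound a B + exp_bound b B)"
| "exp_cost (Lt a b) B = exp_cost a B + exp_cost b B + (3 + exp_bound a B + exp_bound b B)"
| "exp_cost (Ite c a b) B = exp_cost c B + exp_cost a B + exp_cost b B + (1 + exp_bound c B)"

primrec cost :: "stm \<Rightarrow> nat \<Rightarrow> nat" where
  "cost (Assign x e) B = exp_cost e B + (1 + exp_bound e B)"
| "cost (Write a e) B = exp_cost a B + exp_cost e B + (1 + exp_bound a B + exp_bound e B)"
| "cost (Sq p q) B = cost p B + cost q B"
| "cost (Ifnz e p q) B = exp_cost e B + (1 + exp_bound e B) + cost p B + cost q B"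
| "cost (For x e p) B = exp_cost e B + (2 + 2 * B) + B * (cost p B + (4 + 4 * B))"

section \<open>Correctness and running time of the compiled code\<close>

lemma eval_le_bound:
  assumes "\<And>x. x \<in> exp_vars e \<Longrightarrow> fst s x \<le> B" "\<And>a. snd s a \<le> B"
  shows "eval e s \<le> exp_bound e B"
  using assms
proof (induction e)
  case (Times a b)
  then show ?case by (simp add: mult_le_mono)
next
  case (Minus a b)
  then show ?case by (simp add: le_diff_conv trans_le_add1)
qed (auto intro: add_le_mono trans_le_add1 trans_le_add2)

lemma eval_cong:
  "(\<And>x. x \<in> exp_vars e \<Longrightarrow> R x = R' x) \<Longrightarrow> eval e (R, M) = eval e (R', M)"
  by (induction e) auto

lemma len_0_1: "len 0 = 0" "len (Suc 0) = 1"
  by (simp_all add: floorlog_def)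

lemma exec_witness2:
  "exec c s t (R', M) \<Longrightarrow> P t R' \<Longrightarrow> \<exists>t R'. exec c s t (R', M) \<and> P t R'"
  by blast

lemma exec_witness3:
  "exec c s t (R', M') \<Longrightarrow> P t R' M' \<Longrightarrow> \<exists>t R' M'. exec c s t (R', M') \<and> P t R' M'"
  by blast

text \<open>\<open>R k + R (k+1) * R (k+2)\<close> is invariant, so \<open>P\<close> bounds every
  value of the accumulator. A round costs at most \<open>1 + b\<close> for the test,
  \<open>1 + P + a\<close> for the addition and \<open>2 + b\<close> for the decrement; the final
  failing test accounts for the leading \<open>1 + b\<close>.\<close>

lemma exec_mult_loop:
  assumes "R k + R (k+1) * R (k+2) \<le> P" "R (k+1) \<le> a" "R (k+2) \<le> b"
  shows "\<exists>t R'. exec (While (Less (Const 0) (Reg (k+2)))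
       (Seq (Add k (Reg k) (Reg (k+1))) (Sub (k+2) (Reg (k+2)) (Const 1)))) (R, M) t (R', M) \<and>
     R' k = R k + R (k+1) * R (k+2) \<and> (\<forall>x<k. R' x = R x) \<and>
     t \<le> 1 + b + R (k+2) * (4 + 2 * b + P + a)"
  using assms
proof (induction "R (k+2)" arbitrary: R)
  case 0
  have "exec (While (Less (Const 0) (Reg (k+2)))
       (Seq (Add k (Reg k) (Reg (k+1))) (Sub (k+2) (Reg (k+2)) (Const 1)))) (R, M)
       (test_cost (Less (Const 0) (Reg (k+2))) (fst (R, M))) (R, M)"
    using 0 by (intro WhileFalse) simp
  moreover have "len (R (k+2)) \<le> b" using len_le[of "R (k+2)"] 0 by simp
  ultimately show ?case using 0 by (intro exI conjI) (auto simp: len_0_1)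
next
  case (Suc m)
  define R1 where "R1 = R(k := R k + R (k+1))"
  define R2 where "R2 = R1(k+2 := R (k+2) - 1)"
  have m: "m = R2 (k+2)" using Suc by (simp add: R2_def)
  have eq: "R2 k + R2 (k+1) * R2 (k+2) = R k + R (k+1) * R (k+2)"
    by (cases "R (k+2)") (use Suc(2) in \<open>auto simp: R2_def R1_def\<close>)
  have "\<exists>t R'. exec (While (Less (Const 0) (Reg (k+2)))
       (Seq (Add k (Reg k) (Reg (k+1))) (Sub (k+2) (Reg (k+2)) (Const 1)))) (R2, M) t (R', M) \<and>
     R' k = R2 k + R2 (k+1) * R2 (k+2) \<and> (\<forall>x<k. R' x = R2 x) \<and>
     t \<le> 1 + b + R2 (k+2) * (4 + 2 * b + P + a)"
    using Suc.prems Suc(2) by (intro Suc.hyps(1)[of R2, OF m])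
      (simp_all only: eq, simp_all add: R2_def R1_def)
  then obtain t R' where *: "exec (While (Less (Const 0) (Reg (k+2)))
       (Seq (Add k (Reg k) (Reg (k+1))) (Sub (k+2) (Reg (k+2)) (Const 1)))) (R2, M) t (R', M)"
     "R' k = R2 k + R2 (k+1) * R2 (k+2)" "\<forall>x<k. R' x = R2 x"
     "t \<le> 1 + b + R2 (k+2) * (4 + 2 * b + P + a)" by blast
  have body: "exec (Seq (Add k (Reg k) (Reg (k+1))) (Sub (k+2) (Reg (k+2)) (Const 1))) (R, M)
      ((1 + len (R k) + len (R (k+1))) + (1 + len (R (k+2)) + len 1)) (R2, M)"
    using Seq[OF Add[of k "Reg k" "Reg (k+1)" R M] Sub[of "k+2" "Reg (k+2)" "Const 1"]]
    by (simp add: R2_def R1_def)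
  have le: "len (R k) \<le> P" "len (R (k+1)) \<le> a" "len (R (k+2)) \<le> b" "len 1 \<le> 1"
    using len_le[of "R k"] len_le[of "R (k+1)"] len_le[of "R (k+2)"] len_le[of 1] Suc.prems
    by linarith+
  have "exec (While (Less (Const 0) (Reg (k+2)))
       (Seq (Add k (Reg k) (Reg (k+1))) (Sub (k+2) (Reg (k+2)) (Const 1)))) (R, M)
       (test_cost (Less (Const 0) (Reg (k+2))) (fst (R, M)) +
        ((1 + len (R k) + len (R (k+1))) + (1 + len (R (k+2)) + len 1)) + t) (R', M)"
    using Suc(2) by (intro WhileTrue[OF _ body *(1)]) simp
  moreover have "R' k = R k + R (k+1) * R (k+2)" using *(2) eq by simp
  moreover have "\<forall>x<k. R' x = R x" using *(3) by (simp add: R2_def R1_def)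
  moreover have "test_cost (Less (Const 0) (Reg (k+2))) (fst (R, M)) +
        ((1 + len (R k) + len (R (k+1))) + (1 + len (R (k+2)) + len 1)) + t
      \<le> 1 + b + R (k+2) * (4 + 2 * b + P + a)"
  proof -
    have "R (k+2) = Suc (R2 (k+2))" using m Suc(2) by simp
    then show ?thesis using le *(4) by (simp add: len_0_1)
  qed
  ultimately show ?case by blast
qed

lemma exec_compile_exp:
  assumes "exp_vars e \<subseteq> {..<k}" "\<And>x. x \<in> exp_vars e \<Longrightarrow> R x \<le> B" "\<And>a. M a \<le> B"
  shows "\<exists>t R'. exec (compile_exp k e) (R, M) t (R', M) \<and> R' k = eval e (R, M) \<and>
     (\<forall>x<k. R' x = R x) \<and> t \<le> exp_cost e B"
proof -
  \<comment> \<open>Shared by the binary operators. The second operand is evaluated after register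
    \<open>k\<close> has changed; its value is not affected because its variables lie below
    \<open>k\<close>.\<close>
  have two: "\<exists>ta tb R1 R2. exec (compile_exp k a) (R, M) ta (R1, M) \<and>
      exec (compile_exp (k+1) b) (R1, M) tb (R2, M) \<and> R2 k = eval a (R, M) \<and>
      R2 (k+1) = eval b (R, M) \<and> (\<forall>x<k. R2 x = R x) \<and> ta \<le> exp_cost a B \<and> tb \<le> exp_cost b B"
    if IHa: "\<And>k R. exp_vars a \<subseteq> {..<k} \<Longrightarrow> (\<And>x. x \<in> exp_vars a \<Longrightarrow> R x \<le> B) \<Longrightarrow>
        \<exists>t R'. exec (compile_exp k a) (R, M) t (R', M) \<and> R' k = eval a (R, M) \<and>
          (\<forall>x<k. R' x = R x) \<and> t \<le> exp_cost a B"
      and IHb: "\<And>k R. exp_vars b \<subseteq> {..<k} \<Longrightarrow> (\<And>x. x \<in> exp_vars b \<Longrightarrow> R x \<le> B) \<Longrightarrow>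
        \<exists>t R'. exec (compile_exp k b) (R, M) t (R', M) \<and> R' k = eval b (R, M) \<and>
          (\<forall>x<k. R' x = R x) \<and> t \<le> exp_cost b B"
      and pre: "exp_vars a \<union> exp_vars b \<subseteq> {..<k}" "\<And>x. x \<in> exp_vars a \<union> exp_vars b \<Longrightarrow> R x \<le> B"
    for a b k R
  proof -
    obtain ta R1 where 1: "exec (compile_exp k a) (R, M) ta (R1, M)" "R1 k = eval a (R, M)"
        "\<forall>x<k. R1 x = R x" "ta \<le> exp_cost a B"
      using IHa[of k R] pre by auto
    have "\<And>x. x \<in> exp_vars b \<Longrightarrow> R1 x = R x" using 1 pre by auto
    then obtain tb R2 where 2: "exec (compile_exp (k+1) b) (R1, M) tb (R2, M)"
        "R2 (k+1) = eval b (R1, M)" "\<forall>x<k+1. R2 x = R1 x" "tb \<le> exp_cost b B"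
      using IHb[of "k+1" R1] pre by fastforce
    moreover have "eval b (R1, M) = eval b (R, M)"
      by (rule eval_cong) (use 1 pre in auto)
    ultimately show ?thesis using 1 by (intro exI[of _ ta] exI[of _ tb] exI[of _ R1] exI[of _ R2]) auto
  qed
  note bnd = eval_le_bound[where s = "(R, M)" and B = B for R, simplified]
  have lenb: "len (eval e (R, M)) \<le> exp_bound e B" if "\<And>x. x \<in> exp_vars e \<Longrightarrow> R x \<le> B" for e R
    by (rule le_trans[OF len_le eval_le_bound]) (use that assms(3) in auto)
  show ?thesis using assms(1,2)
  proof (induction e arbitrary: k R)
    case (Num c)
    have ex: "exec (compile_exp k (Num c)) (R, M) (1 + len c) (R(k := c), M)"
      using Move[of k "Const c" R M] by simp
    show ?case by (rule exec_witness2[OF ex]) (use len_le[of c] in auto)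
  next
    case (Var y)
    have "len (R y) \<le> B" using len_le[of "R y"] Var by (simp add: le_trans)
    moreover have ex: "exec (compile_exp k (Var y)) (R, M) (1 + len (R y)) (R(k := R y), M)"
      using Move[of k "Reg y" R M] by simp
    ultimately show ?case by (intro exec_witness2[OF ex]) auto
  next
    case (Plus a b)
    obtain ta tb R1 R2 where *: "exec (compile_exp k a) (R, M) ta (R1, M)"
      "exec (compile_exp (k+1) b) (R1, M) tb (R2, M)" "R2 k = eval a (R, M)"
      "R2 (k+1) = eval b (R, M)" "\<forall>x<k. R2 x = R x" "ta \<le> exp_cost a B" "tb \<le> exp_cost b B"
      using two[OF Plus.IH, of k R] Plus.prems by auto
    have le: "len (eval a (R, M)) \<le> exp_bound a B" "len (eval b (R, M)) \<le> exp_bound b B"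
      by (rule lenb, use Plus.prems in simp)+
    show ?case unfolding compile_exp.simps
      by (rule exec_witness2[OF Seq[OF *(1) Seq[OF *(2) Add[of k "Reg k" "Reg (k+1)"]]]])
        (use * le in auto)
  next
    case (Minus a b)
    obtain ta tb R1 R2 where *: "exec (compile_exp k a) (R, M) ta (R1, M)"
      "exec (compile_exp (k+1) b) (R1, M) tb (R2, M)" "R2 k = eval a (R, M)"
      "R2 (k+1) = eval b (R, M)" "\<forall>x<k. R2 x = R x" "ta \<le> exp_cost a B" "tb \<le> exp_cost b B"
      using two[OF Minus.IH, of k R] Minus.prems by auto
    have le: "len (eval a (R, M)) \<le> exp_bound a B" "len (eval b (R, M)) \<le> exp_bound b B"
      by (rule lenb, use Minus.prems in simp)+
    show ?case unfolding compile_exp.simps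
      by (rule exec_witness2[OF Seq[OF *(1) Seq[OF *(2) Sub[of k "Reg k" "Reg (k+1)"]]]])
        (use * le in auto)
  next
    case (Times a b)
    obtain ta tb R1 R2 where *: "exec (compile_exp (k+1) a) (R, M) ta (R1, M)"
      "exec (compile_exp (k+2) b) (R1, M) tb (R2, M)" "R2 (k+1) = eval a (R, M)"
      "R2 (k+2) = eval b (R, M)" "\<forall>x<k+1. R2 x = R x" "ta \<le> exp_cost a B" "tb \<le> exp_cost b B"
      using two[OF Times.IH, of "k+1" R] Times.prems by fastforce
    have le: "eval a (R, M) \<le> exp_bound a B" "eval b (R, M) \<le> exp_bound b B"
      using bnd[of a R] bnd[of b R] Times.prems assms(3) by auto
    define R3 where "R3 = R2(k := 0)"
    have R3: "R3 k = 0" "R3 (k+1) = eval a (R, M)" "R3 (k+2) = eval b (R, M)" "\<forall>x<k. R3 x = R x"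
      using * by (auto simp: R3_def)
    have mv: "exec (Move k (Const 0)) (R2, M) 1 (R3, M)"
      using Move[of k "Const 0" R2 M] by (simp add: R3_def len_0_1)
    have "R3 k + R3 (k+1) * R3 (k+2) \<le> exp_bound a B * exp_bound b B"
      using R3 mult_le_mono[OF le] by simp
    note loop = exec_mult_loop[OF this, of "exp_bound a B" "exp_bound b B" M]
    obtain t R4 where **: "exec (While (Less (Const 0) (Reg (k+2)))
         (Seq (Add k (Reg k) (Reg (k+1))) (Sub (k+2) (Reg (k+2)) (Const 1)))) (R3, M) t (R4, M)"
        "R4 k = R3 k + R3 (k+1) * R3 (k+2)" "\<forall>x<k. R4 x = R3 x"
        "t \<le> 1 + exp_bound b B + R3 (k+2) *
          (4 + 2 * exp_bound b B + exp_bound a B * exp_bound b B + exp_bound a B)"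
      using loop le unfolding R3(2,3) by blast
    have "R3 (k+2) * (4 + 2 * exp_bound b B + exp_bound a B * exp_bound b B + exp_bound a B)
        \<le> exp_bound b B * (4 + 2 * exp_bound b B + exp_bound a B * exp_bound b B + exp_bound a B)"
      unfolding R3(3) using le(2) by (rule mult_le_mono1)
    then have "t \<le> 1 + exp_bound b B + exp_bound b B *
          (4 + 2 * exp_bound b B + exp_bound a B * exp_bound b B + exp_bound a B)"
      using **(4) by linarith
    then show ?case unfolding compile_exp.simps
      by (intro exec_witness2[OF Seq[OF *(1) Seq[OF *(2) Seq[OF mv **(1)]]]])
        (use *(6,7) **(2,3) R3 in auto)
  next
    case (Mem a)
    obtain t R' where *: "exec (compile_exp k a) (R, M) t (R', M)" "R' k = eval a (R, M)"
       "\<forall>x<k. R' x = R x" "t \<le> exp_cost a B"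
      using Mem.IH[of k R] Mem.prems by auto
    have "len (eval a (R, M)) \<le> exp_bound a B"
      by (rule lenb) (use Mem.prems in simp)
    moreover have "len (M (eval a (R, M))) \<le> B" using assms(3) len_le le_trans by blast
    ultimately show ?case unfolding compile_exp.simps
      by (intro exec_witness2[OF Seq[OF *(1) Load[of k "Reg k"]]]) (use * in auto)
  next
    case (Eq a b)
    obtain ta tb R1 R2 where *: "exec (compile_exp k a) (R, M) ta (R1, M)"
      "exec (compile_exp (k+1) b) (R1, M) tb (R2, M)" "R2 k = eval a (R, M)"
      "R2 (k+1) = eval b (R, M)" "\<forall>x<k. R2 x = R x" "ta \<le> exp_cost a B" "tb \<le> exp_cost b B"
      using two[OF Eq.IH, of k R] Eq.prems by auto
    let ?b = "Equal (Reg k) (Reg (k+1))"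
    have le: "len (eval a (R, M)) \<le> exp_bound a B" "len (eval b (R, M)) \<le> exp_bound b B"
      by (rule lenb, use Eq.prems in simp)+
    show ?case
    proof (cases "eval a (R, M) = eval b (R, M)")
      case True
      then have "exec (Cond ?b (Move k (Const 1)) (Move k (Const 0))) (R2, M)
          (test_cost ?b (fst (R2, M)) + (1 + len 1)) (R2(k := 1), M)"
        using Move[of k "Const 1" R2 M] * by (intro CondTrue) auto
      from Seq[OF *(1) Seq[OF *(2) this]] show ?thesis unfolding compile_exp.simps
        by (rule exec_witness2) (use True * le in \<open>auto simp: len_0_1\<close>)
    next
      case False
      then have "exec (Cond ?b (Move k (Const 1)) (Move k (Const 0))) (R2, M)
          (test_cost ?b (fst (R2, M)) + (1 + len 0)) (R2(k := 0), M)"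
        using Move[of k "Const 0" R2 M] * by (intro CondFalse) auto
      from Seq[OF *(1) Seq[OF *(2) this]] show ?thesis unfolding compile_exp.simps
        by (rule exec_witness2) (use False * le in \<open>auto simp: len_0_1\<close>)
    qed
  next
    case (Lt a b)
    obtain ta tb R1 R2 where *: "exec (compile_exp k a) (R, M) ta (R1, M)"
      "exec (compile_exp (k+1) b) (R1, M) tb (R2, M)" "R2 k = eval a (R, M)"
      "R2 (k+1) = eval b (R, M)" "\<forall>x<k. R2 x = R x" "ta \<le> exp_cost a B" "tb \<le> exp_cost b B"
      using two[OF Lt.IH, of k R] Lt.prems by auto
    let ?b = "Less (Reg k) (Reg (k+1))"
    have le: "len (eval a (R, M)) \<le> exp_bound a B" "len (eval b (R, M)) \<le> exp_bound b B"
      by (rule lenb, use Lt.prems in simp)+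
    show ?case
    proof (cases "eval a (R, M) < eval b (R, M)")
      case True
      then have "exec (Cond ?b (Move k (Const 1)) (Move k (Const 0))) (R2, M)
          (test_cost ?b (fst (R2, M)) + (1 + len 1)) (R2(k := 1), M)"
        using Move[of k "Const 1" R2 M] * by (intro CondTrue) auto
      from Seq[OF *(1) Seq[OF *(2) this]] show ?thesis unfolding compile_exp.simps
        by (rule exec_witness2) (use True * le in \<open>auto simp: len_0_1\<close>)
    next
      case False
      then have "exec (Cond ?b (Move k (Const 1)) (Move k (Const 0))) (R2, M)
          (test_cost ?b (fst (R2, M)) + (1 + len 0)) (R2(k := 0), M)"
        using Move[of k "Const 0" R2 M] * by (intro CondFalse) auto
      from Seq[OF *(1) Seq[OF *(2) this]] show ?thesis unfolding compile_exp.simps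
        by (rule exec_witness2) (use False * le in \<open>auto simp: len_0_1\<close>)
    qed
  next
    case (Ite c a b)
    obtain tc R1 where *: "exec (compile_exp k c) (R, M) tc (R1, M)" "R1 k = eval c (R, M)"
       "\<forall>x<k. R1 x = R x" "tc \<le> exp_cost c B"
      using Ite.IH(1)[of k R] Ite.prems by auto
    have le: "len (eval c (R, M)) \<le> exp_bound c B"
      by (rule lenb) (use Ite.prems in simp)
    have R1: "\<And>x. x \<in> exp_vars a \<union> exp_vars b \<Longrightarrow> R1 x = R x" using *(3) Ite.prems by auto
    have ev: "eval a (R1, M) = eval a (R, M)" "eval b (R1, M) = eval b (R, M)"
      by (rule eval_cong, simp add: R1)+
    obtain ta R2 where a: "exec (compile_exp k a) (R1, M) ta (R2, M)" "R2 k = eval a (R, M)"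
       "\<forall>x<k. R2 x = R1 x" "ta \<le> exp_cost a B"
      using Ite.IH(2)[of k R1] Ite.prems R1 unfolding ev by auto
    obtain tb R3 where b: "exec (compile_exp k b) (R1, M) tb (R3, M)" "R3 k = eval b (R, M)"
       "\<forall>x<k. R3 x = R1 x" "tb \<le> exp_cost b B"
      using Ite.IH(3)[of k R1] Ite.prems R1 unfolding ev by auto
    let ?b = "Equal (Reg k) (Const 0)"
    show ?case
    proof (cases "eval c (R, M) = 0")
      case True
      have "exec (Cond ?b (compile_exp k b) (compile_exp k a)) (R1, M) (test_cost ?b (fst (R1, M)) + tb) (R3, M)"
        using True * b by (intro CondTrue) auto
      from Seq[OF *(1) this] show ?thesis unfolding compile_exp.simps
        by (rule exec_witness2) (use True * le b in \<open>auto simp: len_0_1\<close>)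
    next
      case False
      have "exec (Cond ?b (compile_exp k b) (compile_exp k a)) (R1, M) (test_cost ?b (fst (R1, M)) + ta) (R2, M)"
        using False * a by (intro CondFalse) auto
      from Seq[OF *(1) this] show ?thesis unfolding compile_exp.simps
        by (rule exec_witness2) (use False * le a in \<open>auto simp: len_0_1\<close>)
    qed
  qed
qed

text \<open>Induction on the number of rounds left. Each test compares two numbers of at most
  \<open>B\<close> and so costs at most \<open>1 + 2 * B\<close>; there is one test per round and a
  final one.\<close>

lemma exec_loop:
  assumes body: "\<And>i R M. i < N \<Longrightarrow> I i R M \<Longrightarrow> R j = i \<Longrightarrow> R l = N \<Longrightarrow>
      \<exists>t R' M'. exec c (R, M) t (R', M') \<and> I (Suc i) R' M' \<and> R' j = Suc i \<and> R' l = N \<and> t \<le> T"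
    and N: "N \<le> B"
    and pre: "I i R M" "R j = i" "R l = N" "i \<le> N"
  shows "\<exists>t R' M'. exec (While (Less (Reg j) (Reg l)) c) (R, M) t (R', M') \<and> I N R' M' \<and>
      t \<le> 1 + 2 * B + (N - i) * (T + 1 + 2 * B)"
  using pre
proof (induction "N - i" arbitrary: i R M)
  case 0
  then have "i = N" by simp
  then have "exec (While (Less (Reg j) (Reg l)) c) (R, M)
      (test_cost (Less (Reg j) (Reg l)) (fst (R, M))) (R, M)"
    using 0 by (intro WhileFalse) auto
  moreover have "len N \<le> B" using len_le[of N] N by simp
  ultimately show ?case using 0 \<open>i = N\<close> by (intro exI conjI) auto
next
  case (Suc m)
  then have i: "i < N" by simp
  obtain t R1 M1 where 1: "exec c (R, M) t (R1, M1)" "I (Suc i) R1 M1" "R1 j = Suc i"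
      "R1 l = N" "t \<le> T"
    using body[OF i] Suc.prems by blast
  obtain u R2 M2 where 2: "exec (While (Less (Reg j) (Reg l)) c) (R1, M1) u (R2, M2)"
      "I N R2 M2" "u \<le> 1 + 2 * B + (N - Suc i) * (T + 1 + 2 * B)"
    using Suc.hyps(1)[of "Suc i" R1 M1, OF _ 1(2,3,4)] Suc.hyps(2) i
    by (metis Suc_leI Suc_diff_Suc old.nat.inject)
  have "exec (While (Less (Reg j) (Reg l)) c) (R, M)
      (test_cost (Less (Reg j) (Reg l)) (fst (R, M)) + t + u) (R2, M2)"
    using i Suc.prems by (intro WhileTrue[OF _ 1(1) 2(1)]) auto
  moreover have "len i \<le> B" "len N \<le> B" using len_le[of N] len_le[of i] i N by auto
  moreover have "N - i = Suc (N - Suc i)" using i by simp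
  ultimately show ?case using 1 2 Suc.prems by (intro exI conjI) auto
qed

text \<open>
  Registers below \<open>K\<close> belong to the program, those from \<open>k\<close> on are scratch space of the
  compiled code; \<open>R0\<close> is the register content in the semantics of the source program.
\<close>

lemma exec_compile:
  assumes "vars p \<subseteq> {..<K}" "K \<le> k" "\<And>x. x < K \<Longrightarrow> R x = R0 x" "safe B p (R0, M)"
    "\<And>x. x < K \<Longrightarrow> R0 x \<le> B" "\<And>a. M a \<le> B"
  shows "\<exists>t R' M'. exec (compile k p) (R, M) t (R', M') \<and> M' = snd (run p (R0, M)) \<and>
     (\<forall>x<K. R' x = fst (run p (R0, M)) x) \<and> (\<forall>x. K \<le> x \<longrightarrow> x < k \<longrightarrow> R' x = R x) \<and>
     (\<forall>x<K. R' x \<le> B) \<and> (\<forall>a. M' a \<le> B) \<and> t \<le> cost p B"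
proof -
  have expr: "\<exists>t R'. exec (compile_exp k e) (R, M) t (R', M) \<and> R' k = eval e (R0, M) \<and>
     (\<forall>x<k. R' x = R x) \<and> t \<le> exp_cost e B \<and> eval e (R0, M) \<le> exp_bound e B"
    if "exp_vars e \<subseteq> {..<K}" "K \<le> k" "\<And>x. x < K \<Longrightarrow> R x = R0 x"
       "\<And>x. x < K \<Longrightarrow> R0 x \<le> B" "\<And>a. M a \<le> B" for e k R R0 M
  proof -
    have "eval e (R, M) = eval e (R0, M)" by (rule eval_cong) (use that in auto)
    moreover have "eval e (R0, M) \<le> exp_bound e B" by (rule eval_le_bound) (use that in auto)
    moreover have "exp_vars e \<subseteq> {..<k}" using that by auto
    moreover have "\<And>x. x \<in> exp_vars e \<Longrightarrow> R x \<le> B" using that by auto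
    ultimately show ?thesis using exec_compile_exp[of e k R B M] that(5) by metis
  qed
  show ?thesis using assms
  proof (induction p arbitrary: k R R0 M)
    case (Assign x e)
    obtain t R' where *: "exec (compile_exp k e) (R, M) t (R', M)" "R' k = eval e (R0, M)"
      "\<forall>x<k. R' x = R x" "t \<le> exp_cost e B" "eval e (R0, M) \<le> exp_bound e B"
      using expr[of e k R R0 M] Assign.prems by auto
    have "len (eval e (R0, M)) \<le> exp_bound e B" using len_le *(5) le_trans by blast
    then show ?case unfolding compile.simps
      by (intro exec_witness3[OF Seq[OF *(1) Move[of x "Reg k"]]]) (use * Assign.prems in auto)
  next
    case (Write a e)
    obtain t R1 where 1: "exec (compile_exp k a) (R, M) t (R1, M)" "R1 k = eval a (R0, M)"
      "\<forall>x<k. R1 x = R x" "t \<le> exp_cost a B" "eval a (R0, M) \<le> exp_bound a B"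
      using expr[of a k R R0 M] Write.prems by auto
    obtain u R2 where 2: "exec (compile_exp (k+1) e) (R1, M) u (R2, M)" "R2 (k+1) = eval e (R0, M)"
      "\<forall>x<k+1. R2 x = R1 x" "u \<le> exp_cost e B" "eval e (R0, M) \<le> exp_bound e B"
      using expr[of e "k+1" R1 R0 M] Write.prems 1 by auto
    have M: "len (eval a (R0, M)) \<le> exp_bound a B" "len (eval e (R0, M)) \<le> exp_bound e B"
      using len_le 1(5) 2(5) le_trans by blast+
    let ?M = "M(eval a (R0, M) := eval e (R0, M))"
    have ex: "exec (compile k (Write a e)) (R, M)
        (t + (u + (1 + len (eval a (R0, M)) + len (eval e (R0, M))))) (R2, ?M)"
      using Seq[OF 1(1) Seq[OF 2(1) Store[of "Reg k" "Reg (k+1)"]]] 1 2 by simp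
    show ?case
      by (rule exec_witness3[OF ex]) (use 1 2 M Write.prems in auto)
  next
    case (Sq p q)
    obtain t R1 M1 where 1: "exec (compile k p) (R, M) t (R1, M1)" "M1 = snd (run p (R0, M))"
       "\<forall>x<K. R1 x = fst (run p (R0, M)) x" "\<forall>x. K \<le> x \<longrightarrow> x < k \<longrightarrow> R1 x = R x"
       "\<forall>x<K. R1 x \<le> B" "\<forall>a. M1 a \<le> B" "t \<le> cost p B"
      using Sq.IH(1)[of k R R0 M] Sq.prems by auto
    obtain u R2 M2 where 2: "exec (compile k q) (R1, M1) u (R2, M2)" "M2 = snd (run q (run p (R0, M)))"
       "\<forall>x<K. R2 x = fst (run q (run p (R0, M))) x" "\<forall>x. K \<le> x \<longrightarrow> x < k \<longrightarrow> R2 x = R1 x"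
       "\<forall>x<K. R2 x \<le> B" "\<forall>a. M2 a \<le> B" "u \<le> cost q B"
      using Sq.IH(2)[of k R1 "fst (run p (R0, M))" M1] Sq.prems 1 by auto
    show ?case unfolding compile.simps
      by (rule exec_witness3[OF Seq[OF 1(1) 2(1)]]) (use 1 2 in auto)
  next
    case (Ifnz e p q)
    obtain t R1 where 1: "exec (compile_exp k e) (R, M) t (R1, M)" "R1 k = eval e (R0, M)"
      "\<forall>x<k. R1 x = R x" "t \<le> exp_cost e B" "eval e (R0, M) \<le> exp_bound e B"
      using expr[of e k R R0 M] Ifnz.prems by auto
    have le: "len (eval e (R0, M)) \<le> exp_bound e B" using len_le 1(5) le_trans by blast
    let ?b = "Equal (Reg k) (Const 0)"
    show ?case
    proof (cases "eval e (R0, M) = 0")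
      case True
      obtain u R2 M2 where 2: "exec (compile k q) (R1, M) u (R2, M2)" "M2 = snd (run q (R0, M))"
         "\<forall>x<K. R2 x = fst (run q (R0, M)) x" "\<forall>x. K \<le> x \<longrightarrow> x < k \<longrightarrow> R2 x = R1 x"
         "\<forall>x<K. R2 x \<le> B" "\<forall>a. M2 a \<le> B" "u \<le> cost q B"
        using Ifnz.IH(2)[of k R1 R0 M] Ifnz.prems 1 True by auto
      have "exec (Cond ?b (compile k q) (compile k p)) (R1, M) (test_cost ?b (fst (R1, M)) + u) (R2, M2)"
        using True 1 2 by (intro CondTrue) auto
      from Seq[OF 1(1) this] show ?thesis unfolding compile.simps
        by (rule exec_witness3) (use True 1 2 le in \<open>auto simp: len_0_1\<close>)
    next
      case False
      obtain u R2 M2 where 2: "exec (compile k p) (R1, M) u (R2, M2)" "M2 = snd (run p (R0, M))"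
         "\<forall>x<K. R2 x = fst (run p (R0, M)) x" "\<forall>x. K \<le> x \<longrightarrow> x < k \<longrightarrow> R2 x = R1 x"
         "\<forall>x<K. R2 x \<le> B" "\<forall>a. M2 a \<le> B" "u \<le> cost p B"
        using Ifnz.IH(1)[of k R1 R0 M] Ifnz.prems 1 False by auto
      have "exec (Cond ?b (compile k q) (compile k p)) (R1, M) (test_cost ?b (fst (R1, M)) + u) (R2, M2)"
        using False 1 2 by (intro CondFalse) auto
      from Seq[OF 1(1) this] show ?thesis unfolding compile.simps
        by (rule exec_witness3) (use False 1 2 le in \<open>auto simp: len_0_1\<close>)
    qed
  next
    case (For y e p)
    obtain t R1 where 1: "exec (compile_exp k e) (R, M) t (R1, M)" "R1 k = eval e (R0, M)"
      "\<forall>x<k. R1 x = R x" "t \<le> exp_cost e B" "eval e (R0, M) \<le> exp_bound e B"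
      using expr[of e k R R0 M] For.prems by auto
    define N where "N = eval e (R0, M)"
    have N: "N \<le> B" using For.prems(4) by (simp add: N_def)
    \<comment> \<open>The source state before round \<open>i\<close>. The invariant \<open>I\<close>
      below ties the machine state to it.\<close>
    define st where "st i = fold (\<lambda>i s. run p ((fst s)(y := i), snd s)) [0..<i] (R0, M)" for i
    have st_Suc: "st (Suc i) = run p ((fst (st i))(y := i), snd (st i))" for i by (simp add: st_def)
    define I where "I i R' M' \<longleftrightarrow> M' = snd (st i) \<and> (\<forall>x<K. R' x = fst (st i) x) \<and>
       (\<forall>x. K \<le> x \<longrightarrow> x < k \<longrightarrow> R' x = R x) \<and> (\<forall>x<K. R' x \<le> B) \<and> (\<forall>a. M' a \<le> B)" for i R' M'
    define c where "c = Seq (Move y (Reg (k+1)))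
       (Seq (compile (k+2) p) (Add (k+1) (Reg (k+1)) (Const 1)))"
    \<comment> \<open>The extra \<open>3 + 2 * B\<close> pays for copying the counter,
      \<open>1 + len i\<close>, and for incrementing it, \<open>2 + len i\<close>.\<close>
    define T where "T = cost p B + 3 + 2 * B"
    have body: "\<exists>t R2 M2. exec c (R', M') t (R2, M2) \<and> I (Suc i) R2 M2 \<and> R2 (k+1) = Suc i \<and>
        R2 k = N \<and> t \<le> T"
      if i: "i < N" and I: "I i R' M'" and ri: "R' (k+1) = i" "R' k = N" for i R' M'
    proof -
      define R1 where "R1 = R'(y := i)"
      have y: "y < K" using For.prems by simp
      have leni: "len i \<le> B" using len_le[of i] i N by simp
      have mv: "exec (Move y (Reg (k+1))) (R', M') (1 + len i) (R1, M')"
        using Move[of y "Reg (k+1)" R' M'] ri by (simp add: R1_def)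
      have sf: "safe B p ((fst (st i))(y := i), M')"
        using For.prems(4) i I by (simp add: N_def st_def I_def)
      obtain u R2 M2 where 2: "exec (compile (k+2) p) (R1, M') u (R2, M2)"
         "M2 = snd (st (Suc i))" "\<forall>x<K. R2 x = fst (st (Suc i)) x"
         "\<forall>x. K \<le> x \<longrightarrow> x < k+2 \<longrightarrow> R2 x = R1 x"
         "\<forall>x<K. R2 x \<le> B" "\<forall>a. M2 a \<le> B" "u \<le> cost p B"
        using For.IH[of "k+2" R1 "(fst (st i))(y := i)" M'] For.prems I i N sf
        by (fastforce simp: R1_def I_def st_Suc)
      define R3 where "R3 = R2(k+1 := Suc i)"
      have R2: "R2 (k+1) = i" "R2 k = N" using 2(4) ri y For.prems(2) by (auto simp: R1_def)
      have ad: "exec (Add (k+1) (Reg (k+1)) (Const 1)) (R2, M2) (2 + len i) (R3, M2)"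
        using Add[of "k+1" "Reg (k+1)" "Const 1" R2 M2] R2 by (simp add: R3_def len_0_1)
      have ex: "exec c (R', M') (1 + len i + (u + (2 + len i))) (R3, M2)"
        unfolding c_def by (rule Seq[OF mv Seq[OF 2(1) ad]])
      moreover have "I (Suc i) R3 M2"
        using I 2 For.prems(2) y by (auto simp: I_def R3_def R1_def)
      ultimately show ?thesis using 2(7) leni R2
        by (intro exec_witness3[OF ex]) (auto simp: R3_def T_def)
    qed
    define R2 where "R2 = R1(k+1 := 0)"
    have mv: "exec (Move (k+1) (Const 0)) (R1, M) 1 (R2, M)"
      using Move[of "k+1" "Const 0" R1 M] by (simp add: R2_def len_0_1)
    have I0: "I 0 R2 M" using 1(3) For.prems by (auto simp: I_def st_def R2_def)
    obtain u R3 M3 where 3: "exec (While (Less (Reg (k+1)) (Reg k)) c) (R2, M) u (R3, M3)"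
       "I N R3 M3" "u \<le> 1 + 2 * B + (N - 0) * (T + 1 + 2 * B)"
      using exec_loop[where I = I and N = N and j = "k+1" and l = k and c = c and T = T and B = B,
          OF body N I0] 1(2)
      by (auto simp: R2_def N_def)
    have T: "T + 1 + 2 * B = cost p B + (4 + 4 * B)" by (simp add: T_def)
    have "N * (cost p B + (4 + 4 * B)) \<le> B * (cost p B + (4 + 4 * B))"
      using N by (intro mult_le_mono1)
    then have "t + (1 + u) \<le> cost (For y e p) B" using 3(3) 1(4)
      unfolding T cost.simps diff_zero by linarith
    moreover have ex: "exec (compile k (For y e p)) (R, M) (t + (1 + u)) (R3, M3)"
      using Seq[OF 1(1) Seq[OF mv 3(1)]] by (simp add: c_def)
    moreover have "run (For y e p) (R0, M) = st N" by (simp add: st_def N_def)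
    ultimately show ?case using 3(2) by (intro exec_witness3[OF ex]) (auto simp: I_def)
  qed
qed

section \<open>Polynomial bounds for the syntactic cost\<close>

definition poly_bounded :: "(nat \<Rightarrow> nat) \<Rightarrow> bool" where
  "poly_bounded f \<longleftrightarrow> (\<exists>C d. \<forall>B. f B \<le> C * (B + 1) ^ d)"

lemma poly_bounded_const: "poly_bounded (\<lambda>_. c)"
  unfolding poly_bounded_def by (intro exI[of _ c] exI[of _ 0]) simp

lemma poly_bounded_id: "poly_bounded (\<lambda>B. B)"
  unfolding poly_bounded_def by (intro exI[of _ 1]) simp

lemma poly_bounded_add:
  assumes "poly_bounded f" "poly_bounded g"
  shows "poly_bounded (\<lambda>B. f B + g B)"
proof -
  obtain C d C' d' where *: "\<And>B. f B \<le> C * (B + 1) ^ d" "\<And>B. g B \<le> C' * (B + 1) ^ d'"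
    using assms unfolding poly_bounded_def by blast
  have "f B + g B \<le> (C + C') * (B + 1) ^ (d + d')" for B
  proof -
    have "(B+1)^d \<le> (B+1)^(d+d')" "(B+1)^d' \<le> (B+1)^(d+d')" by (intro power_increasing; simp)+
    then have "C * (B+1)^d + C' * (B+1)^d' \<le> C * (B+1)^(d+d') + C' * (B+1)^(d+d')"
      by (intro add_mono mult_le_mono2)
    then show ?thesis using *[of B] by (simp add: algebra_simps)
  qed
  then show ?thesis unfolding poly_bounded_def by blast
qed

lemma poly_bounded_mult:
  assumes "poly_bounded f" "poly_bounded g"
  shows "poly_bounded (\<lambda>B. f B * g B)"
proof -
  obtain C d C' d' where *: "\<And>B. f B \<le> C * (B + 1) ^ d" "\<And>B. g B \<le> C' * (B + 1) ^ d'"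
    using assms unfolding poly_bounded_def by blast
  have "f B * g B \<le> (C * C') * (B + 1) ^ (d + d')" for B
    using mult_le_mono[OF *(1)[of B] *(2)[of B]] by (simp add: power_add mult_ac)
  then show ?thesis unfolding poly_bounded_def by blast
qed

lemmas poly_bounded_intros =
  poly_bounded_const poly_bounded_id poly_bounded_add poly_bounded_mult

lemma poly_bounded_exp_bound: "poly_bounded (exp_bound e)"
  by (induction e) (simp_all, (intro poly_bounded_intros | assumption)+)

lemma poly_bounded_exp_cost: "poly_bounded (exp_cost e)"
  by (induction e) (simp_all only: exp_cost.simps,
      (intro poly_bounded_intros poly_bounded_exp_bound | assumption)+)

lemma poly_bounded_cost: "poly_bounded (cost p)"
  by (induction p) (simp_all only: cost.simps,
      (intro poly_bounded_intros poly_bounded_exp_bound poly_bounded_exp_cost | assumption)+)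

section \<open>Two-list colouring\<close>

text \<open>The 2-satisfiability criterion for an implication graph closed under contraposition.
  Take a largest closed set without complementary literals. If it leaves \<open>p\<close> undecided,
  some literal \<open>r\<close> among \<open>p\<close> and \<open>neg p\<close> does not reach its
  own negation, and everything reachable from \<open>r\<close> can be added: if both
  \<open>q\<close> and \<open>neg q\<close> were reachable from \<open>r\<close>, then by
  contraposition \<open>q\<close>, and hence \<open>r\<close>, would reach
  \<open>neg r\<close>.\<close>

lemma two_sat:
  fixes R :: "('a \<times> 'a) set"
  assumes fin: "finite L" and RL: "R \<subseteq> L \<times> L"
    and neg: "\<And>p. p \<in> L \<Longrightarrow> neg p \<in> L" "\<And>p. p \<in> L \<Longrightarrow> neg (neg p) = p"
      "\<And>p. p \<in> L \<Longrightarrow> neg p \<noteq> p"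
    and skew: "\<And>p q. (p, q) \<in> R \<Longrightarrow> (neg q, neg p) \<in> R"
    and consistent: "\<And>p. p \<in> L \<Longrightarrow> (p, neg p) \<in> R\<^sup>+ \<Longrightarrow> (neg p, p) \<in> R\<^sup>+ \<Longrightarrow> False"
  shows "\<exists>S\<subseteq>L. (\<forall>p q. p \<in> S \<longrightarrow> (p, q) \<in> R \<longrightarrow> q \<in> S) \<and> (\<forall>p\<in>L. p \<in> S \<longleftrightarrow> neg p \<notin> S)"
proof -
  have skew': "(neg q, neg p) \<in> R\<^sup>*" if "(p, q) \<in> R\<^sup>*" for p q
    using that by induction (auto intro: skew converse_rtrancl_into_rtrancl)
  have L': "q \<in> L" if "(p, q) \<in> R\<^sup>*" "p \<in> L" for p q
    using that by induction (use RL in auto)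
  define good where "good S \<longleftrightarrow> S \<subseteq> L \<and> (\<forall>p q. p \<in> S \<longrightarrow> (p, q) \<in> R \<longrightarrow> q \<in> S) \<and>
      (\<forall>p\<in>S. neg p \<notin> S)" for S
  have "good {}" by (simp add: good_def)
  moreover have "\<forall>S. good S \<longrightarrow> card S < Suc (card L)"
    using fin by (auto simp: good_def less_Suc_eq_le intro: card_mono)
  ultimately have "\<exists>S. good S \<and> (\<forall>S'. good S' \<longrightarrow> card S' \<le> card S)"
    by (rule ex_has_greatest_nat)
  then obtain S where S: "good S" and max: "\<And>S'. good S' \<Longrightarrow> card S' \<le> card S" by blast
  have closed: "q \<in> S" if "(p, q) \<in> R\<^sup>*" "p \<in> S" for p q
    using that by induction (use S in \<open>auto simp: good_def\<close>)
  have total: "p \<in> S \<or> neg p \<in> S" if p: "p \<in> L" for p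
  proof (rule ccontr)
    assume not: "\<not> (p \<in> S \<or> neg p \<in> S)"
    \<comment> \<open>By consistency \<open>p\<close> and \<open>neg p\<close> do not both reach
      their negations.\<close>
    have "\<exists>r\<in>L. r \<notin> S \<and> neg r \<notin> S \<and> (r, neg r) \<notin> R\<^sup>+"
    proof (cases "(p, neg p) \<in> R\<^sup>+")
      case True
      then have "(neg p, neg (neg p)) \<notin> R\<^sup>+" using consistent[OF p] neg p by auto
      then show ?thesis using neg p not by (intro bexI[of _ "neg p"]) auto
    qed (use p not in auto)
    then obtain r where r: "r \<in> L" "r \<notin> S" "neg r \<notin> S" "(r, neg r) \<notin> R\<^sup>+" by blast
    have r': "(r, neg r) \<notin> R\<^sup>*" using r(4) neg(3)[OF r(1)] by (auto dest: rtranclD)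
    let ?S = "S \<union> R\<^sup>* `` {r}"
    have "good ?S" unfolding good_def
    proof (intro conjI allI ballI impI)
      show "?S \<subseteq> L" using S L' r(1) by (auto simp: good_def)
    next
      fix p q assume "p \<in> ?S" "(p, q) \<in> R"
      then show "q \<in> ?S" using S by (auto simp: good_def intro: rtrancl_into_rtrancl)
    next
      fix q assume q: "q \<in> ?S"
      then have qL: "q \<in> L" using S L' r(1) by (auto simp: good_def)
      show "neg q \<notin> ?S"
      proof
        assume nq: "neg q \<in> ?S"
        consider "q \<in> S" "neg q \<in> S" | "q \<in> S" "(r, neg q) \<in> R\<^sup>*"
          | "(r, q) \<in> R\<^sup>*" "neg q \<in> S" | "(r, q) \<in> R\<^sup>*" "(r, neg q) \<in> R\<^sup>*"
          using q nq by auto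
        then show False
        proof cases
          case 1
          then show False using S by (auto simp: good_def)
        next
          case 2
          then have "(q, neg r) \<in> R\<^sup>*" using skew'[OF 2(2)] neg(2)[OF qL] by simp
          then show False using closed 2 r by blast
        next
          case 3
          then show False using closed skew'[OF 3(1)] r by blast
        next
          case 4
          then have "(q, neg r) \<in> R\<^sup>*" using skew'[OF 4(2)] neg(2)[OF qL] by simp
          then show False using 4 r' by (meson rtrancl_trans)
        qed
      qed
    qed
    moreover have "card S < card ?S"
    proof (rule psubset_card_mono)
      show "finite ?S" using \<open>good ?S\<close> fin by (auto simp: good_def intro: finite_subset)
      show "S \<subset> ?S" using r(2) by auto
    qed
    ultimately show False using max[of ?S] by simp
  qed
  show ?thesis
    by (rule exI[of _ S]) (use S total neg in \<open>auto simp: good_def\<close>)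
qed

section \<open>Colourings with two allowed colours per vertex as a 2-satisfiability problem\<close>

locale coloring =
  fixes n :: nat and a :: "nat \<Rightarrow> nat \<Rightarrow> bool"
  assumes adj_sym: "a i j \<Longrightarrow> a j i" and adj_irrefl: "\<not> a i i"
begin

definition proper :: "(nat \<Rightarrow> nat) \<Rightarrow> bool" where
  "proper f \<longleftrightarrow> (\<forall>i<n. f i < 3) \<and> (\<forall>i<n. \<forall>j<n. a i j \<longrightarrow> f i \<noteq> f j)"

text \<open>
  A search state is a list of length \<open>n\<close>. Its \<open>i\<close>-th entry is a colour forbidden
  at vertex \<open>i\<close>, or 3 if no colour is forbidden there.
\<close>

definition feasible :: "nat list \<Rightarrow> bool" where
  "feasible g \<longleftrightarrow> (\<exists>f. proper f \<and> (\<forall>i<n. f i \<noteq> g ! i))"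

text \<open>The number \<open>3 * v + c\<close> stands for the literal that vertex \<open>v\<close> has colour \<open>c\<close>.\<close>

definition implies :: "nat list \<Rightarrow> nat \<Rightarrow> nat \<Rightarrow> nat \<Rightarrow> nat \<Rightarrow> bool" where
  "implies g v c u d \<longleftrightarrow> a v u \<and> c \<noteq> d \<and> c \<noteq> g ! v \<and> c \<noteq> g ! u \<and> d \<noteq> g ! u"

text \<open>If \<open>v\<close> takes the colour \<open>c\<close> and \<open>c\<close> is allowed at
  its neighbour \<open>u\<close>, then \<open>u\<close> is left with its other allowed colour
  \<open>d\<close>. If \<open>c\<close> is forbidden at \<open>u\<close> anyway, nothing follows and
  there is no edge.\<close>

definition implications :: "nat list \<Rightarrow> (nat \<times> nat) set" where
  "implications g = {(p, q). p < 3 * n \<and> q < 3 * n \<and>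
     implies g (p div 3) (p mod 3) (q div 3) (q mod 3)}"

lemma implications_literal:
  assumes "c < 3" "d < 3" "v < n" "u < n"
  shows "(3 * v + c, 3 * u + d) \<in> implications g \<longleftrightarrow> implies g v c u d"
proof -
  have "3 * v + c < 3 * n" "3 * u + d < 3 * n" using assms by linarith+
  moreover have "(3 * v + c) div 3 = v" "(3 * v + c) mod 3 = c" "(3 * u + d) div 3 = u"
    "(3 * u + d) mod 3 = d" using assms by simp_all
  ultimately show ?thesis unfolding implications_def by simp
qed

text \<open>The test ranges over all pairs of colours, which is easy to program. A pair containing
  the forbidden colour of \<open>v\<close> never lies on a cycle, since no implication starts at a
  forbidden literal.\<close>

definition two_list_test :: "nat list \<Rightarrow> bool" where
  "two_list_test g \<longleftrightarrow> \<not> (\<exists>v<n. \<exists>c<3. \<exists>d<3. c \<noteq> d \<and>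
     (3 * v + c, 3 * v + d) \<in> (implications g)\<^sup>+ \<and> (3 * v + d, 3 * v + c) \<in> (implications g)\<^sup>+)"

lemma third_colour:
  fixes c d e x :: nat
  assumes "c < 3" "d < 3" "e < 3" "c \<noteq> d" "c \<noteq> e" "d \<noteq> e" "x < 3" "x \<noteq> c" "x \<noteq> d"
  shows "x = e"
  using assms by linarith

lemma implications_sound:
  assumes f: "proper f" "\<forall>i<n. f i \<noteq> g ! i" and g: "\<forall>i<n. g ! i < 3"
    and pq: "(p, q) \<in> (implications g)\<^sup>+" and p: "f (p div 3) = p mod 3"
  shows "f (q div 3) = q mod 3"
proof -
  have step: "f (q div 3) = q mod 3" if "(p, q) \<in> implications g" "f (p div 3) = p mod 3" for p q
  proof -
    have lt: "p div 3 < n" "q div 3 < n" using that(1) by (auto simp: implications_def)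
    then have "f (p div 3) \<noteq> f (q div 3)" "f (q div 3) < 3"
      using f that(1) by (auto simp: implications_def implies_def proper_def)
    then show ?thesis
      using that f g lt
      by (intro third_colour[of "p mod 3" "g ! (q div 3)" "q mod 3"])
        (auto simp: implications_def implies_def)
  qed
  show ?thesis using pq p by induction (blast intro: step)+
qed

text \<open>An instance of \<open>two_sat\<close>: the literals are the allowed pairs of a vertex
  and a colour, and the negation of a literal is the other allowed colour at the same
  vertex.\<close>

lemma feasible_iff_two_list_test:
  assumes g: "\<forall>i<n. g ! i < 3"
  shows "feasible g \<longleftrightarrow> two_list_test g"
proof
  assume "feasible g"
  then obtain f where f: "proper f" "\<forall>i<n. f i \<noteq> g ! i" by (auto simp: feasible_def)
  show "two_list_test g"
    unfolding two_list_test_def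
  proof safe
    fix v c d :: nat
    assume *: "v < n" "c < 3" "d < 3" "c \<noteq> d"
      "(3 * v + c, 3 * v + d) \<in> (implications g)\<^sup>+" "(3 * v + d, 3 * v + c) \<in> (implications g)\<^sup>+"
    have "c \<noteq> g ! v" "d \<noteq> g ! v"
      using tranclD[OF *(5)] tranclD[OF *(6)] * by (auto simp: implications_def implies_def)
    moreover have "f v < 3" "f v \<noteq> g ! v" using f *(1) by (auto simp: proper_def)
    ultimately have "f v = c \<or> f v = d"
      using * g third_colour[of "g ! v" c d "f v"] by blast
    then show False
      using implications_sound[OF f g *(5)] implications_sound[OF f g *(6)] * by auto
  qed
next
  assume test: "two_list_test g"
  define L where "L = {p. p < 3 * n \<and> p mod 3 \<noteq> g ! (p div 3)}"
  \<comment> \<open>The colours 0, 1, 2 have sum 3, so subtracting two of them from 3 yields the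
    third.\<close>
  define neg where "neg p = 3 * (p div 3) + (3 - p mod 3 - g ! (p div 3))" for p
  have lt: "p div 3 < n" "g ! (p div 3) < 3" if "p < 3 * n" for p
    using that g by auto
  have thirdL: "3 - c - e < 3 \<and> 3 - c - e \<noteq> c \<and> 3 - c - e \<noteq> e \<and> 3 - (3 - c - e) - e = c"
    if "c < 3" "e < 3" "c \<noteq> e" for c e :: nat
  proof -
    have "c \<in> {0, 1, 2}" "e \<in> {0, 1, 2}" using that by auto
    then show ?thesis using that by auto
  qed
  have thirdU: "3 - d - e = c"
    if "c < 3" "d < 3" "e < 3" "c \<noteq> d" "c \<noteq> e" "d \<noteq> e" for c d e :: nat
    using that by linarith
  have neg: "neg p div 3 = p div 3" "neg p mod 3 = 3 - p mod 3 - g ! (p div 3)" "neg p \<in> L"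
    "neg (neg p) = p" "neg p \<noteq> p" if "p \<in> L" for p
  proof -
    have p: "p < 3 * n" "p mod 3 \<noteq> g ! (p div 3)" using that by (auto simp: L_def)
    note t = thirdL[OF _ lt(2)[OF p(1)] p(2)]
    show 1: "neg p div 3 = p div 3" and 2: "neg p mod 3 = 3 - p mod 3 - g ! (p div 3)"
      using t by (simp_all add: neg_def)
    have "neg p < 3 * (p div 3) + 3" using t by (simp add: neg_def)
    also have "\<dots> \<le> 3 * n" using lt(1)[OF p(1)] by linarith
    finally show "neg p \<in> L" using t 1 2 by (simp add: L_def)
    show "neg (neg p) = p" using t by (subst neg_def) (simp add: 1 2)
    show "neg p \<noteq> p"
    proof
      assume "neg p = p"
      then have "neg p mod 3 = p mod 3" by simp
      then show False using t 2 by simp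
    qed
  qed
  have sub: "implications g \<subseteq> L \<times> L" by (auto simp: implications_def implies_def L_def)
  have skew: "(neg q, neg p) \<in> implications g" if "(p, q) \<in> implications g" for p q
  proof -
    have pq: "p \<in> L" "q \<in> L" using that sub by auto
    have *: "p mod 3 \<noteq> q mod 3" "p mod 3 \<noteq> g ! (q div 3)" "q mod 3 \<noteq> g ! (q div 3)"
      "p mod 3 \<noteq> g ! (p div 3)" "a (p div 3) (q div 3)"
      using that by (auto simp: implications_def implies_def)
    have lts: "g ! (p div 3) < 3" "g ! (q div 3) < 3" using pq lt by (auto simp: L_def)
    have m3: "p mod 3 < 3" "q mod 3 < 3" by simp_all
    note tp = thirdL[OF m3(1) lts(1) *(4)]
    have "3 - q mod 3 - g ! (q div 3) = p mod 3"
      by (rule thirdU[OF m3 lts(2) *(1,2,3)])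
    moreover have "neg p < 3 * n" "neg q < 3 * n" using neg(3)[OF pq(1)] neg(3)[OF pq(2)]
      by (auto simp: L_def)
    moreover have "implies g (q div 3) (p mod 3) (p div 3) (3 - p mod 3 - g ! (p div 3))"
      unfolding implies_def using adj_sym[OF *(5)] tp *(2,4) by metis
    ultimately show ?thesis
      unfolding implications_def mem_Collect_eq prod.case neg(1,2)[OF pq(1)] neg(1,2)[OF pq(2)]
      by (simp only: simp_thms)
  qed
  have "\<exists>S\<subseteq>L. (\<forall>p q. p \<in> S \<longrightarrow> (p, q) \<in> implications g \<longrightarrow> q \<in> S) \<and>
      (\<forall>p\<in>L. p \<in> S \<longleftrightarrow> neg p \<notin> S)"
  proof (rule two_sat[where neg = neg, OF _ sub neg(3,4,5) skew])
    show "finite L" by (simp add: L_def)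
    fix p assume p: "p \<in> L" and cyc: "(p, neg p) \<in> (implications g)\<^sup>+" "(neg p, p) \<in> (implications g)\<^sup>+"
    have "3 * (p div 3) + p mod 3 = p" "3 * (p div 3) + neg p mod 3 = neg p"
      using neg(1)[OF p] by (metis mult_div_mod_eq)+
    moreover have "p mod 3 \<noteq> neg p mod 3" using neg(1,5)[OF p] by (metis mult_div_mod_eq)
    moreover have "p div 3 < n" using p lt by (simp add: L_def)
    ultimately show False using test cyc unfolding two_list_test_def
      by (metis mod_less_divisor zero_less_numeral)
  qed
  then obtain S where S: "S \<subseteq> L" "\<And>p q. p \<in> S \<Longrightarrow> (p, q) \<in> implications g \<Longrightarrow> q \<in> S"
    "\<And>p. p \<in> L \<Longrightarrow> p \<in> S \<longleftrightarrow> neg p \<notin> S" by blast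
  have ex: "\<exists>c<3. 3 * v + c \<in> S" if v: "v < n" for v
  proof -
    define c :: nat where "c = (if g ! v = 0 then 1 else 0)"
    have c: "c < 3" "c \<noteq> g ! v" by (auto simp: c_def)
    then have pL: "3 * v + c \<in> L" using v by (auto simp: L_def)
    show ?thesis
    proof (cases "3 * v + c \<in> S")
      case False
      then have "neg (3 * v + c) \<in> S" using S(3)[OF pL] by blast
      moreover have "neg (3 * v + c) div 3 = v" using neg(1)[OF pL] c(1) by simp
      then have "3 * v + neg (3 * v + c) mod 3 = neg (3 * v + c)"
        using mult_div_mod_eq[of 3 "neg (3 * v + c)"] by simp
      ultimately show ?thesis by (intro exI[of _ "neg (3 * v + c) mod 3"]) simp
    qed (use c in auto)
  qed
  define f where "f v = (SOME c. c < 3 \<and> 3 * v + c \<in> S)" for v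
  have f: "f v < 3" "3 * v + f v \<in> S" if "v < n" for v
    using someI_ex[OF ex[OF that]] by (simp_all add: f_def)
  have fg: "f v \<noteq> g ! v" if "v < n" for v
  proof -
    have "3 * v + f v \<in> L" using f[OF that] S(1) by blast
    then show ?thesis using f[OF that] by (auto simp: L_def)
  qed
  have "f v \<noteq> f u" if vu: "v < n" "u < n" "a v u" for v u
  proof
    assume eq: "f v = f u"
    \<comment> \<open>The other allowed colour of \<open>u\<close>. The colour of \<open>v\<close>
      implies it, although its negation, the literal of \<open>u\<close> with colour
      \<open>f u\<close>, was selected.\<close>
    define d where "d = 3 - f u - g ! u"
    have d: "d < 3" "d \<noteq> f u" "d \<noteq> g ! u" using thirdL[of "f u" "g ! u"] f(1)[OF vu(2)] fg[OF vu(2)] g vu(2)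
      unfolding d_def by blast+
    have "(3 * v + f v, 3 * u + d) \<in> implications g"
      unfolding implications_literal[OF f(1)[OF vu(1)] d(1) vu(1,2)] implies_def
      using vu fg d eq by metis
    then have "3 * u + d \<in> S" using S(2) f vu by blast
    moreover have "neg (3 * u + f u) = 3 * u + d" using f[OF vu(2)] by (simp add: neg_def d_def)
    moreover have "3 * u + f u \<in> S" "3 * u + f u \<in> L" using f[OF vu(2)] S(1) by auto
    ultimately show False using S(3) by metis
  qed
  then have "proper f" using f by (auto simp: proper_def)
  then show "feasible g" using fg by (auto simp: feasible_def)
qed

end

section \<open>The branching rules\<close>

text \<open>
  Eight words of length 4, found by computer search. With nine words, the bound on the running
  time would not be met.
\<close>

definition cover_words :: "nat list" where
  "cover_words =
    [0,0,0,0, 0,1,1,1, 0,1,2,2, 1,0,1,1, 1,0,2,2, 1,1,0,0, 2,2,1,2, 2,2,2,1]"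

text \<open>The words serve as vectors of forbidden colours: every colouring of four vertices must
  avoid one of them at all four places. A word is avoided by 16 of the 81 colourings, so at least
  six words are necessary. The proof checks all 81 cases.\<close>

lemma cover_words_cover:
  fixes w x y z :: nat
  assumes "w < 3" "x < 3" "y < 3" "z < 3"
  shows "\<exists>k<8. w \<noteq> cover_words ! (4 * k) \<and> x \<noteq> cover_words ! (4 * k + 1) \<and>
    y \<noteq> cover_words ! (4 * k + 2) \<and> z \<noteq> cover_words ! (4 * k + 3)"
proof -
  have "{..<8::nat} = {0,1,2,3,4,5,6,7}" by auto
  moreover have "\<exists>k\<in>{0,1,2,3,4,5,6,7}. w \<noteq> cover_words ! (4 * k) \<and> x \<noteq> cover_words ! (4 * k + 1) \<and>
    y \<noteq> cover_words ! (4 * k + 2) \<and> z \<noteq> cover_words ! (4 * k + 3)"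
  proof -
    have "w = 0 \<or> w = 1 \<or> w = 2" "x = 0 \<or> x = 1 \<or> x = 2" "y = 0 \<or> y = 1 \<or> y = 2"
      "z = 0 \<or> z = 1 \<or> z = 2" using assms by linarith+
    then show ?thesis by (elim disjE) (simp_all add: cover_words_def)
  qed
  ultimately show ?thesis by (metis lessThan_iff)
qed

lemma cover_words_less:
  assumes "k < 8" "r < 4"
  shows "cover_words ! (4 * k + r) < 3"
proof -
  have "list_all (\<lambda>c. c < 3) cover_words" by (simp add: cover_words_def)
  moreover have "length cover_words = 32" by (simp add: cover_words_def)
  moreover have "4 * k + r < 32" using assms by linarith
  ultimately show ?thesis by (simp add: list_all_length)
qed

text \<open>Numbers the elements of \<open>F\<close> in increasing order. This assigns the letters
  of a word to the first four unset vertices.\<close>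

lemma bij_betw_rank:
  fixes F :: "nat set"
  assumes "finite F"
  shows "bij_betw (\<lambda>i. card {j \<in> F. j < i}) F {..<card F}"
proof -
  let ?r = "\<lambda>i. card {j \<in> F. j < i}"
  have mono: "?r i < ?r j" if "i \<in> F" "i < j" for i j
    using assms that by (intro psubset_card_mono) auto
  have inj: "inj_on ?r F"
  proof (rule inj_onI)
    fix i j assume "i \<in> F" "j \<in> F" "?r i = ?r j"
    then show "i = j" using mono[of i j] mono[of j i] by (metis less_irrefl linorder_neqE_nat)
  qed
  have "?r ` F \<subseteq> {..<card F}"
  proof clarsimp
    fix i assume "i \<in> F"
    then show "?r i < card F" using assms by (intro psubset_card_mono) auto
  qed
  then have "?r ` F = {..<card F}" using card_image[OF inj] by (intro card_subset_eq) auto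
  then show ?thesis using inj by (simp add: bij_betw_def)
qed

context coloring
begin

definition unset :: "nat list \<Rightarrow> nat set" where
  "unset g = {i. i < n \<and> g ! i = 3}"

definition udeg :: "nat list \<Rightarrow> nat \<Rightarrow> nat" where
  "udeg g v = card {j \<in> unset g. a v j}"

text \<open>A vertex that has a forbidden colour gets a bonus of 1, so that three unset neighbours
  already give score 4. Thus a maximal score of at least 4 means precisely that a guess of the first
  kind exists. With fewer than three unset neighbours such a vertex would not pay for two branches,
  and score 0 keeps it from being chosen.\<close>

definition score :: "nat list \<Rightarrow> nat \<Rightarrow> nat" where
  "score g v = (if g ! v = 3 then udeg g v else if 3 \<le> udeg g v then Suc (udeg g v) else 0)"

text \<open>The prefix length \<open>m\<close> serves induction and the loop invariant of the
  program. The vertex is meaningful only for a positive score; \<open>(0, 0)\<close> is the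
  default.\<close>

definition select_upto :: "nat list \<Rightarrow> nat \<Rightarrow> nat \<times> nat" where
  "select_upto g m = fold (\<lambda>v (b, w). if b < score g v then (score g v, v) else (b, w)) [0..<m] (0, 0)"

abbreviation "select g \<equiv> select_upto g n"

text \<open>The guess that \<open>v\<close> has colour \<open>k\<close> is recorded only by
  forbidding \<open>k\<close> at the unset neighbours. An unset \<open>v\<close> merely receives
  some forbidden colour other than \<open>k\<close>, and may still take either of the two remaining
  colours. This relaxation is sound, since any colouring of the child is also one of the parent, and
  it settles \<open>v\<close> at no extra cost.\<close>

definition star_child :: "nat list \<Rightarrow> nat \<Rightarrow> nat \<Rightarrow> nat list" where
  "star_child g v k = map (\<lambda>i. if g ! i = 3 \<and> a v i then k
     else if g ! i = 3 \<and> i = v then (if k = 0 then 1 else 0) else g ! i) [0..<n]"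

definition rank :: "nat list \<Rightarrow> nat \<Rightarrow> nat" where
  "rank g i = card {j \<in> unset g. j < i}"

definition cover_child :: "nat list \<Rightarrow> nat \<Rightarrow> nat list" where
  "cover_child g k = map (\<lambda>i. if g ! i = 3 \<and> rank g i < 4 then cover_words ! (4 * k + rank g i)
     else g ! i) [0..<n]"

text \<open>
  The third colour can be omitted for an isolated edge of unset vertices: a proper colouring
  of the edge gives its first end a colour other than 0 and its second end a colour other
  than 1, or vice versa.
\<close>

definition star_colours :: "nat list \<Rightarrow> nat list" where
  "star_colours g = (case select g of (b, v) \<Rightarrow>
     filter (\<lambda>k. k \<noteq> g ! v \<and> \<not> (b = 1 \<and> k = 2)) [0..<3])"

definition children :: "nat list \<Rightarrow> nat list list" where
  "children g = (case select g of (b, v) \<Rightarrow>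
     if 0 < b then map (star_child g v) (star_colours g)
     else if unset g \<noteq> {} then map (cover_child g) [0..<8] else [])"

definition valid :: "nat list \<Rightarrow> bool" where
  "valid g \<longleftrightarrow> length g = n \<and> (\<forall>i<n. g ! i \<le> 3)"

lemma finite_unset [simp]: "finite (unset g)"
  by (simp add: unset_def)

lemma select_upto_spec:
  "select_upto g m = (b, v) \<Longrightarrow> (\<forall>w<m. score g w \<le> b) \<and> (0 < b \<longrightarrow> v < m \<and> score g v = b)"
proof (induction m arbitrary: b v)
  case (Suc m)
  obtain b' v' where *: "select_upto g m = (b', v')" by fastforce
  show ?case using Suc.IH[OF *] Suc.prems *
    by (auto simp: select_upto_def less_Suc_eq split: if_splits)
qed (simp add: select_upto_def)

lemma length_star_child [simp]: "length (star_child g v k) = n"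
  by (simp add: star_child_def)

lemma length_cover_child [simp]: "length (cover_child g k) = n"
  by (simp add: cover_child_def)

lemma star_child_nth: "i < n \<Longrightarrow> star_child g v k ! i = (if g ! i = 3 \<and> a v i then k
     else if g ! i = 3 \<and> i = v then (if k = 0 then 1 else 0) else g ! i)"
  by (auto simp: star_child_def)

lemma cover_child_nth: "i < n \<Longrightarrow> cover_child g k ! i =
    (if g ! i = 3 \<and> rank g i < 4 then cover_words ! (4 * k + rank g i) else g ! i)"
  by (simp add: cover_child_def)

lemma unset_star_child: "k < 3 \<Longrightarrow> unset (star_child g v k) = unset g - {i \<in> unset g. i = v \<or> a v i}"
  by (auto simp: unset_def star_child_nth split: if_splits)

lemma unset_cover_child: "k < 8 \<Longrightarrow> unset (cover_child g k) = unset g - {i \<in> unset g. rank g i < 4}"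
  using cover_words_less[of k "rank g i" for i]
  by (auto simp: unset_def cover_child_nth split: if_splits) (metis less_irrefl)

lemma score_pos: "0 < score g v \<Longrightarrow> 0 < udeg g v"
  by (auto simp: score_def split: if_splits)

text \<open>Behind three things: the recursion of \<open>nodes\<close> terminates, the linear factor
  in the bounds on \<open>nodes\<close> pays for inner nodes, and the stack stays low.\<close>

lemma children_unset:
  assumes "h \<in> set (children g)"
  shows "card (unset h) < card (unset g)"
proof -
  obtain b v where s: "select g = (b, v)" by fastforce
  have "unset h \<subset> unset g"
  proof (cases "0 < b")
    case True
    then have "0 < udeg g v" using select_upto_spec[OF s] score_pos by metis
    then obtain j where "j \<in> unset g" "a v j"
      unfolding udeg_def card_gt_0_iff by blast
    moreover obtain k where "h = star_child g v k" "k < 3"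
      using assms s True by (auto simp: children_def star_colours_def)
    ultimately show ?thesis by (auto simp: unset_star_child)
  next
    case False
    then have "unset g \<noteq> {}" "h \<in> cover_child g ` {..<8}"
      using assms s by (auto simp: children_def split: if_splits)
    then obtain k where k: "h = cover_child g k" "k < 8" "unset g \<noteq> {}" by blast
    define i where "i = Min (unset g)"
    have i: "i \<in> unset g" "\<And>j. j \<in> unset g \<Longrightarrow> \<not> j < i"
      using k(3) by (auto simp: i_def not_less)
    then have "{j \<in> unset g. j < i} = {}" by blast
    then have "rank g i = 0" by (simp add: rank_def)
    then have "i \<notin> unset h" "unset h \<subseteq> unset g" using k by (simp_all add: unset_cover_child)
    then show ?thesis using i(1) by blast
  qed
  then show ?thesis by (intro psubset_card_mono) auto
qed

lemma valid_star_child: "valid g \<Longrightarrow> k < 3 \<Longrightarrow> valid (star_child g v k)"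
  by (simp add: valid_def star_child_nth)

lemma valid_cover_child: "valid g \<Longrightarrow> k < 8 \<Longrightarrow> valid (cover_child g k)"
  using cover_words_less[of k "rank g i" for i]
  by (simp add: valid_def cover_child_nth less_imp_le)

lemma children_valid: "valid g \<Longrightarrow> h \<in> set (children g) \<Longrightarrow> valid h"
  by (auto simp: children_def star_colours_def valid_star_child valid_cover_child
      split: prod.splits if_splits)

lemma feasible_mono:
  assumes "feasible h" "\<And>i. i < n \<Longrightarrow> g ! i \<noteq> 3 \<Longrightarrow> h ! i = g ! i"
  shows "feasible g"
proof -
  obtain f where f: "proper f" "\<forall>i<n. f i \<noteq> h ! i" using assms(1) by (auto simp: feasible_def)
  have "f i \<noteq> g ! i" if "i < n" for i
    using f that assms(2)[OF that] by (cases "g ! i = 3") (auto simp: proper_def)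
  then show ?thesis using f(1) by (auto simp: feasible_def)
qed

text \<open>A child only adds restrictions, which gives one direction. For the other, a colouring
  \<open>f\<close> survives in the star child for the colour \<open>f v\<close>, if that colour is
  tried, or in a cover child whose word it avoids.\<close>

lemma feasible_children:
  assumes "children g \<noteq> []"
  shows "feasible g \<longleftrightarrow> (\<exists>h\<in>set (children g). feasible h)"
proof
  assume "\<exists>h\<in>set (children g). feasible h"
  then obtain h where h: "h \<in> set (children g)" "feasible h" by blast
  have "h ! i = g ! i" if "i < n" "g ! i \<noteq> 3" for i
    using h(1) that
    by (auto simp: children_def star_child_nth cover_child_nth split: prod.splits if_splits)
  then show "feasible g" using feasible_mono[OF h(2)] by blast
next
  assume "feasible g"
  then obtain f where f: "proper f" "\<And>i. i < n \<Longrightarrow> f i \<noteq> g ! i" by (auto simp: feasible_def)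
  have f3: "f i < 3" if "i < n" for i using f(1) that by (auto simp: proper_def)
  obtain b v where s: "select g = (b, v)" by fastforce
  show "\<exists>h\<in>set (children g). feasible h"
  proof (cases "0 < b")
    case True
    then have v: "v < n" "score g v = b" using select_upto_spec[OF s] by auto
    show ?thesis
    proof (cases "b = 1 \<and> f v = 2")
      case False
      have "f v \<in> set (star_colours g)"
        using False f(2)[OF v(1)] f3[OF v(1)] s by (auto simp: star_colours_def)
      moreover have "f i \<noteq> star_child g v (f v) ! i" if "i < n" for i
      proof -
        have "a v i \<Longrightarrow> f v \<noteq> f i" using f(1) v(1) that by (auto simp: proper_def)
        then show ?thesis using f(2)[OF that] that by (auto simp: star_child_nth)
      qed
      ultimately show ?thesis using True s f(1)
        by (intro bexI[of _ "star_child g v (f v)"]) (auto simp: feasible_def children_def)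
    next
      case b: True
      then have "g ! v = 3" "udeg g v = 1"
        using v(2) by (auto simp: score_def split: if_splits)
      then have g: "g ! v = 3" "card {j \<in> unset g. a v j} = 1" by (simp_all add: udeg_def)
      then obtain w where w: "{j \<in> unset g. a v j} = {w}" by (auto simp: card_1_singleton_iff)
      then have wn: "w < n" "a v w" by (auto simp: unset_def)
      have "f w \<noteq> 2" using f(1) v wn b by (force simp: proper_def)
      \<comment> \<open>The omitted branch is \<open>f v = 2\<close>. Then \<open>f w\<close> is 0
        or 1, and \<open>k\<close> is the other one of these two. Forbidding \<open>k\<close> at
        \<open>w\<close> and \<open>1 - k\<close> at \<open>v\<close> is respected by
        \<open>f\<close>, although \<open>v\<close> does not have colour \<open>k\<close>.\<close>
      define k :: nat where "k = (if f w = 0 then 1 else 0)"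
      have "k \<in> set (star_colours g)"
        using g s by (auto simp: star_colours_def k_def)
      moreover have "f i \<noteq> star_child g v k ! i" if i: "i < n" for i
      proof (cases "g ! i = 3")
        case True
        then have "i = w" if "a v i" using w i that by (auto simp: unset_def)
        then show ?thesis using i True b \<open>f w \<noteq> 2\<close> f3[OF i] by (auto simp: star_child_nth k_def)
      qed (use f(2)[OF i] i in \<open>simp add: star_child_nth\<close>)
      ultimately show ?thesis using True s f(1)
        by (intro bexI[of _ "star_child g v k"]) (auto simp: feasible_def children_def)
    qed
  next
    case False
    then have U: "unset g \<noteq> {}" "children g = map (cover_child g) [0..<8]"
      using assms s by (auto simp: children_def split: if_splits)
    \<comment> \<open>The colours of the unset vertices in increasing order, padded with 0 so that
      there are always four letters.\<close>
    define w where "w r = (if r < card (unset g) then f (THE i. i \<in> unset g \<and> rank g i = r) else 0)" for r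
    note bij = bij_betw_rank[OF finite_unset[of g], folded rank_def]
    have wr: "w (rank g i) = f i" if i: "i \<in> unset g" for i
    proof -
      have "(THE j. j \<in> unset g \<and> rank g j = rank g i) = i"
        using bij i by (intro the_equality) (auto simp: bij_betw_def dest: inj_onD)
      moreover have "rank g i < card (unset g)" using bij_betwE[OF bij] i by blast
      ultimately show ?thesis by (simp add: w_def)
    qed
    have w3: "w r < 3" for r
    proof (cases "r < card (unset g)")
      case True
      then have "r \<in> rank g ` unset g" using bij by (simp add: bij_betw_def)
      then obtain i where "i \<in> unset g" "rank g i = r" by blast
      then show ?thesis using wr f3 by (auto simp: unset_def)
    qed (simp add: w_def)
    obtain k where k: "k < 8" "w 0 \<noteq> cover_words ! (4 * k)" "w 1 \<noteq> cover_words ! (4 * k + 1)"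
       "w 2 \<noteq> cover_words ! (4 * k + 2)" "w 3 \<noteq> cover_words ! (4 * k + 3)"
      using cover_words_cover[OF w3[of 0] w3[of 1] w3[of 2] w3[of 3]] by blast
    have avoid: "w r \<noteq> cover_words ! (4 * k + r)" if "r < 4" for r
    proof -
      have "r = 0 \<or> r = 1 \<or> r = 2 \<or> r = 3" using that by linarith
      then show ?thesis using k by auto
    qed
    have "f i \<noteq> cover_child g k ! i" if i: "i < n" for i
      using f(2)[OF i] i wr avoid[of "rank g i"] by (auto simp: cover_child_nth unset_def)
    then show ?thesis using k(1) f(1) U(2)
      by (intro bexI[of _ "cover_child g k"]) (auto simp: feasible_def)
  qed
qed

lemma children_Nil_iff: "valid g \<Longrightarrow> children g = [] \<longleftrightarrow> unset g = {}"
proof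
  assume v: "valid g"
  obtain b v where s: "select g = (b, v)" by fastforce
  {
    assume "unset g = {}"
    then have "score g w = 0" for w using score_pos[of g w] by (auto simp: udeg_def)
    then have "b = 0" using select_upto_spec[OF s] by (cases b) auto
    then show "children g = []" using s \<open>unset g = {}\<close> by (simp add: children_def)
  next
    assume nil: "children g = []"
    have "star_colours g \<noteq> []"
    proof -
      have "(0::nat) \<noteq> g ! v \<or> 1 \<noteq> g ! v" by auto
      then have "0 \<in> set (star_colours g) \<or> 1 \<in> set (star_colours g)"
        using s by (auto simp: star_colours_def)
      then show ?thesis by auto
    qed
    then show "unset g = {}" using nil s by (auto simp: children_def split: if_splits)
  }
qed

text \<open>The size of the search tree, independent of the machine. It will turn out to be the
  number of rounds of the search loop.\<close>

function nodes :: "nat list \<Rightarrow> nat" where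
  "nodes g = Suc (sum_list (map nodes (children g)))"
  by auto
termination by (relation "measure (\<lambda>g. card (unset g))") (use children_unset in auto)

declare nodes.simps [simp del]

end

section \<open>The size of the search tree\<close>

lemma card_filter_sum:
  "finite A \<Longrightarrow> card {x \<in> A. P x} = (\<Sum>x\<in>A. if P x then 1 else 0)"
  by (simp add: sum.If_cases Int_def flip: sum.inter_filter)

lemma real_sum_list: "real (sum_list (map f xs)) = (\<Sum>x\<leftarrow>xs. real (f x))"
  by (induction xs) auto

lemma double_count:
  assumes "finite A" "finite B"
  shows "(\<Sum>x\<in>A. card {y \<in> B. P x y}) = (\<Sum>y\<in>B. card {x \<in> A. P x y})"
  using assms by (simp add: card_filter_sum sum.swap[of _ A B])

context coloring
begin

text \<open>Twice the number of edges between unset vertices.\<close>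

definition total_udeg :: "nat list \<Rightarrow> nat" where
  "total_udeg g = (\<Sum>v\<in>unset g. udeg g v)"

definition boundary :: "nat list \<Rightarrow> nat set" where
  "boundary g = {i. i < n \<and> g ! i \<noteq> 3 \<and> 0 < udeg g i}"

text \<open>
  The potential replaces the weight as soon as all scores are at most 3. Minimum degree 7
  makes it at most the weight at that moment.
\<close>

definition weight :: "nat list \<Rightarrow> real" where
  "weight g = (8 * real (card (unset g)) + 2 * real (card (boundary g))) / 20"

text \<open>Weights are scaled to exponents of 2. Since \<beta> is \<open>2 powr (2/5)\<close>,
  weight 1 becomes 8/20, weight 1/4 becomes 2/20 and weight 15/8 becomes 15/20. An edge is counted
  twice in \<open>total_udeg\<close>, hence the coefficient 1/20.\<close>

definition potential :: "nat list \<Rightarrow> real" where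
  "potential g = (15 * real (card (unset g)) - real (total_udeg g)) / 20"

lemma finite_boundary [simp]: "finite (boundary g)"
  by (simp add: boundary_def)

lemma udeg_mono: "unset h \<subseteq> unset g \<Longrightarrow> udeg h v \<le> udeg g v"
  unfolding udeg_def by (intro card_mono) auto

lemma adj_commute: "a i j \<longleftrightarrow> a j i"
  using adj_sym by blast

text \<open>At most \<open>s * card X\<close> edges disappear, and each is counted at both ends. The
  two ends are estimated separately, as degrees lost inside \<open>X\<close> and degrees lost by the
  remaining vertices.\<close>

lemma total_udeg_removal:
  assumes h: "unset h = unset g - X" "X \<subseteq> unset g" and s: "\<And>x. x \<in> X \<Longrightarrow> udeg g x \<le> s"
  shows "total_udeg g \<le> total_udeg h + 2 * (s * card X)"
proof -
  have fin: "finite X" using finite_subset[OF h(2) finite_unset] .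
  have split: "udeg g x = udeg h x + card {y \<in> X. a x y}" for x
  proof -
    have "{j \<in> unset g. a x j} = {j \<in> unset h. a x j} \<union> {y \<in> X. a x y}" using h by auto
    then show ?thesis unfolding udeg_def using fin h
      by (simp only:) (intro card_Un_disjoint, auto)
  qed
  have sumX: "(\<Sum>x\<in>X. udeg g x) \<le> s * card X"
    using sum_bounded_above[of X "udeg g" s] s by (simp add: mult.commute)
  have "(\<Sum>x\<in>unset h. card {y \<in> X. a x y}) = (\<Sum>y\<in>X. card {x \<in> unset h. a x y})"
    using fin by (intro double_count) auto
  also have "\<dots> \<le> (\<Sum>y\<in>X. udeg g y)"
  proof (rule sum_mono)
    fix y
    have "card {x \<in> unset h. a x y} \<le> card {x \<in> unset g. a y x}"
      using h by (intro card_mono) (auto simp: adj_commute[of y])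
    then show "card {x \<in> unset h. a x y} \<le> udeg g y" by (simp add: udeg_def)
  qed
  finally have cross: "(\<Sum>x\<in>unset h. card {y \<in> X. a x y}) \<le> s * card X" using sumX by simp
  have "total_udeg g = (\<Sum>x\<in>unset h. udeg g x) + (\<Sum>x\<in>X. udeg g x)"
    unfolding total_udeg_def h(1) using sum.subset_diff[OF h(2) finite_unset] by blast
  also have "(\<Sum>x\<in>unset h. udeg g x) = total_udeg h + (\<Sum>x\<in>unset h. card {y \<in> X. a x y})"
    by (simp add: split sum.distrib total_udeg_def)
  finally show ?thesis using sumX cross by linarith
qed

lemma potential_removal:
  assumes h: "unset h = unset g - X" "X \<subseteq> unset g" and s: "\<And>x. x \<in> X \<Longrightarrow> udeg g x \<le> s"
  shows "potential h \<le> potential g - (15 * real (card X) - 2 * real (s * card X)) / 20"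
proof -
  have "card (unset h) = card (unset g) - card X" "card X \<le> card (unset g)"
    using h by (simp_all add: card_Diff_subset finite_subset card_mono)
  then have "real (card (unset h)) = real (card (unset g)) - real (card X)" by (simp add: of_nat_diff)
  moreover have "real (total_udeg g) \<le> real (total_udeg h) + 2 * real (s * card X)"
    using total_udeg_removal[OF assms] by (metis of_nat_add of_nat_le_iff of_nat_mult of_nat_numeral)
  ultimately show ?thesis by (simp add: potential_def field_simps)
qed

lemma potential_nonneg:
  assumes "\<And>v. v \<in> unset g \<Longrightarrow> udeg g v \<le> 3"
  shows "0 \<le> potential g"
proof -
  have "total_udeg g \<le> card (unset g) * 3"
    unfolding total_udeg_def using sum_bounded_above[of "unset g" "udeg g" 3] assms by simp
  then have "real (total_udeg g) \<le> 15 * real (card (unset g))" by linarith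
  then show ?thesis by (simp add: potential_def)
qed

text \<open>Children have at least one unset vertex less, so together they account for
  \<open>8 * card (unset g) * 2 powr e\<close>. The summand 1 next to \<open>card (unset g)\<close>
  then leaves \<open>8 * 2 powr e\<close> for the node itself. The factor 8 is a safe choice for the
  last group of fewer than four isolated vertices, whose eight branches are not covered by the
  potential.\<close>

lemma nodes_step:
  assumes children: "\<And>h. h \<in> set (children g) \<Longrightarrow>
      real (nodes h) \<le> 8 * (real (card (unset h)) + 1) * 2 powr (e - d)"
    and length: "real (length (children g)) \<le> 2 powr d" and e: "0 \<le> e"
  shows "real (nodes g) \<le> 8 * (real (card (unset g)) + 1) * 2 powr e"
proof -
  have "real (nodes h) \<le> 8 * real (card (unset g)) * 2 powr (e - d)" if "h \<in> set (children g)" for h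
  proof -
    have "real (card (unset h)) + 1 \<le> real (card (unset g))" using children_unset[OF that] by linarith
    then have "8 * (real (card (unset h)) + 1) * 2 powr (e - d) \<le>
        8 * real (card (unset g)) * 2 powr (e - d)"
      by (intro mult_right_mono) auto
    then show ?thesis using children[OF that] by linarith
  qed
  then have "(\<Sum>h\<leftarrow>children g. real (nodes h)) \<le>
      (\<Sum>h\<leftarrow>children g. 8 * real (card (unset g)) * 2 powr (e - d))"
    by (intro sum_list_mono) auto
  also have "\<dots> = real (length (children g)) * (8 * real (card (unset g)) * 2 powr (e - d))"
    by (simp add: sum_list_triv)
  also have "\<dots> \<le> 2 powr d * (8 * real (card (unset g)) * 2 powr (e - d))"
    using length by (intro mult_right_mono) auto
  also have "\<dots> = 8 * real (card (unset g)) * 2 powr e"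
    by (simp add: powr_diff)
  finally have "(\<Sum>h\<leftarrow>children g. real (nodes h)) \<le> 8 * real (card (unset g)) * 2 powr e" .
  moreover have "real (nodes g) = 1 + (\<Sum>h\<leftarrow>children g. real (nodes h))"
    by (subst nodes.simps) (simp add: real_sum_list)
  moreover have "1 \<le> 2 powr e" using e by (simp add: ge_one_powr_ge_zero)
  ultimately show ?thesis by (simp add: algebra_simps)
qed

text \<open>Because \<open>3 ^ 5 = 243\<close> is just below \<open>2 ^ 8 = 256\<close>, and
  \<open>8/5 = 32/20\<close>.\<close>

lemma three_le_powr: "32/20 \<le> d \<Longrightarrow> (3::real) \<le> 2 powr d"
proof -
  assume d: "32/20 \<le> d"
  have "(243::real) = 3 powr 5" by simp
  then have "(3::real) = 243 powr (1/5)" by (simp only: powr_powr) simp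
  also have "\<dots> \<le> (256::real) powr (1/5)" by (intro powr_mono2) auto
  also have "\<dots> = 2 powr (8/5)"
  proof -
    have "(256::real) = 2 powr 8" by simp
    then show ?thesis by (simp only: powr_powr) simp
  qed
  also have "\<dots> \<le> 2 powr d" using d by (intro powr_mono) auto
  finally show ?thesis .
qed

lemma two_le_powr: "1 \<le> d \<Longrightarrow> (2::real) \<le> 2 powr d"
  using powr_mono[of 1 d 2] by simp

lemma length_star_colours: "length (star_colours g) \<le> 3"
  by (simp add: star_colours_def split: prod.splits) (metis diff_zero length_filter_le length_upt)

lemma length_star_colours_2:
  assumes "select g = (b, v)" "g ! v < 3 \<or> b = 1"
  shows "length (star_colours g) \<le> 2"
proof -
  define c where "c = (if g ! v < 3 then g ! v else 2)"
  have c: "c \<in> {0..<3}" using assms(2) by (auto simp: c_def)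
  have "set (star_colours g) \<subseteq> {0..<3} - {c}"
    using assms by (auto simp: star_colours_def c_def)
  then have "card (set (star_colours g)) \<le> card ({0..<3} - {c})" by (intro card_mono) auto
  also have "\<dots> = 2" using c by simp
  moreover have "distinct (star_colours g)" by (simp add: star_colours_def split: prod.splits)
  ultimately show ?thesis by (simp add: distinct_card)
qed

lemma card_star:
  "card {i \<in> unset g. i = v \<or> a v i} = udeg g v + (if v \<in> unset g then 1 else 0)"
proof -
  have "{i \<in> unset g. i = v \<or> a v i} = {i \<in> unset g. a v i} \<union> (if v \<in> unset g then {v} else {})"
    by auto
  moreover have "{i \<in> unset g. a v i} \<inter> (if v \<in> unset g then {v} else {}) = {}"
    using adj_irrefl by auto
  ultimately show ?thesis unfolding udeg_def by (cases "v \<in> unset g") auto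
qed

text \<open>The invariant concerns unset vertices only and survives because \<open>udeg\<close>
  never grows. In units of 1/20, a removed vertex with at most \<open>s\<close> unset neighbours
  lowers the potential by at least \<open>15 - 2 * s\<close>. The prices in these units are 20 for
  two, at most 32 for three and 60 for eight branches.\<close>

lemma nodes_le_potential:
  assumes "valid g" "\<And>v. v \<in> unset g \<Longrightarrow> udeg g v \<le> 3"
  shows "real (nodes g) \<le> 8 * (real (card (unset g)) + 1) * 2 powr potential g"
  using assms
proof (induction g rule: nodes.induct)
  case (1 g)
  note deg3 = 1(3)
  have IH: "real (nodes h) \<le> 8 * (real (card (unset h)) + 1) * 2 powr potential h"
    if "h \<in> set (children g)" "unset h \<subseteq> unset g" for h
  proof (rule 1(1)[OF that(1) children_valid[OF 1(2) that(1)]])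
    fix v assume "v \<in> unset h"
    then show "udeg h v \<le> 3" using udeg_mono[OF that(2), of v] deg3[of v] that(2) by auto
  qed
  have e: "0 \<le> potential g" using potential_nonneg[OF deg3] .
  obtain b v where s: "select g = (b, v)" by fastforce
  have le_b: "udeg g w \<le> b" if "w \<in> unset g" for w
    using select_upto_spec[OF s] that by (auto simp: unset_def score_def)
  show ?case
  proof (cases "0 < b")
    case True
    then have v: "v < n" "score g v = b" using select_upto_spec[OF s] by auto
    define X where "X = {i \<in> unset g. i = v \<or> a v i}"
    have bound: "real (nodes h) \<le> 8 * (real (card (unset h)) + 1) * 2 powr (potential g - d)"
      if h: "h \<in> set (children g)" and d: "20 * d \<le> 15 * real (card X) - 2 * real (r * card X)"
        and r: "\<And>x. x \<in> X \<Longrightarrow> udeg g x \<le> r" for h d r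
    proof -
      have *: "unset h = unset g - X" "X \<subseteq> unset g"
        using h True s by (auto simp: children_def star_colours_def unset_star_child X_def)
      have "potential h \<le> potential g - (15 * real (card X) - 2 * real (r * card X)) / 20"
        using * r by (rule potential_removal)
      moreover have "d \<le> (15 * real (card X) - 2 * real (r * card X)) / 20" using d by simp
      ultimately have "potential h \<le> potential g - d" by linarith
      then have "2 powr potential h \<le> 2 powr (potential g - d)" by simp
      then have "8 * (real (card (unset h)) + 1) * 2 powr potential h \<le>
          8 * (real (card (unset h)) + 1) * 2 powr (potential g - d)"
        by (intro mult_left_mono) auto
      moreover have "unset h \<subseteq> unset g" using *(1) by simp
      ultimately show ?thesis using IH[OF h] by linarith
    qed
    have len: "length (children g) = length (star_colours g)"
      using s True by (simp add: children_def)
    show ?thesis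
    proof (cases "v \<in> unset g")
      case vU: True
      then have b: "udeg g v = b" "b \<le> 3" using v deg3 by (auto simp: score_def unset_def)
      have X: "card X = b + 1" using card_star[of g v] vU b by (simp add: X_def)
      have r: "\<And>x. x \<in> X \<Longrightarrow> udeg g x \<le> b" using le_b by (auto simp: X_def)
      show ?thesis
      proof (cases "b = 1")
        case b1: True
        have "real (length (children g)) \<le> 2"
          using length_star_colours_2[OF s] b1 len by simp
        \<comment> \<open>Two vertices are removed, and as the maximal score is 1, each has at most
          one unset neighbour: \<open>2 * (15 - 2) = 26\<close>.\<close>
        then have l: "real (length (children g)) \<le> 2 powr (26/20)"
          using two_le_powr[of "26/20"] by linarith
        show ?thesis
          by (rule nodes_step[OF bound[where r = b] l e]) (use X r b1 in auto)
      next
        case False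
        have "real (length (children g)) \<le> 3" using length_star_colours[of g] len by simp
        \<comment> \<open>For \<open>b = 2\<close> the gain is \<open>3 * (15 - 4) = 33\<close>, for
          \<open>b = 3\<close> it is \<open>4 * (15 - 6) = 36\<close>. Maximality of
          \<open>b\<close> bounds the unset neighbours of the removed vertices.\<close>
        then have l: "real (length (children g)) \<le> 2 powr (33/20)"
          using three_le_powr[of "33/20"] by simp
        have "b = 2 \<or> b = 3" using b False True by linarith
        then have "20 * (33/20) \<le> 15 * real (card X) - 2 * real (b * card X)"
          using X by auto
        then show ?thesis by (intro nodes_step[OF bound[where r = b] l e]) (use r in auto)
      qed
    next
      case vU: False
      then have gv: "g ! v \<noteq> 3" using v by (auto simp: unset_def)
      then have "3 \<le> udeg g v" using v True by (auto simp: score_def split: if_splits)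
      moreover have "card X = udeg g v" using card_star[of g v] vU by (simp add: X_def)
      \<comment> \<open>At least three vertices are removed, each worth at least
        \<open>15 - 2 * 3 = 9\<close>.\<close>
      ultimately have X: "20 * 1 \<le> 15 * real (card X) - 2 * real (3 * card X)" by simp
      have r: "\<And>x. x \<in> X \<Longrightarrow> udeg g x \<le> 3" using deg3 by (auto simp: X_def)
      have "g ! v \<le> 3" using 1(2) v(1) by (simp add: valid_def)
      then have "real (length (children g)) \<le> 2"
        using length_star_colours_2[OF s] gv len by simp
      then have l: "real (length (children g)) \<le> 2 powr 1" by simp
      show ?thesis by (rule nodes_step[OF bound[where r = 3] l e]) (use X r in auto)
    qed
  next
    case False
    then have udeg0: "udeg g w \<le> 0" if "w \<in> unset g" for w using le_b[OF that] by simp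
    show ?thesis
    proof (cases "unset g = {}")
      case True
      then have "children g = []" using children_Nil_iff[OF 1(2)] by simp
      then have "real (nodes g) = 1" by (subst nodes.simps) simp
      moreover have "1 \<le> 2 powr potential g" using e by (simp add: ge_one_powr_ge_zero)
      ultimately show ?thesis using True by simp
    next
      case U: False
      have ch: "children g = map (cover_child g) [0..<8]" using U False s by (simp add: children_def)
      define X where "X = {i \<in> unset g. rank g i < 4}"
      have X: "X \<subseteq> unset g" by (auto simp: X_def)
      note bij = bij_betw_rank[OF finite_unset[of g], folded rank_def]
      have unset_h: "unset h = unset g - X" if "h \<in> set (children g)" for h
        using that by (auto simp: ch unset_cover_child X_def)
      show ?thesis
      proof (cases "4 \<le> card (unset g)")
        case True
        have "rank g ` X = {..<4}"
        proof -
          have "r \<in> rank g ` X" if "r < 4" for r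
          proof -
            have "r \<in> rank g ` unset g" using bij that True by (auto simp: bij_betw_def)
            then show ?thesis using that by (auto simp: X_def)
          qed
          then show ?thesis by (auto simp: X_def)
        qed
        moreover have "inj_on (rank g) X" using bij X by (meson bij_betw_def inj_on_subset)
        ultimately have cX: "card X = 4" by (metis card_image card_lessThan)
        have "potential h \<le> potential g - 3" if "h \<in> set (children g)" for h
          using potential_removal[OF unset_h[OF that] X, of 0] udeg0 X cX by auto
        then have bound: "real (nodes h) \<le> 8 * (real (card (unset h)) + 1) * 2 powr (potential g - 3)"
          if "h \<in> set (children g)" for h
        proof -
          have "2 powr potential h \<le> 2 powr (potential g - 3)"
            using \<open>\<And>h. h \<in> set (children g) \<Longrightarrow> potential h \<le> potential g - 3\<close> that by simp
          then have "8 * (real (card (unset h)) + 1) * 2 powr potential h \<le>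
              8 * (real (card (unset h)) + 1) * 2 powr (potential g - 3)"
            by (intro mult_left_mono) auto
          moreover have "unset h \<subseteq> unset g" using unset_h[OF that] by simp
          ultimately show ?thesis using IH[OF that] by linarith
        qed
        show ?thesis by (rule nodes_step[OF bound _ e]) (auto simp: ch)
      next
        \<comment> \<open>All remaining vertices are isolated and settled at once, so the children
          are leaves. The nine nodes fit into \<open>8 * (card (unset g) + 1)\<close>.\<close>
        case small: False
        have "nodes h = 1" if h: "h \<in> set (children g)" for h
        proof -
          have "rank g i < 4" if "i \<in> unset g" for i
            using bij_betwE[OF bij] that small by fastforce
          then have "unset h = {}" using unset_h[OF h] by (auto simp: X_def)
          then have "children h = []" using children_Nil_iff children_valid[OF 1(2) h] by blast
          then show ?thesis by (subst nodes.simps) simp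
        qed
        then have "map nodes (children g) = map (\<lambda>_. 1::nat) (children g)" by (intro map_cong) auto
        also have "\<dots> = replicate 8 1" by (simp add: map_replicate_const ch)
        finally have "nodes g = 9" by (subst nodes.simps) (simp only: sum_list_replicate, simp)
        moreover have "1 \<le> card (unset g)" using U by (simp add: Suc_le_eq card_gt_0_iff)
        moreover have "1 \<le> 2 powr potential g" using e by (simp add: ge_one_powr_ge_zero)
        ultimately have "real (nodes g) \<le> 8 * (1 + 1) * 1" by simp
        also have "\<dots> \<le> 8 * (real (card (unset g)) + 1) * 2 powr potential g"
          using \<open>1 \<le> card (unset g)\<close> \<open>1 \<le> 2 powr potential g\<close>
          by (intro mult_mono) auto
        finally show ?thesis .
      qed
    qed
  qed
qed

lemma potential_le_weight:
  assumes deg: "\<And>v. v < n \<Longrightarrow> 7 \<le> card {j. j < n \<and> a v j}"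
    and score: "\<And>v. v < n \<Longrightarrow> score g v \<le> 3"
  shows "potential g \<le> weight g"
proof -
  have "7 \<le> udeg g v + card {j \<in> boundary g. a v j}" if v: "v \<in> unset g" for v
  proof -
    have "j \<in> boundary g" if j: "j < n" "a v j" "g ! j \<noteq> 3" for j
    proof -
      have "v \<in> {i \<in> unset g. a j i}" using v j adj_sym by auto
      then have "0 < udeg g j" unfolding udeg_def by (subst card_gt_0_iff) auto
      then show ?thesis using j by (simp add: boundary_def)
    qed
    then have "{j. j < n \<and> a v j} \<subseteq> {j \<in> unset g. a v j} \<union> {j \<in> boundary g. a v j}"
      by (auto simp: unset_def)
    then have "card {j. j < n \<and> a v j} \<le> card ({j \<in> unset g. a v j} \<union> {j \<in> boundary g. a v j})"
      by (intro card_mono) auto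
    also have "\<dots> \<le> udeg g v + card {j \<in> boundary g. a v j}"
      unfolding udeg_def by (rule card_Un_le)
    finally show ?thesis using deg[of v] v by (auto simp: unset_def)
  qed
  then have "(\<Sum>v\<in>unset g. 7) \<le> (\<Sum>v\<in>unset g. udeg g v + card {j \<in> boundary g. a v j})"
    by (intro sum_mono)
  also have "\<dots> = total_udeg g + (\<Sum>v\<in>unset g. card {j \<in> boundary g. a v j})"
    by (simp add: sum.distrib total_udeg_def)
  also have "(\<Sum>v\<in>unset g. card {j \<in> boundary g. a v j}) =
      (\<Sum>j\<in>boundary g. card {v \<in> unset g. a v j})"
    by (intro double_count) auto
  also have "\<dots> \<le> (\<Sum>j\<in>boundary g. 2)"
  proof (rule sum_mono)
    fix j assume j: "j \<in> boundary g"
    \<comment> \<open>With three unset neighbours, a vertex that is not unset would have score at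
      least 4.\<close>
    have "udeg g j \<le> 2" using score[of j] j by (auto simp: boundary_def score_def split: if_splits)
    moreover have "{v \<in> unset g. a v j} = {v \<in> unset g. a j v}" using adj_sym by auto
    ultimately show "card {v \<in> unset g. a v j} \<le> 2" by (simp add: udeg_def)
  qed
  finally have "7 * card (unset g) \<le> total_udeg g + 2 * card (boundary g)"
    by (simp add: mult.commute)
  then have "7 * real (card (unset g)) \<le> real (total_udeg g) + 2 * real (card (boundary g))"
    by linarith
  then show ?thesis by (simp add: potential_def weight_def)
qed

text \<open>In units of 1/20, each unset neighbour of \<open>v\<close> loses 8, but may join the
  boundary and then keeps 2. The vertex \<open>v\<close> itself loses its whole contribution, 8 or
  2, because no unset neighbour is left to it in the child.\<close>

lemma weight_star_child:
  assumes v: "v < n" and k: "k < 3" and d: "0 < udeg g v"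
  shows "weight (star_child g v k) \<le> weight g -
    (6 * real (udeg g v) + (if v \<in> unset g then 8 else 2)) / 20"
proof -
  let ?h = "star_child g v k"
  define X where "X = {i \<in> unset g. i = v \<or> a v i}"
  have h: "unset ?h = unset g - X" using unset_star_child[OF k] by (simp add: X_def)
  have X: "X \<subseteq> unset g" "card X = udeg g v + (if v \<in> unset g then 1 else 0)"
    using card_star[of g v] by (auto simp: X_def)
  have "card (unset ?h) = card (unset g) - card X" "card X \<le> card (unset g)"
    using h X(1) by (simp_all add: card_Diff_subset finite_subset card_mono)
  then have U: "real (card (unset ?h)) = real (card (unset g)) - real (card X)"
    by (simp add: of_nat_diff)
  have "{j \<in> unset ?h. a v j} = {}" using h by (auto simp: X_def)
  then have v0: "v \<notin> boundary ?h" by (simp add: boundary_def udeg_def)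
  have "boundary ?h \<subseteq> (boundary g - {v}) \<union> {j \<in> unset g. a v j}"
  proof
    fix i assume i: "i \<in> boundary ?h"
    then have "i \<noteq> v" "i < n" "0 < udeg g i" "?h ! i \<noteq> 3"
      using v0 udeg_mono[of ?h g i] h by (auto simp: boundary_def)
    then show "i \<in> (boundary g - {v}) \<union> {j \<in> unset g. a v j}"
      by (auto simp: boundary_def unset_def star_child_nth split: if_splits)
  qed
  then have "card (boundary ?h) \<le> card ((boundary g - {v}) \<union> {j \<in> unset g. a v j})"
    by (intro card_mono) auto
  also have "\<dots> \<le> card (boundary g - {v}) + udeg g v"
    unfolding udeg_def by (rule card_Un_le)
  finally have W: "card (boundary ?h) \<le> card (boundary g - {v}) + udeg g v" .
  show ?thesis
  proof (cases "v \<in> unset g")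
    case True
    have "card (boundary g - {v}) \<le> card (boundary g)" by (intro card_mono) auto
    then have "real (card (boundary ?h)) \<le> real (card (boundary g)) + real (udeg g v)"
      using W by linarith
    then show ?thesis using U X(2) True by (simp add: weight_def field_simps)
  next
    case False
    then have "v \<in> boundary g" using v d by (auto simp: boundary_def unset_def)
    then have "card (boundary g - {v}) = card (boundary g) - 1" "0 < card (boundary g)"
      by (auto simp: card_gt_0_iff)
    then have "real (card (boundary ?h)) + 1 \<le> real (card (boundary g)) + real (udeg g v)"
      using W by linarith
    then show ?thesis using U X(2) False by (simp add: weight_def field_simps)
  qed
qed

text \<open>A vertex of score at least 4 lowers the weight by at least \<open>6 * 4 + 8 = 32\<close>
  twentieths if it is unset, enough for three branches, and otherwise by at least
  \<open>6 * 3 + 2 = 20\<close>, exactly enough for two. Once all scores are at most 3, the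
  potential bounds the entire subtree, so it does not matter whether higher scores reappear further
  down.\<close>

lemma nodes_le_weight:
  assumes "valid g" and deg: "\<And>v. v < n \<Longrightarrow> 7 \<le> card {j. j < n \<and> a v j}"
  shows "real (nodes g) \<le> 8 * (real (card (unset g)) + 1) * 2 powr weight g"
  using assms(1)
proof (induction g rule: nodes.induct)
  case (1 g)
  obtain b v where s: "select g = (b, v)" by fastforce
  have le_b: "score g w \<le> b" if "w < n" for w
    using select_upto_spec[OF s] that by auto
  show ?case
  proof (cases "b \<le> 3")
    case True
    then have sc: "score g w \<le> 3" if "w < n" for w using le_b[OF that] by linarith
    then have "udeg g w \<le> 3" if "w \<in> unset g" for w
      using that by (fastforce simp: unset_def score_def)
    then have "real (nodes g) \<le> 8 * (real (card (unset g)) + 1) * 2 powr potential g"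
      using nodes_le_potential[OF 1(2)] by blast
    also have "\<dots> \<le> 8 * (real (card (unset g)) + 1) * 2 powr weight g"
      using potential_le_weight[OF deg sc] by (intro mult_left_mono) auto
    finally show ?thesis .
  next
    case False
    then have v: "v < n" "score g v = b" using select_upto_spec[OF s] by auto
    then have pos: "0 < udeg g v" using score_pos[of g v] False by simp
    have e: "0 \<le> weight g" by (simp add: weight_def)
    have bound: "real (nodes h) \<le> 8 * (real (card (unset h)) + 1) * 2 powr (weight g - d)"
      if h: "h \<in> set (children g)"
        and d: "d \<le> (6 * real (udeg g v) + (if v \<in> unset g then 8 else 2)) / 20" for h d
    proof -
      obtain k where k: "h = star_child g v k" "k < 3"
        using h s False by (auto simp: children_def star_colours_def)
      have "weight h \<le> weight g - d" using weight_star_child[OF v(1) k(2) pos] d unfolding k(1) by linarith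
      then have "2 powr weight h \<le> 2 powr (weight g - d)" by simp
      then have "8 * (real (card (unset h)) + 1) * 2 powr weight h \<le>
          8 * (real (card (unset h)) + 1) * 2 powr (weight g - d)"
        by (intro mult_left_mono) auto
      then show ?thesis using 1(1)[OF h children_valid[OF 1(2) h]] by linarith
    qed
    have len: "length (children g) = length (star_colours g)"
      using s False by (simp add: children_def)
    show ?thesis
    proof (cases "v \<in> unset g")
      case True
      then have u: "4 \<le> udeg g v" using v False by (auto simp: score_def unset_def)
      have "real (length (children g)) \<le> 3" using length_star_colours[of g] len by simp
      then have l: "real (length (children g)) \<le> 2 powr (32/20)"
        using three_le_powr[of "32/20"] by simp
      show ?thesis by (rule nodes_step[OF bound l e]) (use True u in auto)
    next
      case vU: False
      then have gv: "g ! v \<noteq> 3" using v by (auto simp: unset_def)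
      then have u: "3 \<le> udeg g v" using v False by (auto simp: score_def split: if_splits)
      have "g ! v \<le> 3" using 1(2) v(1) by (simp add: valid_def)
      then have "real (length (children g)) \<le> 2"
        using length_star_colours_2[OF s] gv len by simp
      then have l: "real (length (children g)) \<le> 2 powr 1" by simp
      show ?thesis by (rule nodes_step[OF bound l e]) (use vU u in auto)
    qed
  qed
qed

text \<open>Initially every vertex is unset, so scores are degrees, and the boundary is empty, so
  the weight is \<open>0.4 * n\<close>. The first guess lowers it by \<open>0.3 * b + 0.4\<close>
  with \<open>b \<ge> D\<close>; the surplus is given away. Three subtrees with factor 8 and the
  root give the constant 25.\<close>

lemma nodes_start:
  assumes deg: "\<And>v. v < n \<Longrightarrow> 7 \<le> card {j. j < n \<and> a v j}"
    and D: "D \<le> card {j. j < n \<and> a u j}" "u < n"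
  shows "real (nodes (replicate n 3)) \<le> 25 * (real n + 1) * 2 powr (0.4 * real n - 0.3 * real D)"
proof -
  let ?g = "replicate n 3"
  have U: "unset ?g = {..<n}" by (auto simp: unset_def)
  have udeg: "udeg ?g v = card {j. j < n \<and> a v j}" for v
    unfolding udeg_def U by simp
  have sc: "score ?g v = udeg ?g v" if "v < n" for v using that by (simp add: score_def)
  obtain b v where s: "select ?g = (b, v)" by fastforce
  have b: "D \<le> b" "7 \<le> b" using select_upto_spec[OF s] sc[OF D(2)] udeg[of u] D deg[of u]
    by (metis order_trans)+
  then have v: "v < n" "udeg ?g v = b" using select_upto_spec[OF s] sc[of v] by auto
  define e where "e = 0.4 * real n - 0.3 * real D"
  \<comment> \<open>No vertex is its own neighbour. Together with \<open>D \<le> b\<close> this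
    makes the exponent \<open>e\<close> nonnegative, which is needed to count the root.\<close>
  have bn: "b < n"
  proof -
    have "b = card {j. j < n \<and> a v j}" using v udeg by simp
    also have "\<dots> < card {..<n}"
      using v(1) adj_irrefl by (intro psubset_card_mono) auto
    finally show ?thesis by simp
  qed
  have "boundary ?g = {}" by (auto simp: boundary_def)
  then have w: "weight ?g = 0.4 * real n" by (simp add: weight_def U)
  have val: "valid ?g" by (simp add: valid_def)
  have bound: "real (nodes h) \<le> 8 * (real n + 1) * 2 powr e" if h: "h \<in> set (children ?g)" for h
  proof -
    obtain k where k: "h = star_child ?g v k" "k < 3"
      using h s b by (auto simp: children_def star_colours_def)
    have "weight h \<le> 0.4 * real n - (6 * real b + 8) / 20"
      using weight_star_child[OF v(1) k(2), of ?g] v b w U unfolding k(1) by simp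
    moreover have "real D \<le> real b" using b by simp
    ultimately have "weight h \<le> e" by (simp add: e_def field_simps)
    moreover have "card (unset h) \<le> card {..<n}" by (intro card_mono) (auto simp: unset_def)
    ultimately have "8 * (real (card (unset h)) + 1) * 2 powr weight h \<le> 8 * (real n + 1) * 2 powr e"
      by (intro mult_mono) auto
    then show ?thesis using nodes_le_weight[OF children_valid[OF val h] deg] by linarith
  qed
  have "length (children ?g) \<le> 3"
    using s b length_star_colours[of ?g] by (simp add: children_def)
  have "(\<Sum>h\<leftarrow>children ?g. real (nodes h)) \<le> (\<Sum>h\<leftarrow>children ?g. 8 * (real n + 1) * 2 powr e)"
    using bound by (intro sum_list_mono) auto
  also have "\<dots> = real (length (children ?g)) * (8 * (real n + 1) * 2 powr e)"
    by (simp add: sum_list_triv)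
  also have "\<dots> \<le> 3 * (8 * (real n + 1) * 2 powr e)"
    using \<open>length (children ?g) \<le> 3\<close> by (intro mult_right_mono) auto
  finally have "(\<Sum>h\<leftarrow>children ?g. real (nodes h)) \<le> 24 * ((real n + 1) * 2 powr e)"
    by (simp add: algebra_simps)
  moreover have "real (nodes ?g) = 1 + (\<Sum>h\<leftarrow>children ?g. real (nodes h))"
    by (subst nodes.simps) (simp add: real_sum_list)
  moreover have "1 * 1 \<le> (real n + 1) * 2 powr e"
  proof (intro mult_mono)
    have "0 \<le> e" using bn b by (simp add: e_def)
    then show "1 \<le> 2 powr e" by (simp add: ge_one_powr_ge_zero)
  qed auto
  ultimately show ?thesis unfolding e_def by linarith
qed

end

section \<open>The program\<close>

text \<open>
  Registers: 0 holds \<open>n\<close>, 1 the answer, 2 the height of the stack, 3 and 4 the selected score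
  and vertex, 5 to 9 are loop variables and a counter. The memory contains the adjacency
  matrix, the current state, the implication matrix of the two-list test, and the stack.
\<close>

definition adj_addr :: "exp \<Rightarrow> exp \<Rightarrow> exp" where
  "adj_addr v i = Plus (Times v (Var 0)) i"

definition cur_addr :: "exp \<Rightarrow> exp" where
  "cur_addr i = Plus (Times (Var 0) (Var 0)) i"

definition imp_addr :: "exp \<Rightarrow> exp \<Rightarrow> exp" where
  "imp_addr p q = Plus (Plus (Times (Var 0) (Var 0)) (Var 0)) (Plus (Times p (Times (Num 3) (Var 0))) q)"

text \<open>The offset \<open>10 * n * n + n\<close> leaves room for the adjacency matrix, the
  current state and the implication matrix with \<open>3 * n\<close> rows and columns. Stack entries
  are consecutive rows of length \<open>n\<close>.\<close>

definition stack_addr :: "exp \<Rightarrow> exp \<Rightarrow> exp" where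
  "stack_addr p i = Plus (Plus (Times (Num 10) (Times (Var 0) (Var 0))) (Var 0))
     (Plus (Times p (Var 0)) i)"

definition complement :: "exp \<Rightarrow> exp" where
  "complement e = Minus (Num 1) e"

definition is_unset :: "exp \<Rightarrow> exp" where
  "is_unset i = Eq (Mem (cur_addr i)) (Num 3)"

primrec table :: "exp \<Rightarrow> nat \<Rightarrow> nat list \<Rightarrow> exp" where
  "table x i [] = Num 0"
| "table x i (c # cs) = Ite (Eq x (Num i)) (Num c) (table x (Suc i) cs)"

definition pop_prog :: stm where
  "pop_prog = Sq (Assign 2 (Minus (Var 2) (Num 1)))
     (For 6 (Var 0) (Write (cur_addr (Var 6)) (Mem (stack_addr (Var 2) (Var 6)))))"

text \<open>Register 7 counts the unset neighbours and is then turned into the score. Register 4 is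
  updated before register 3, because both tests compare with the old best score.\<close>

definition select_prog :: stm where
  "select_prog = Sq (Assign 3 (Num 0)) (Sq (Assign 4 (Num 0)) (For 5 (Var 0)
     (Sq (Assign 7 (Num 0)) (Sq
       (For 6 (Var 0) (Assign 7 (Plus (Var 7)
         (Times (Mem (adj_addr (Var 5) (Var 6))) (is_unset (Var 6))))))
       (Sq (Assign 7 (Ite (is_unset (Var 5)) (Var 7)
            (Ite (Lt (Num 2) (Var 7)) (Plus (Var 7) (Num 1)) (Num 0))))
         (Sq (Assign 4 (Ite (Lt (Var 3) (Var 7)) (Var 5) (Var 4)))
           (Assign 3 (Ite (Lt (Var 3) (Var 7)) (Var 7) (Var 3)))))))))"

text \<open>A child is written to the top of the stack for each of the three colours, but the height
  grows only for the colours of \<open>star_colours\<close>. A rejected child is overwritten in a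
  later round or stays above the top.\<close>

definition star_prog :: stm where
  "star_prog = For 9 (Num 3) (Sq
     (For 6 (Var 0) (Write (stack_addr (Var 2) (Var 6))
       (Ite (is_unset (Var 6)) (Ite (Mem (adj_addr (Var 4) (Var 6))) (Var 9)
         (Ite (Eq (Var 6) (Var 4)) (Ite (Eq (Var 9) (Num 0)) (Num 1) (Num 0)) (Num 3)))
         (Mem (cur_addr (Var 6))))))
     (Assign 2 (Plus (Var 2) (Times (complement (Eq (Var 9) (Mem (cur_addr (Var 4)))))
       (complement (Times (Eq (Var 3) (Num 1)) (Eq (Var 9) (Num 2))))))))"

definition count_prog :: stm where
  "count_prog = Sq (Assign 7 (Num 0)) (For 6 (Var 0) (Assign 7 (Plus (Var 7) (is_unset (Var 6)))))"

definition cover_prog :: stm where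
  "cover_prog = For 9 (Num 8) (Sq (Assign 7 (Num 0)) (Sq
     (For 6 (Var 0) (Sq
       (Write (stack_addr (Var 2) (Var 6)) (Ite (is_unset (Var 6))
         (Ite (Lt (Var 7) (Num 4))
           (table (Plus (Times (Num 4) (Var 9)) (Var 7)) 0 cover_words) (Num 3))
         (Mem (cur_addr (Var 6)))))
       (Assign 7 (Plus (Var 7) (is_unset (Var 6))))))
     (Assign 2 (Plus (Var 2) (Num 1)))))"

definition literal :: "exp \<Rightarrow> exp \<Rightarrow> exp" where
  "literal v c = Plus (Times (Num 3) v) c"

text \<open>The colour loop for the first vertex encloses the loop over the second vertex, so that
  the cells are written in the order of their addresses and progress is described by a single
  position.\<close>

definition imp_prog :: stm where
  "imp_prog = For 5 (Var 0) (For 7 (Num 3) (For 6 (Var 0) (For 8 (Num 3)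
     (Write (imp_addr (literal (Var 5) (Var 7)) (literal (Var 6) (Var 8)))
       (Times (Mem (adj_addr (Var 5) (Var 6))) (Times (complement (Eq (Var 7) (Var 8)))
         (Times (complement (Eq (Var 7) (Mem (cur_addr (Var 5)))))
           (Times (complement (Eq (Var 7) (Mem (cur_addr (Var 6)))))
             (complement (Eq (Var 8) (Mem (cur_addr (Var 6)))))))))))))"

text \<open>Warshall's algorithm, in place, with the intermediate literal in the outermost
  loop.\<close>

definition closure_prog :: stm where
  "closure_prog = For 5 (Times (Num 3) (Var 0)) (For 6 (Times (Num 3) (Var 0))
     (For 8 (Times (Num 3) (Var 0)) (Write (imp_addr (Var 6) (Var 8))
       (Ite (Times (Mem (imp_addr (Var 6) (Var 5))) (Mem (imp_addr (Var 5) (Var 8))))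
         (Num 1) (Mem (imp_addr (Var 6) (Var 8)))))))"

definition cycle_prog :: stm where
  "cycle_prog = Sq (Assign 7 (Num 1)) (For 5 (Var 0) (For 6 (Num 3) (For 8 (Num 3)
     (Assign 7 (Times (Var 7) (complement (Times (complement (Eq (Var 6) (Var 8)))
       (Times (Mem (imp_addr (literal (Var 5) (Var 6)) (literal (Var 5) (Var 8))))
         (Mem (imp_addr (literal (Var 5) (Var 8)) (literal (Var 5) (Var 6))))))))))))"

definition leaf_prog :: stm where
  "leaf_prog = Sq imp_prog (Sq closure_prog (Sq cycle_prog
     (Assign 1 (Ite (Var 7) (Num 1) (Var 1)))))"

definition node_prog :: stm where
  "node_prog = Sq pop_prog (Sq select_prog (Ifnz (Lt (Num 0) (Var 3)) star_prog
     (Sq count_prog (Ifnz (Var 7) cover_prog leaf_prog))))"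

definition init_prog :: stm where
  "init_prog = Sq (For 6 (Var 0) (Write (stack_addr (Num 0) (Var 6)) (Num 3))) (Assign 2 (Num 1))"

text \<open>The loop does not stop at the first colouring found but empties the stack, so that its
  number of rounds is exactly the size of the tree. Scratch registers start at 12, above all
  registers named in the programs.\<close>

definition main_prog :: com where
  "main_prog = Seq (compile 12 init_prog)
     (Seq (While (Less (Const 0) (Reg 2)) (compile 12 node_prog)) (Move 0 (Reg 1)))"

lemmas addr_defs = adj_addr_def cur_addr_def imp_addr_def stack_addr_def is_unset_def complement_def literal_def

lemma eval_table:
  "i \<le> eval x s \<Longrightarrow> eval x s < i + length cs \<Longrightarrow> eval (table x i cs) s = cs ! (eval x s - i)"
proof (induction cs arbitrary: i)
  case (Cons c cs)
  show ?case
  proof (cases "eval x s = i")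
    case False
    then have "eval x s - i = Suc (eval x s - Suc i)" using Cons.prems by simp
    then show ?thesis using Cons.IH[of "Suc i"] Cons.prems False by simp
  qed simp
qed simp

lemma exp_vars_table: "exp_vars (table x i cs) \<subseteq> exp_vars x"
  by (induction cs arbitrary: i) auto

lemma vars_node_prog: "vars node_prog \<subseteq> {..<12}"
  using exp_vars_table[of "Plus (Times (Num 4) (Var 9)) (Var 7)" 0 cover_words]
  by (auto simp: node_prog_def pop_prog_def select_prog_def star_prog_def count_prog_def
      cover_prog_def leaf_prog_def imp_prog_def closure_prog_def cycle_prog_def addr_defs)

lemma vars_init_prog: "vars init_prog \<subseteq> {..<12}"
  by (auto simp: init_prog_def addr_defs)

section \<open>Address arithmetic and filling a block of memory\<close>

lemma addr_eq_iff:
  fixes i j p q m :: nat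
  assumes "j < m" "q < m"
  shows "p * m + q = i * m + j \<longleftrightarrow> p = i \<and> q = j"
proof
  assume eq: "p * m + q = i * m + j"
  have "(p * m + q) div m = p" "(p * m + q) mod m = q" "(i * m + j) div m = i" "(i * m + j) mod m = j"
    using assms by simp_all
  then show "p = i \<and> q = j" using eq by simp
qed simp

lemma addr_less:
  fixes i j k m :: nat
  assumes "i < k" "j < m"
  shows "i * m + j < k * m"
proof -
  have "i * m + j < Suc i * m" using assms(2) by simp
  also have "\<dots> \<le> k * m" using assms(1) by (intro mult_le_mono1) simp
  finally show ?thesis .
qed

text \<open>For loops that write one row of length \<open>n\<close>. The written expression may read
  any memory outside the row, as this is still unchanged.\<close>

lemma wp_fill:
  assumes "R 0 = n" "n \<le> B"
    and step: "\<And>j R' M'. j < n \<Longrightarrow> (\<And>y. y \<noteq> x \<Longrightarrow> R' y = R y) \<Longrightarrow> R' x = j \<Longrightarrow>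
      (\<And>y. y \<notin> {A..<A + n} \<Longrightarrow> M' y = M y) \<Longrightarrow>
      eval ad (R', M') = A + j \<and> eval e (R', M') = f j \<and> f j \<le> B"
    and post: "\<And>R' M'. (\<And>y. y \<noteq> x \<Longrightarrow> R' y = R y) \<Longrightarrow> (\<And>y. y \<notin> {A..<A + n} \<Longrightarrow> M' y = M y) \<Longrightarrow>
      (\<And>j. j < n \<Longrightarrow> M' (A + j) = f j) \<Longrightarrow> Q (R', M')"
  shows "wp B (For x (Var 0) (Write ad e)) Q (R, M)"
proof (rule wp_For[where N = n and I = "\<lambda>i R' M'. (\<forall>y. y \<noteq> x \<longrightarrow> R' y = R y) \<and>
      (\<forall>y. y \<notin> {A..<A + n} \<longrightarrow> M' y = M y) \<and> (\<forall>j<i. M' (A + j) = f j)"])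
  fix i R' M'
  assume i: "i < n" and I: "(\<forall>y. y \<noteq> x \<longrightarrow> R' y = R y) \<and>
      (\<forall>y. y \<notin> {A..<A + n} \<longrightarrow> M' y = M y) \<and> (\<forall>j<i. M' (A + j) = f j)"
  have "eval ad (R'(x := i), M') = A + i \<and> eval e (R'(x := i), M') = f i \<and> f i \<le> B"
    by (rule step) (use i I in auto)
  then show "wp B (Write ad e) (\<lambda>(R', M'). (\<forall>y. y \<noteq> x \<longrightarrow> R' y = R y) \<and>
      (\<forall>y. y \<notin> {A..<A + n} \<longrightarrow> M' y = M y) \<and> (\<forall>j<Suc i. M' (A + j) = f j)) (R'(x := i), M')"
    using i I by (auto simp: wp_Write less_Suc_eq)
qed (use assms in auto)

context coloring
begin

section \<open>Memory layout and the meaning of memory contents\<close>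

definition adj_ok :: "(nat \<Rightarrow> nat) \<Rightarrow> bool" where
  "adj_ok M \<longleftrightarrow> (\<forall>i<n. \<forall>j<n. M (i * n + j) = (if a i j then 1 else 0))"

definition cur_base :: nat where "cur_base = n * n"
definition imp_base :: nat where "imp_base = n * n + n"
definition stack_base :: nat where "stack_base = 10 * (n * n) + n"

definition block :: "(nat \<Rightarrow> nat) \<Rightarrow> nat \<Rightarrow> nat list" where
  "block M p = map (\<lambda>i. M (stack_base + (p * n + i))) [0..<n]"

definition holds_state :: "nat list \<Rightarrow> (nat \<Rightarrow> nat) \<Rightarrow> bool" where
  "holds_state g M \<longleftrightarrow> adj_ok M \<and> (\<forall>i<n. M (cur_base + i) = g ! i)"

lemma block_nth: "i < n \<Longrightarrow> block M p ! i = M (stack_base + (p * n + i))"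
  by (simp add: block_def)

lemma bases: "cur_base + n = imp_base" "imp_base + (3 * n) * (3 * n) = stack_base"
  by (simp_all add: cur_base_def imp_base_def stack_base_def)

lemma holds_state_cong:
  assumes "holds_state g M" "\<And>x. x < imp_base \<Longrightarrow> M' x = M x"
  shows "holds_state g M'"
proof -
  have "i * n + j < imp_base" if "i < n" "j < n" for i j
    using addr_less[OF that] by (simp add: imp_base_def)
  moreover have "cur_base + i < imp_base" if "i < n" for i
    using that by (simp add: imp_base_def cur_base_def)
  ultimately show ?thesis using assms by (simp add: holds_state_def adj_ok_def)
qed

lemma adj_ok_cong:
  assumes "adj_ok M" "\<And>x. x < cur_base \<Longrightarrow> M' x = M x"
  shows "adj_ok M'"
  using assms addr_less unfolding adj_ok_def cur_base_def by metis

lemma eval_addrs: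
  assumes "fst s 0 = n"
  shows "eval (adj_addr v i) s = eval v s * n + eval i s"
    "eval (cur_addr i) s = cur_base + eval i s"
    "eval (imp_addr p q) s = imp_base + (eval p s * (3 * n) + eval q s)"
    "eval (stack_addr p i) s = stack_base + (eval p s * n + eval i s)"
    "eval (is_unset i) s = (if snd s (cur_base + eval i s) = 3 then 1 else 0)"
    "eval (literal p q) s = 3 * eval p s + eval q s"
    "eval (complement p) s = 1 - eval p s"
  using assms by (simp_all add: addr_defs cur_base_def imp_base_def stack_base_def)

lemma holds_stateD:
  assumes "holds_state g M" "i < n"
  shows "M (cur_base + i) = g ! i" "j < n \<Longrightarrow> M (i * n + j) = (if a i j then 1 else 0)"
  using assms by (auto simp: holds_state_def adj_ok_def)

section \<open>Taking a state from the stack, selecting a vertex and pushing children\<close>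

lemma wp_pop:
  assumes R: "R 0 = n" "R 2 = Suc p" and M: "adj_ok M" "valid (block M p)" and B: "n + 3 \<le> B" "p \<le> B"
    and post: "\<And>R' M'. (\<And>y. y \<notin> {2, 6} \<Longrightarrow> R' y = R y) \<Longrightarrow> R' 2 = p \<Longrightarrow>
      (\<And>x. stack_base \<le> x \<Longrightarrow> M' x = M x) \<Longrightarrow> holds_state (block M p) M' \<Longrightarrow> Q (R', M')"
  shows "wp B pop_prog Q (R, M)"
proof -
  have "wp B (For 6 (Var 0) (Write (cur_addr (Var 6)) (Mem (stack_addr (Var 2) (Var 6))))) Q
      (R(2 := p), M)"
  proof (rule wp_fill[where n = n and A = cur_base and f = "\<lambda>j. block M p ! j"])
    fix j R' M'
    assume *: "j < n" "\<And>y. y \<noteq> 6 \<Longrightarrow> R' y = (R(2 := p)) y" "R' 6 = j"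
      "\<And>y. y \<notin> {cur_base..<cur_base + n} \<Longrightarrow> M' y = M y"
    have R': "R' 0 = n" "R' 2 = p" using * R by simp_all
    have "M' (stack_base + (p * n + j)) = M (stack_base + (p * n + j))"
      using *(4) by (simp add: cur_base_def stack_base_def)
    moreover have "block M p ! j \<le> 3" using M(2) *(1) by (simp add: valid_def)
    ultimately show "eval (cur_addr (Var 6)) (R', M') = cur_base + j \<and>
        eval (Mem (stack_addr (Var 2) (Var 6))) (R', M') = block M p ! j \<and> block M p ! j \<le> B"
      using R' *(1,3) B by (simp add: eval_addrs block_nth)
  next
    fix R' M'
    assume *: "\<And>y. y \<noteq> 6 \<Longrightarrow> R' y = (R(2 := p)) y"
      "\<And>y. y \<notin> {cur_base..<cur_base + n} \<Longrightarrow> M' y = M y"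
      "\<And>j. j < n \<Longrightarrow> M' (cur_base + j) = block M p ! j"
    have "adj_ok M'" by (rule adj_ok_cong[OF M(1)]) (use *(2) in simp)
    then show "Q (R', M')" using * by (intro post) (auto simp: holds_state_def cur_base_def stack_base_def)
  qed (use R B in auto)
  then show ?thesis using R B by (simp add: pop_prog_def wp_simps)
qed

lemma card_upto_Suc:
  "card {j. j < Suc i \<and> P j} = card {j. j < i \<and> P j} + (if P i then 1 else 0)"
proof -
  have "{j. j < Suc i \<and> P j} = {j. j < i \<and> P j} \<union> (if P i then {i} else {})"
    by (auto simp: less_Suc_eq)
  then show ?thesis by (auto simp: card_insert_if)
qed

lemma card_upto_le: "card {j. j < i \<and> P j} \<le> (i::nat)"
proof -
  have "card {j. j < i \<and> P j} \<le> card {..<i}" by (intro card_mono) auto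
  then show ?thesis by simp
qed

lemma select_upto_Suc:
  "select_upto g m = (b, v) \<Longrightarrow> select_upto g (Suc m) =
    (if b < score g m then (score g m, m) else (b, v))"
  by (simp add: select_upto_def)

lemma wp_select:
  assumes R: "R 0 = n" and M: "holds_state g M" and B: "n + 1 \<le> B"
    and post: "\<And>R'. (\<And>y. y \<notin> {3, 4, 5, 6, 7} \<Longrightarrow> R' y = R y) \<Longrightarrow>
      select g = (R' 3, R' 4) \<Longrightarrow> Q (R', M)"
  shows "wp B select_prog Q (R, M)"
proof -
  define I where "I m R' M' \<longleftrightarrow> (\<forall>y. y \<notin> {3, 4, 5, 6, 7} \<longrightarrow> R' y = R y) \<and>
    select_upto g m = (R' 3, R' 4) \<and> R' 3 \<le> B \<and> R' 4 \<le> B \<and> M' = M" for m and R' M' :: "nat \<Rightarrow> nat"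
  have udeg: "udeg g v = card {j. j < n \<and> (a v j \<and> g ! j = 3)}" for v
    unfolding udeg_def unset_def by (rule arg_cong[of _ _ card]) auto
  let ?inner = "For 6 (Var 0) (Assign 7 (Plus (Var 7)
    (Times (Mem (adj_addr (Var 5) (Var 6))) (is_unset (Var 6)))))"
  let ?tail = "Sq (Assign 7 (Ite (is_unset (Var 5)) (Var 7)
            (Ite (Lt (Num 2) (Var 7)) (Plus (Var 7) (Num 1)) (Num 0))))
         (Sq (Assign 4 (Ite (Lt (Var 3) (Var 7)) (Var 5) (Var 4)))
           (Assign 3 (Ite (Lt (Var 3) (Var 7)) (Var 7) (Var 3))))"
  have loop: "wp B (For 5 (Var 0) (Sq (Assign 7 (Num 0)) (Sq ?inner ?tail))) Q (R(3 := 0, 4 := 0), M)"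
  proof (rule wp_For[where N = n and I = I])
    show "I 0 (R(3 := 0, 4 := 0)) M" by (simp add: I_def select_upto_def)
  next
    fix m R' M' assume m: "m < n" and I: "I m R' M'"
    then have M': "M' = M" and R': "R' 0 = n" using R by (auto simp: I_def)
    let ?R = "R'(5 := m, 7 := 0)"
    have "wp B ?inner (wp B ?tail (\<lambda>(R, M). I (Suc m) R M)) (?R, M)"
    proof (rule wp_For[where N = n and I = "\<lambda>i R'' M''. M'' = M \<and> (\<forall>y. y \<noteq> 6 \<and> y \<noteq> 7 \<longrightarrow> R'' y = ?R y) \<and>
        R'' 7 = card {j. j < i \<and> (a m j \<and> g ! j = 3)}"])
      fix i R'' M''
      assume i: "i < n" and J: "M'' = M \<and> (\<forall>y. y \<noteq> 6 \<and> y \<noteq> 7 \<longrightarrow> R'' y = ?R y) \<and>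
        R'' 7 = card {j. j < i \<and> (a m j \<and> g ! j = 3)}"
      have "card {j. j < Suc i \<and> (a m j \<and> g ! j = 3)} \<le> B"
        using card_upto_le[of "Suc i" "\<lambda>j. a m j \<and> g ! j = 3"] i B by linarith
      then show "wp B (Assign 7 (Plus (Var 7) (Times (Mem (adj_addr (Var 5) (Var 6))) (is_unset (Var 6)))))
        (\<lambda>(R'', M''). M'' = M \<and> (\<forall>y. y \<noteq> 6 \<and> y \<noteq> 7 \<longrightarrow> R'' y = ?R y) \<and>
        R'' 7 = card {j. j < Suc i \<and> (a m j \<and> g ! j = 3)}) (R''(6 := i), M'')"
        using J R' holds_stateD[OF M m] holds_stateD[OF M i] i m
        by (auto simp: wp_Assign eval_addrs card_upto_Suc)
    next
      fix R'' M''
      assume J: "M'' = M \<and> (\<forall>y. y \<noteq> 6 \<and> y \<noteq> 7 \<longrightarrow> R'' y = ?R y) \<and>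
        R'' 7 = card {j. j < n \<and> (a m j \<and> g ! j = 3)}"
      then have c: "R'' 7 = udeg g m" "udeg g m \<le> n" using card_upto_le by (simp_all add: udeg)
      have sel: "select_upto g m = (R' 3, R' 4)" "R' 3 \<le> B" "R' 4 \<le> B" using I by (auto simp: I_def)
      have s: "eval (Ite (is_unset (Var 5)) (Var 7)
            (Ite (Lt (Num 2) (Var 7)) (Plus (Var 7) (Num 1)) (Num 0))) (R'', M) = score g m"
        using J R' c holds_stateD[OF M m] by (simp add: eval_addrs score_def Suc_le_eq)
      have sB: "score g m \<le> B" using c B by (simp add: score_def)
      show "wp B ?tail (\<lambda>(R, M). I (Suc m) R M) (R'', M'')"
        using J I sel sB m B c
        by (auto simp only: wp_Sq wp_Assign s split: prod.split)
          (auto simp: I_def select_upto_Suc[OF sel(1)])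
    qed (use R' B in auto)
    then show "wp B (Sq (Assign 7 (Num 0)) (Sq ?inner ?tail)) (\<lambda>(R, M). I (Suc m) R M) (R'(5 := m), M')"
      using B M' by (simp add: wp_simps)
  next
    fix R' M' assume "I n R' M'"
    then show "Q (R', M')" using post[of R'] by (auto simp: I_def)
  qed (use R B in auto)
  then show ?thesis using B by (simp add: select_prog_def wp_simps)
qed

text \<open>Shared by the two kinds of children. Every round writes the child for \<open>k\<close>
  into the first free slot, and \<open>P k\<close> decides whether it is kept. Only that slot
  changes, so the blocks below survive.\<close>

lemma wp_push:
  assumes B: "K \<le> B" and p: "R 2 = p" and V: "V = {2, 6, 7, 9}"
    and step: "\<And>k q R' M'. k < K \<Longrightarrow> p \<le> q \<Longrightarrow> q \<le> p + k \<Longrightarrow> (\<And>y. y \<notin> V \<Longrightarrow> R' y = R y) \<Longrightarrow>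
      R' 9 = k \<Longrightarrow> R' 2 = q \<Longrightarrow> (\<And>x. x < stack_base \<Longrightarrow> M' x = M x) \<Longrightarrow>
      wp B body (\<lambda>(R'', M''). (\<forall>y. y \<notin> V \<longrightarrow> R'' y = R y) \<and>
        R'' 2 = q + (if P k then 1 else 0) \<and>
        (\<forall>x. x \<notin> {stack_base + q * n..<stack_base + q * n + n} \<longrightarrow> M'' x = M' x) \<and>
        block M'' q = ch k) (R', M')"
    and post: "\<And>R' M'. (\<And>y. y \<notin> V \<Longrightarrow> R' y = R y) \<Longrightarrow> R' 2 = p + length (filter P [0..<K]) \<Longrightarrow>
      (\<And>x. x < stack_base \<Longrightarrow> M' x = M x) \<Longrightarrow> (\<And>q. q < p \<Longrightarrow> block M' q = block M q) \<Longrightarrow>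
      (\<And>j. j < length (filter P [0..<K]) \<Longrightarrow> block M' (p + j) = ch (filter P [0..<K] ! j)) \<Longrightarrow>
      Q (R', M')"
  shows "wp B (For 9 (Num K) body) Q (R, M)"
proof -
  define cs where "cs k = filter P [0..<k]" for k
  have cs_Suc: "cs (Suc k) = cs k @ (if P k then [k] else [])" for k by (simp add: cs_def)
  have cs_len: "length (cs k) \<le> k" for k using length_filter_le[of P "[0..<k]"] by (simp add: cs_def)
  define I where "I k R' M' \<longleftrightarrow> (\<forall>y. y \<notin> V \<longrightarrow> R' y = R y) \<and> R' 2 = p + length (cs k) \<and>
     (\<forall>x<stack_base. M' x = M x) \<and> (\<forall>q<p. block M' q = block M q) \<and>
     (\<forall>j<length (cs k). block M' (p + j) = ch (cs k ! j))" for k R' M'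
  show ?thesis
  proof (rule wp_For[where N = K and I = I])
    show "I 0 R M" using p by (simp add: I_def cs_def)
  next
    fix k R' M' assume k: "k < K" and I: "I k R' M'"
    define q where "q = p + length (cs k)"
    have "wp B body (\<lambda>(R'', M''). (\<forall>y. y \<notin> V \<longrightarrow> R'' y = R y) \<and>
        R'' 2 = q + (if P k then 1 else 0) \<and>
        (\<forall>x. x \<notin> {stack_base + q * n..<stack_base + q * n + n} \<longrightarrow> M'' x = M' x) \<and>
        block M'' q = ch k) (R'(9 := k), M')"
      by (rule step[OF k]) (use I k cs_len[of k] V in \<open>auto simp: I_def q_def\<close>)
    then show "wp B body (\<lambda>(R, M). I (Suc k) R M) (R'(9 := k), M')"
    proof (rule wp_mono)
      fix R'' M''
      assume J: "case (R'', M'') of (R'', M'') \<Rightarrow> (\<forall>y. y \<notin> V \<longrightarrow> R'' y = R y) \<and>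
        R'' 2 = q + (if P k then 1 else 0) \<and>
        (\<forall>x. x \<notin> {stack_base + q * n..<stack_base + q * n + n} \<longrightarrow> M'' x = M' x) \<and>
        block M'' q = ch k"
      have below: "block M'' r = block M' r" if "r < q" for r
      proof (unfold block_def, rule map_cong[OF refl])
        fix i assume "i \<in> set [0..<n]"
        then have "r * n + i < q * n" using addr_less[OF that, of i n] by simp
        then show "M'' (stack_base + (r * n + i)) = M' (stack_base + (r * n + i))" using J by simp
      qed
      have "block M'' (p + j) = ch (cs (Suc k) ! j)" if j: "j < length (cs (Suc k))" for j
      proof (cases "j < length (cs k)")
        case True
        then have "block M'' (p + j) = block M' (p + j)" by (intro below) (simp add: q_def)
        then show ?thesis using I True by (simp add: I_def cs_Suc nth_append)
      next
        case False
        then have "j = length (cs k)" "P k" using j by (auto simp: cs_Suc split: if_splits)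
        then show ?thesis using J by (simp add: cs_Suc nth_append q_def)
      qed
      moreover have "block M'' r = block M r" if "r < p" for r
        using below[of r] that I by (simp add: q_def I_def)
      ultimately show "case (R'', M'') of (R, M) \<Rightarrow> I (Suc k) R M"
        using J I by (auto simp: I_def cs_Suc q_def)
    qed
  next
    fix R' M' assume "I K R' M'"
    then show "Q (R', M')" by (intro post) (auto simp: I_def cs_def)
  qed (use B in auto)
qed

lemma block_eqI:
  assumes "length h = n" "\<And>j. j < n \<Longrightarrow> M (stack_base + q * n + j) = h ! j"
  shows "block M q = h"
  using assms by (intro nth_equalityI) (simp_all add: block_def add.assoc)

lemma base_less: "x < imp_base \<Longrightarrow> x < stack_base" "imp_base \<le> stack_base"
  by (simp_all add: imp_base_def stack_base_def)

lemma wp_star: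
  assumes R: "R 0 = n" "R 2 = p" "select g = (R 3, R 4)" "R 4 < n" and M: "holds_state g M" "valid g"
    and B: "n + 3 \<le> B" "p + 3 \<le> B"
    and post: "\<And>R' M'. (\<And>y. y \<notin> {2, 6, 7, 9} \<Longrightarrow> R' y = R y) \<Longrightarrow> R' 2 = p + length (star_colours g) \<Longrightarrow>
      (\<And>x. x < stack_base \<Longrightarrow> M' x = M x) \<Longrightarrow> (\<And>q. q < p \<Longrightarrow> block M' q = block M q) \<Longrightarrow>
      (\<And>j. j < length (star_colours g) \<Longrightarrow> block M' (p + j) = star_child g (R 4) (star_colours g ! j)) \<Longrightarrow>
      Q (R', M')"
  shows "wp B star_prog Q (R, M)"
  unfolding star_prog_def
proof (rule wp_push[where ch = "star_child g (R 4)" and p = p and V = "{2, 6, 7, 9}"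
      and P = "\<lambda>k. k \<noteq> g ! R 4 \<and> \<not> (R 3 = 1 \<and> k = 2)"])
  fix k q R' M'
  assume k: "k < 3" and q: "p \<le> q" "q \<le> p + k"
    and R': "\<And>y. y \<notin> {2, 6, 7, 9} \<Longrightarrow> R' y = R y" "R' 9 = k" "R' 2 = q"
    and M': "\<And>x. x < stack_base \<Longrightarrow> M' x = M x"
  have h: "holds_state g M'" by (rule holds_state_cong[OF M(1)]) (use M' base_less in auto)
  let ?tail = "Assign 2 (Plus (Var 2) (Times (complement (Eq (Var 9) (Mem (cur_addr (Var 4)))))
       (complement (Times (Eq (Var 3) (Num 1)) (Eq (Var 9) (Num 2))))))"
  let ?post = "\<lambda>(R'', M''). (\<forall>y. y \<notin> {2, 6, 7, 9} \<longrightarrow> R'' y = R y) \<and>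
        R'' 2 = q + (if k \<noteq> g ! R 4 \<and> \<not> (R 3 = 1 \<and> k = 2) then 1 else 0) \<and>
        (\<forall>x. x \<notin> {stack_base + q * n..<stack_base + q * n + n} \<longrightarrow> M'' x = M' x) \<and>
        block M'' q = star_child g (R 4) k"
  have "valid (star_child g (R 4) k)" using valid_star_child[OF M(2) k] .
  then have le3: "star_child g (R 4) k ! j \<le> 3" if "j < n" for j using that by (simp add: valid_def)
  have "wp B (For 6 (Var 0) (Write (stack_addr (Var 2) (Var 6))
       (Ite (is_unset (Var 6)) (Ite (Mem (adj_addr (Var 4) (Var 6))) (Var 9)
         (Ite (Eq (Var 6) (Var 4)) (Ite (Eq (Var 9) (Num 0)) (Num 1) (Num 0)) (Num 3)))
         (Mem (cur_addr (Var 6)))))) (wp B ?tail ?post) (R', M')"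
  proof (rule wp_fill[where n = n and A = "stack_base + q * n" and f = "\<lambda>j. star_child g (R 4) k ! j"])
    fix j R'' M''
    assume j: "j < n" and R'': "\<And>y. y \<noteq> 6 \<Longrightarrow> R'' y = R' y" "R'' 6 = j"
      and M'': "\<And>y. y \<notin> {stack_base + q * n..<stack_base + q * n + n} \<Longrightarrow> M'' y = M' y"
    have h'': "holds_state g M''" by (rule holds_state_cong[OF h]) (use M'' base_less in auto)
    have regs: "R'' 0 = n" "R'' 2 = q" "R'' 4 = R 4" "R'' 9 = k" using R'' R' R by simp_all
    let ?val = "Ite (is_unset (Var 6)) (Ite (Mem (adj_addr (Var 4) (Var 6))) (Var 9)
         (Ite (Eq (Var 6) (Var 4)) (Ite (Eq (Var 9) (Num 0)) (Num 1) (Num 0)) (Num 3)))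
         (Mem (cur_addr (Var 6)))"
    have "eval ?val (R'', M'') = (if g ! j = 3 then if a (R 4) j then k
        else if j = R 4 then if k = 0 then 1 else 0 else 3 else g ! j)"
      using regs R''(2) holds_stateD(1)[OF h'' j] holds_stateD(2)[OF h'' R(4) j]
      by (simp add: eval_addrs)
    also have "\<dots> = star_child g (R 4) k ! j" using j by (auto simp: star_child_nth)
    finally have val: "eval ?val (R'', M'') = star_child g (R 4) k ! j" .
    show "eval (stack_addr (Var 2) (Var 6)) (R'', M'') = stack_base + q * n + j \<and>
      eval (Ite (is_unset (Var 6)) (Ite (Mem (adj_addr (Var 4) (Var 6))) (Var 9)
         (Ite (Eq (Var 6) (Var 4)) (Ite (Eq (Var 9) (Num 0)) (Num 1) (Num 0)) (Num 3)))
         (Mem (cur_addr (Var 6)))) (R'', M'') = star_child g (R 4) k ! j \<and>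
      star_child g (R 4) k ! j \<le> B"
      unfolding val using regs R''(2) le3[OF j] B by (simp add: eval_addrs)
  next
    fix R'' M''
    assume R'': "\<And>y. y \<noteq> 6 \<Longrightarrow> R'' y = R' y"
      and M'': "\<And>y. y \<notin> {stack_base + q * n..<stack_base + q * n + n} \<Longrightarrow> M'' y = M' y"
      and blk: "\<And>j. j < n \<Longrightarrow> M'' (stack_base + q * n + j) = star_child g (R 4) k ! j"
    have h'': "holds_state g M''" by (rule holds_state_cong[OF h]) (use M'' base_less in auto)
    have "R'' 0 = n" "R'' 2 = q" "R'' 3 = R 3" "R'' 4 = R 4" "R'' 9 = k" using R'' R' R by simp_all
    then have "eval (Plus (Var 2) (Times (complement (Eq (Var 9) (Mem (cur_addr (Var 4)))))
       (complement (Times (Eq (Var 3) (Num 1)) (Eq (Var 9) (Num 2)))))) (R'', M'') =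
       q + (if k \<noteq> g ! R 4 \<and> \<not> (R 3 = 1 \<and> k = 2) then 1 else 0)"
      using holds_stateD(1)[OF h'' R(4)] by (auto simp: eval_addrs)
    moreover have "block M'' q = star_child g (R 4) k" by (rule block_eqI) (use blk in auto)
    ultimately show "wp B ?tail ?post (R'', M'')"
      using R'' R' M'' q k B by (simp add: wp_Assign)
  qed (use R R' B in auto)
  then show "wp B (Sq (For 6 (Var 0) (Write (stack_addr (Var 2) (Var 6))
       (Ite (is_unset (Var 6)) (Ite (Mem (adj_addr (Var 4) (Var 6))) (Var 9)
         (Ite (Eq (Var 6) (Var 4)) (Ite (Eq (Var 9) (Num 0)) (Num 1) (Num 0)) (Num 3)))
         (Mem (cur_addr (Var 6)))))) ?tail) ?post (R', M')"
    by (simp add: wp_Sq)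
next
  fix R' M'
  have "filter (\<lambda>k. k \<noteq> g ! R 4 \<and> \<not> (R 3 = 1 \<and> k = 2)) [0..<3] = star_colours g"
    by (simp only: star_colours_def R(3) prod.case)
  note post' = post[folded this]
  show "(\<And>y. y \<notin> {2, 6, 7, 9} \<Longrightarrow> R' y = R y) \<Longrightarrow>
    R' 2 = p + length (filter (\<lambda>k. k \<noteq> g ! R 4 \<and> \<not> (R 3 = 1 \<and> k = 2)) [0..<3]) \<Longrightarrow>
    (\<And>x. x < stack_base \<Longrightarrow> M' x = M x) \<Longrightarrow> (\<And>q. q < p \<Longrightarrow> block M' q = block M q) \<Longrightarrow>
    (\<And>j. j < length (filter (\<lambda>k. k \<noteq> g ! R 4 \<and> \<not> (R 3 = 1 \<and> k = 2)) [0..<3]) \<Longrightarrow>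
      block M' (p + j) = star_child g (R 4)
        (filter (\<lambda>k. k \<noteq> g ! R 4 \<and> \<not> (R 3 = 1 \<and> k = 2)) [0..<3] ! j)) \<Longrightarrow> Q (R', M')"
    by (rule post')
qed (use R B in auto)

lemma rank_eq: "i \<le> n \<Longrightarrow> rank g i = card {j. j < i \<and> g ! j = 3}"
  unfolding rank_def unset_def by (rule arg_cong[of _ _ card]) auto

lemma wp_cover:
  assumes R: "R 0 = n" "R 2 = p" and M: "holds_state g M" "valid g"
    and B: "n + 8 \<le> B" "p + 8 \<le> B"
    and post: "\<And>R' M'. (\<And>y. y \<notin> {2, 6, 7, 9} \<Longrightarrow> R' y = R y) \<Longrightarrow> R' 2 = p + 8 \<Longrightarrow>
      (\<And>x. x < stack_base \<Longrightarrow> M' x = M x) \<Longrightarrow> (\<And>q. q < p \<Longrightarrow> block M' q = block M q) \<Longrightarrow>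
      (\<And>j. j < 8 \<Longrightarrow> block M' (p + j) = cover_child g j) \<Longrightarrow> Q (R', M')"
  shows "wp B cover_prog Q (R, M)"
  unfolding cover_prog_def
proof (rule wp_push[where ch = "cover_child g" and p = p and V = "{2, 6, 7, 9}" and P = "\<lambda>k. True"])
  fix k q R' M'
  assume k: "k < 8" and q: "p \<le> q" "q \<le> p + k"
    and R': "\<And>y. y \<notin> {2, 6, 7, 9} \<Longrightarrow> R' y = R y" "R' 9 = k" "R' 2 = q"
    and M': "\<And>x. x < stack_base \<Longrightarrow> M' x = M x"
  have h: "holds_state g M'" by (rule holds_state_cong[OF M(1)]) (use M' base_less in auto)
  let ?A = "stack_base + q * n"
  let ?val = "Ite (is_unset (Var 6)) (Ite (Lt (Var 7) (Num 4))
           (table (Plus (Times (Num 4) (Var 9)) (Var 7)) 0 cover_words) (Num 3))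
         (Mem (cur_addr (Var 6)))"
  let ?body = "Sq (Write (stack_addr (Var 2) (Var 6)) ?val) (Assign 7 (Plus (Var 7) (is_unset (Var 6))))"
  let ?tail = "Assign 2 (Plus (Var 2) (Num 1))"
  let ?post = "\<lambda>(R'', M''). (\<forall>y. y \<notin> {2, 6, 7, 9} \<longrightarrow> R'' y = R y) \<and>
        R'' 2 = q + (if True then 1 else 0) \<and>
        (\<forall>x. x \<notin> {?A..<?A + n} \<longrightarrow> M'' x = M' x) \<and> block M'' q = cover_child g k"
  have "valid (cover_child g k)" using valid_cover_child[OF M(2) k] .
  then have le3: "cover_child g k ! j \<le> 3" if "j < n" for j using that by (simp add: valid_def)
  \<comment> \<open>Register 7 counts the unset vertices before \<open>i\<close>. This is the rank
    that selects the letter of the word.\<close>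
  define I where "I i R'' M'' \<longleftrightarrow> (\<forall>y. y \<notin> {6, 7} \<longrightarrow> R'' y = R' y) \<and> R'' 7 = rank g i \<and>
     (\<forall>x. x \<notin> {?A..<?A + n} \<longrightarrow> M'' x = M' x) \<and> (\<forall>j<i. M'' (?A + j) = cover_child g k ! j)"
    for i R'' M''
  have "wp B (For 6 (Var 0) ?body) (wp B ?tail ?post) (R'(7 := 0), M')"
  proof (rule wp_For[where N = n and I = I])
    show "I 0 (R'(7 := 0)) M'" by (simp add: I_def rank_def)
  next
    fix i R'' M'' assume i: "i < n" and J: "I i R'' M''"
    have h'': "holds_state g M''"
      by (rule holds_state_cong[OF h]) (use J base_less in \<open>auto simp: I_def\<close>)
    have regs: "R'' 0 = n" "R'' 2 = q" "R'' 9 = k" "R'' 7 = rank g i"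
      using J R' R by (simp_all add: I_def)
    have len: "length cover_words = 32" by (simp add: cover_words_def)
    have val: "eval ?val (R''(6 := i), M'') = cover_child g k ! i"
    proof (cases "g ! i = 3 \<and> rank g i < 4")
      case True
      then have "4 * k + rank g i < 32" using k by linarith
      then have "eval (table (Plus (Times (Num 4) (Var 9)) (Var 7)) 0 cover_words) (R''(6 := i), M'') =
          cover_words ! (4 * k + rank g i)"
        using regs len by (subst eval_table) simp_all
      then show ?thesis using True regs holds_stateD(1)[OF h'' i] i
        by (simp add: eval_addrs cover_child_nth)
    next
      case False
      then show ?thesis using regs holds_stateD(1)[OF h'' i] i
        by (auto simp: eval_addrs cover_child_nth)
    qed
    have addr: "eval (stack_addr (Var 2) (Var 6)) (R''(6 := i), M'') = ?A + i"
      using regs by (simp add: eval_addrs)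
    let ?M = "M''(?A + i := cover_child g k ! i)"
    have h3: "holds_state g ?M"
      by (rule holds_state_cong[OF h'']) (use base_less in auto)
    have rS: "rank g (Suc i) = rank g i + (if g ! i = 3 then 1 else 0)"
      using i by (simp add: rank_eq card_upto_Suc)
    have rB: "rank g (Suc i) \<le> B"
      using card_upto_le[of "Suc i" "\<lambda>j. g ! j = 3"] i B by (simp add: rank_eq)
    have inc: "eval (Plus (Var 7) (is_unset (Var 6))) (R''(6 := i), ?M) = rank g (Suc i)"
      using regs holds_stateD(1)[OF h3 i] by (simp add: eval_addrs rS)
    have "cover_child g k ! i \<le> B" using le3[OF i] B by simp
    then show "wp B ?body (\<lambda>(R, M). I (Suc i) R M) (R''(6 := i), M'')"
      unfolding wp_Sq wp_Write val addr wp_Assign inc using J i rB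
      by (auto simp: I_def less_Suc_eq)
  next
    fix R'' M'' assume J: "I n R'' M''"
    have "block M'' q = cover_child g k" by (rule block_eqI) (use J in \<open>auto simp: I_def\<close>)
    moreover have "R'' 2 = q" using J R' by (simp add: I_def)
    ultimately show "wp B ?tail ?post (R'', M'')"
      using J R' q k B by (auto simp: wp_Assign I_def)
  qed (use R R' B in auto)
  then show "wp B (Sq (Assign 7 (Num 0)) (Sq (For 6 (Var 0) ?body) ?tail)) ?post (R', M')"
    by (simp add: wp_Sq wp_Assign)
next
  fix R' M'
  have f: "filter (\<lambda>k. True) [0..<8] = [0..<8]" by simp
  show "(\<And>y. y \<notin> {2, 6, 7, 9} \<Longrightarrow> R' y = R y) \<Longrightarrow> R' 2 = p + length (filter (\<lambda>k. True) [0..<8]) \<Longrightarrow>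
    (\<And>x. x < stack_base \<Longrightarrow> M' x = M x) \<Longrightarrow> (\<And>q. q < p \<Longrightarrow> block M' q = block M q) \<Longrightarrow>
    (\<And>j. j < length (filter (\<lambda>k. True) [0..<8]) \<Longrightarrow>
      block M' (p + j) = cover_child g (filter (\<lambda>k. True) [0..<8] ! j)) \<Longrightarrow> Q (R', M')"
    unfolding f by (rule post) simp_all
qed (use R B in auto)

lemma wp_count:
  assumes R: "R 0 = n" and M: "holds_state g M" and B: "n \<le> B"
    and post: "\<And>R'. (\<And>y. y \<notin> {6, 7} \<Longrightarrow> R' y = R y) \<Longrightarrow> R' 7 = card (unset g) \<Longrightarrow> Q (R', M)"
  shows "wp B count_prog Q (R, M)"
proof -
  have "wp B (For 6 (Var 0) (Assign 7 (Plus (Var 7) (is_unset (Var 6))))) Q (R(7 := 0), M)"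
  proof (rule wp_For[where N = n and I = "\<lambda>i R' M'. (\<forall>y. y \<notin> {6, 7} \<longrightarrow> R' y = R y) \<and>
      R' 7 = card {j. j < i \<and> g ! j = 3} \<and> M' = M"])
    fix i R' M'
    assume i: "i < n" and I: "(\<forall>y. y \<notin> {6, 7} \<longrightarrow> R' y = R y) \<and>
      R' 7 = card {j. j < i \<and> g ! j = 3} \<and> M' = M"
    have "card {j. j < Suc i \<and> g ! j = 3} \<le> B"
      using card_upto_le[of "Suc i" "\<lambda>j. g ! j = 3"] i B by linarith
    then show "wp B (Assign 7 (Plus (Var 7) (is_unset (Var 6)))) (\<lambda>(R', M').
      (\<forall>y. y \<notin> {6, 7} \<longrightarrow> R' y = R y) \<and> R' 7 = card {j. j < Suc i \<and> g ! j = 3} \<and> M' = M)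
      (R'(6 := i), M')"
      using I R holds_stateD(1)[OF M i] by (auto simp: wp_Assign eval_addrs card_upto_Suc)
  qed (use R B post in \<open>auto simp: unset_def\<close>)
  then show ?thesis by (simp add: count_prog_def wp_simps)
qed

section \<open>Implication matrix, transitive closure and search for contradictory cycles\<close>

definition cell :: "(nat \<Rightarrow> nat) \<Rightarrow> nat \<Rightarrow> nat \<Rightarrow> nat" where
  "cell M p q = M (imp_base + (p * (3 * n) + q))"

lemma cell_update:
  assumes "j < 3 * n" "q < 3 * n"
  shows "cell (M(imp_base + (i * (3 * n) + j) := x)) p q = (if p = i \<and> q = j then x else cell M p q)"
  using addr_eq_iff[OF assms, of p i] by (simp add: cell_def)

lemma imp_addr_less:
  assumes "i < 3 * n" "j < 3 * n"
  shows "imp_base + (i * (3 * n) + j) < stack_base"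
  using addr_less[OF assms] bases by linarith

definition stores :: "(nat \<times> nat) set \<Rightarrow> (nat \<Rightarrow> nat) \<Rightarrow> bool" where
  "stores E M \<longleftrightarrow> (\<forall>p<3 * n. \<forall>q<3 * n. cell M p q = (if (p, q) \<in> E then 1 else 0))"

definition same_outside :: "(nat \<Rightarrow> nat) \<Rightarrow> (nat \<Rightarrow> nat) \<Rightarrow> bool" where
  "same_outside M M' \<longleftrightarrow> (\<forall>x. x < imp_base \<or> stack_base \<le> x \<longrightarrow> M' x = M x)"

lemma same_outside_update:
  "same_outside M M' \<Longrightarrow> i < 3 * n \<Longrightarrow> j < 3 * n \<Longrightarrow>
    same_outside M (M'(imp_base + (i * (3 * n) + j) := x))"
  using imp_addr_less by (force simp: same_outside_def)

lemma holds_state_outside: "holds_state g M \<Longrightarrow> same_outside M M' \<Longrightarrow> holds_state g M'"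
  by (rule holds_state_cong) (auto simp: same_outside_def)

lemma literal_less: "v < n \<Longrightarrow> c < 3 \<Longrightarrow> 3 * v + c < 3 * n"
  by linarith

text \<open>Nothing is assumed about the old matrix, which may hold the closure from an earlier
  leaf; so zeros are written as well as ones.\<close>

lemma wp_imp:
  assumes R: "R 0 = n" and M: "holds_state g M" and B: "n + 3 \<le> B"
    and post: "\<And>R' M'. (\<And>y. y \<notin> {5, 6, 7, 8} \<Longrightarrow> R' y = R y) \<Longrightarrow> same_outside M M' \<Longrightarrow>
      stores (implications g) M' \<Longrightarrow> Q (R', M')"
  shows "wp B imp_prog Q (R, M)"
proof -
  \<comment> \<open>The rows before \<open>m\<close> are complete, and row \<open>m\<close> is
    complete up to column \<open>r\<close>.\<close>
  define F where "F m r R' M' \<longleftrightarrow> (\<forall>y. y \<notin> {5, 6, 7, 8} \<longrightarrow> R' y = R y) \<and> same_outside M M' \<and>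
     (\<forall>p q. q < 3 * n \<longrightarrow> p < m \<or> p = m \<and> q < r \<longrightarrow>
        cell M' p q = (if (p, q) \<in> implications g then 1 else 0))" for m r R' M'
  have F0: "F m r R' M' \<Longrightarrow> R' 0 = n" for m r R' M' using R by (simp add: F_def)
  have F_row: "F m (3 * n) R' M' \<Longrightarrow> F (Suc m) 0 R' M'" for m R' M'
    by (auto simp: F_def less_Suc_eq)
  have F_upd: "F m r (R'(y := i)) M'" if "F m r R' M'" "y \<in> {5, 6, 7, 8}" for m r R' M' y i
    using that by (auto simp: F_def)
  have t3: "3 * Suc x = 3 * x + 3" for x :: nat by simp
  let ?val = "Times (Mem (adj_addr (Var 5) (Var 6))) (Times (complement (Eq (Var 7) (Var 8)))
         (Times (complement (Eq (Var 7) (Mem (cur_addr (Var 5)))))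
           (Times (complement (Eq (Var 7) (Mem (cur_addr (Var 6)))))
             (complement (Eq (Var 8) (Mem (cur_addr (Var 6))))))))"
  let ?W = "Write (imp_addr (literal (Var 5) (Var 7)) (literal (Var 6) (Var 8))) ?val"
  have "wp B (For 5 (Var 0) (For 7 (Num 3) (For 6 (Var 0) (For 8 (Num 3) ?W)))) Q (R, M)"
  proof (rule wp_For[where N = n and I = "\<lambda>v. F (3 * v) 0"])
    fix v R1 M1 assume v: "v < n" and F1: "F (3 * v) 0 R1 M1"
    show "wp B (For 7 (Num 3) (For 6 (Var 0) (For 8 (Num 3) ?W)))
        (\<lambda>(R, M). F (3 * Suc v) 0 R M) (R1(5 := v), M1)"
    proof (rule wp_For[where N = 3 and I = "\<lambda>c R M. F (3 * v + c) 0 R M \<and> R 5 = v"])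
      fix c R2 M2 assume c: "c < 3" and F2: "F (3 * v + c) 0 R2 M2 \<and> R2 5 = v"
      show "wp B (For 6 (Var 0) (For 8 (Num 3) ?W))
          (\<lambda>(R, M). F (3 * v + Suc c) 0 R M \<and> R 5 = v) (R2(7 := c), M2)"
      proof (rule wp_For[where N = n and I = "\<lambda>u R M. F (3 * v + c) (3 * u) R M \<and> R 5 = v \<and> R 7 = c"])
        fix u R3 M3 assume u: "u < n" and F3: "F (3 * v + c) (3 * u) R3 M3 \<and> R3 5 = v \<and> R3 7 = c"
        show "wp B (For 8 (Num 3) ?W)
            (\<lambda>(R, M). F (3 * v + c) (3 * Suc u) R M \<and> R 5 = v \<and> R 7 = c) (R3(6 := u), M3)"
        proof (rule wp_For[where N = 3 and I = "\<lambda>d R M. F (3 * v + c) (3 * u + d) R M \<and>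
            R 5 = v \<and> R 7 = c \<and> R 6 = u"])
          fix d R4 M4 assume d: "d < 3" and F4: "F (3 * v + c) (3 * u + d) R4 M4 \<and>
            R4 5 = v \<and> R4 7 = c \<and> R4 6 = u"
          have h: "holds_state g M4"
            using holds_state_outside[OF M] F4 by (simp add: F_def)
          have n: "R4 0 = n" using F0 F4 by blast
          have val: "eval ?val (R4(8 := d), M4) = (if implies g v c u d then 1 else 0)"
            using F4 n holds_stateD(1)[OF h v] holds_stateD(1)[OF h u] holds_stateD(2)[OF h v u]
            by (simp add: eval_addrs implies_def)
          have addr: "eval (imp_addr (literal (Var 5) (Var 7)) (literal (Var 6) (Var 8)))
              (R4(8 := d), M4) = imp_base + ((3 * v + c) * (3 * n) + (3 * u + d))"
            using F4 n by (simp add: eval_addrs)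
          let ?M = "M4(imp_base + ((3 * v + c) * (3 * n) + (3 * u + d)) :=
              (if implies g v c u d then 1 else 0))"
          have ins: "cell ?M p q = (if (p, q) \<in> implications g then 1 else 0)"
            if "q < 3 * n" "p < 3 * v + c \<or> p = 3 * v + c \<and> q < 3 * u + Suc d" for p q
          proof (cases "p = 3 * v + c \<and> q = 3 * u + d")
            case True
            then show ?thesis
              using implications_literal[OF c d v u, of g] literal_less[OF u d]
              by (simp add: cell_update)
          next
            case False
            then have "p < 3 * v + c \<or> p = 3 * v + c \<and> q < 3 * u + d" using that(2) by auto
            moreover have "cell ?M p q = cell M4 p q"
              using False by (auto simp: cell_update[OF literal_less[OF u d] that(1)])
            moreover have "cell M4 p q = (if (p, q) \<in> implications g then 1 else 0)"
              using F4 that(1) calculation(1) unfolding F_def by blast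
            ultimately show ?thesis by (simp only:)
          qed
          have "same_outside M ?M"
            using F4 same_outside_update[OF _ literal_less[OF v c] literal_less[OF u d]]
            by (simp add: F_def)
          then have "F (3 * v + c) (3 * u + Suc d) (R4(8 := d)) ?M"
            using F4 ins unfolding F_def by auto
          then show "wp B ?W (\<lambda>(R, M). F (3 * v + c) (3 * u + Suc d) R M \<and>
            R 5 = v \<and> R 7 = c \<and> R 6 = u) (R4(8 := d), M4)"
            unfolding wp_Write val addr using F4 B by simp
        qed (use F3 B F_upd in \<open>auto simp: t3 simp del: mult_Suc_right\<close>)
      qed (use F2 F0 F_upd B in \<open>auto dest: F_row\<close>)
    qed (use F1 F_upd B in \<open>auto simp: t3 simp del: mult_Suc_right\<close>)
  next
    fix R' M' assume F: "F (3 * n) 0 R' M'"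
    then show "Q (R', M')" by (intro post) (auto simp: F_def stores_def)
  qed (use R B in \<open>auto simp: F_def same_outside_def\<close>)
  then show ?thesis by (simp add: imp_prog_def)
qed

text \<open>After round \<open>k\<close> the stored relation lies between \<open>E\<close> and its
  closure, and compositions through the literals up to \<open>k\<close> stay inside it. After all
  rounds it is transitive, hence equal to the closure.\<close>

lemma wp_closure:
  assumes R: "R 0 = n" and M: "stores E M" and E: "E \<subseteq> {..<3 * n} \<times> {..<3 * n}"
    and B: "3 * n \<le> B" "1 \<le> B"
    and post: "\<And>R' M'. (\<And>y. y \<notin> {5, 6, 7, 8} \<Longrightarrow> R' y = R y) \<Longrightarrow> same_outside M M' \<Longrightarrow>
      stores (E\<^sup>+) M' \<Longrightarrow> Q (R', M')"
  shows "wp B closure_prog Q (R, M)"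
proof -
  let ?N = "3 * n"
  define G where "G R' M' \<longleftrightarrow> (\<forall>y. y \<notin> {5, 6, 7, 8} \<longrightarrow> R' y = R y) \<and> same_outside M M'" for R' M'
  define T where "T k E' \<longleftrightarrow> E \<subseteq> E' \<and> E' \<subseteq> E\<^sup>+ \<and>
    (\<forall>m<k. \<forall>i j. (i, m) \<in> E' \<longrightarrow> (m, j) \<in> E' \<longrightarrow> (i, j) \<in> E')" for k :: nat and E'
  \<comment> \<open>The relation stored when round \<open>k\<close> has reached row \<open>i\<close>
    and column \<open>j\<close>: compositions through \<open>k\<close> are added at the earlier
    positions only.\<close>
  define step where "step k i j E' = E' \<union> {(i', j'). (i', k) \<in> E' \<and> (k, j') \<in> E' \<and>
    (i' < i \<or> i' = i \<and> j' < j)}" for k i j :: nat and E'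
  have dom: "p < ?N \<and> q < ?N" if "(p, q) \<in> E\<^sup>+" for p q
    using that trancl_subset_Sigma[OF E] by auto
  have T_step: "T (Suc k) (step k ?N 0 E')" if "T k E'" for k E'
  proof -
    have E': "step k ?N 0 E' = E' \<union> {(i, j). (i, k) \<in> E' \<and> (k, j) \<in> E'}"
      using that dom by (auto simp: step_def T_def)
    have "step k ?N 0 E' \<subseteq> E\<^sup>+" using that unfolding E' T_def by (auto intro: trancl_trans)
    moreover have "\<forall>m<Suc k. \<forall>i j. (i, m) \<in> step k ?N 0 E' \<longrightarrow> (m, j) \<in> step k ?N 0 E' \<longrightarrow>
        (i, j) \<in> step k ?N 0 E'"
      using that unfolding E' T_def less_Suc_eq by blast
    moreover have "E \<subseteq> step k ?N 0 E'" using that by (auto simp: step_def T_def)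
    ultimately show ?thesis by (simp add: T_def)
  qed
  let ?val = "Ite (Times (Mem (imp_addr (Var 6) (Var 5))) (Mem (imp_addr (Var 5) (Var 8))))
         (Num 1) (Mem (imp_addr (Var 6) (Var 8)))"
  let ?W = "Write (imp_addr (Var 6) (Var 8)) ?val"
  let ?n = "Times (Num 3) (Var 0)"
  have reg0: "G R' M' \<Longrightarrow> R' 0 = n" for R' M' using R by (simp add: G_def)
  have G_upd: "G R' M' \<Longrightarrow> y \<in> {5, 6, 7, 8} \<Longrightarrow> G (R'(y := i)) M'" for R' M' y i
    by (auto simp: G_def)
  have "wp B (For 5 ?n (For 6 ?n (For 8 ?n ?W))) Q (R, M)"
  proof (rule wp_For[where N = ?N and I = "\<lambda>k R M. G R M \<and> (\<exists>E'. T k E' \<and> stores E' M)"])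
    fix k R1 M1 assume k: "k < ?N" and I1: "G R1 M1 \<and> (\<exists>E'. T k E' \<and> stores E' M1)"
    then obtain E' where E': "T k E'" "stores E' M1" by blast
    have domE': "p < ?N \<and> q < ?N" if "(p, q) \<in> E'" for p q using that E'(1) dom by (auto simp: T_def)
    show "wp B (For 6 ?n (For 8 ?n ?W)) (\<lambda>(R, M). G R M \<and> (\<exists>E'. T (Suc k) E' \<and> stores E' M)) (R1(5 := k), M1)"
    proof (rule wp_For[where N = ?N and I = "\<lambda>i R M. G R M \<and> R 5 = k \<and> stores (step k i 0 E') M"])
      fix i R2 M2 assume i: "i < ?N" and I2: "G R2 M2 \<and> R2 5 = k \<and> stores (step k i 0 E') M2"
      show "wp B (For 8 ?n ?W) (\<lambda>(R, M). G R M \<and> R 5 = k \<and> stores (step k (Suc i) 0 E') M) (R2(6 := i), M2)"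
      proof (rule wp_For[where N = ?N and I = "\<lambda>j R M. G R M \<and> R 5 = k \<and> R 6 = i \<and> stores (step k i j E') M"])
        fix j R3 M3 assume j: "j < ?N"
          and I3: "G R3 M3 \<and> R3 5 = k \<and> R3 6 = i \<and> stores (step k i j E') M3"
        let ?E = "step k i j E'"
        have cells: "cell M3 p q = (if (p, q) \<in> ?E then 1 else 0)" if "p < ?N" "q < ?N" for p q
          using I3 that by (simp add: stores_def)
        \<comment> \<open>Updating in place is harmless: a pair ending or starting at
          \<open>k\<close> is a composition through \<open>k\<close> only if it was present before,
          so row \<open>k\<close> and column \<open>k\<close> do not change in this round.\<close>
        have ik: "(i, k) \<in> ?E \<longleftrightarrow> (i, k) \<in> E'" and kj: "(k, j) \<in> ?E \<longleftrightarrow> (k, j) \<in> E'"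
          by (auto simp: step_def)
        have ins: "step k i (Suc j) E' = (if (i, k) \<in> E' \<and> (k, j) \<in> E' then insert (i, j) ?E else ?E)"
          by (auto simp: step_def less_Suc_eq)
        have n: "R3 0 = n" using I3 reg0 by blast
        define x :: nat where "x = (if (i, j) \<in> step k i (Suc j) E' then 1 else 0)"
        have val: "eval ?val (R3(8 := j), M3) = x"
          using I3 n cells[OF i k] cells[OF k j] cells[OF i j] unfolding ik kj
          by (simp add: eval_addrs cell_def x_def ins)
        have addr: "eval (imp_addr (Var 6) (Var 8)) (R3(8 := j), M3) = imp_base + (i * (3 * n) + j)"
          using I3 n by (simp add: eval_addrs)
        have "stores (step k i (Suc j) E') (M3(imp_base + (i * (3 * n) + j) := x))"
          unfolding stores_def using cells by (auto simp: cell_update[OF j] x_def ins)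
        moreover have "G (R3(8 := j)) (M3(imp_base + (i * (3 * n) + j) := x))"
          using I3 same_outside_update[OF _ i j] by (auto simp: G_def)
        moreover have "x \<le> B" using B by (simp add: x_def)
        ultimately show "wp B ?W (\<lambda>(R, M). G R M \<and> R 5 = k \<and> R 6 = i \<and>
            stores (step k i (Suc j) E') M) (R3(8 := j), M3)"
          unfolding wp_Write val addr using I3 by simp
      next
        fix R3 M3 assume "G R3 M3 \<and> R3 5 = k \<and> R3 6 = i \<and> stores (step k i ?N E') M3"
        moreover have "step k i ?N E' = step k (Suc i) 0 E'"
          using domE' by (auto simp: step_def less_Suc_eq)
        ultimately show "case (R3, M3) of (R, M) \<Rightarrow> G R M \<and> R 5 = k \<and> stores (step k (Suc i) 0 E') M"
          by simp
      qed (use I2 B G_upd reg0 in auto)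
    next
      show "G (R1(5 := k)) M1 \<and> (R1(5 := k)) 5 = k \<and> stores (step k 0 0 E') M1"
        using I1 E' G_upd by (simp add: step_def)
    next
      fix R2 M2 assume "G R2 M2 \<and> R2 5 = k \<and> stores (step k ?N 0 E') M2"
      then show "case (R2, M2) of (R, M) \<Rightarrow> G R M \<and> (\<exists>E'. T (Suc k) E' \<and> stores E' M)"
        using T_step[OF E'(1)] by auto
    qed (use I1 B reg0 in auto)
  next
    show "G R M \<and> (\<exists>E'. T 0 E' \<and> stores E' M)"
      using M by (auto simp: G_def same_outside_def T_def)
  next
    fix R' M' assume "G R' M' \<and> (\<exists>E'. T ?N E' \<and> stores E' M')"
    then obtain E' where I: "G R' M'" "T ?N E'" "stores E' M'" by blast
    have "trans E'"
    proof (rule transI)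
      fix p q r assume "(p, q) \<in> E'" "(q, r) \<in> E'"
      moreover then have "q < ?N" using I(2) dom by (auto simp: T_def)
      ultimately show "(p, r) \<in> E'" using I(2) by (auto simp: T_def)
    qed
    then have "E\<^sup>+ \<subseteq> E'" using I(2) trancl_mono_subset[of E E'] by (simp add: T_def)
    then have "E' = E\<^sup>+" using I(2) by (auto simp: T_def)
    then show "Q (R', M')" using I by (intro post) (auto simp: G_def)
  qed (use R B in auto)
  then show ?thesis by (simp add: closure_prog_def)
qed

lemma wp_cycle:
  assumes R: "R 0 = n" and M: "stores E M" and B: "n + 3 \<le> B"
    and post: "\<And>R'. (\<And>y. y \<notin> {5, 6, 7, 8} \<Longrightarrow> R' y = R y) \<Longrightarrow>
      R' 7 = (if \<exists>v<n. \<exists>c<3. \<exists>d<3. c \<noteq> d \<and> (3 * v + c, 3 * v + d) \<in> E \<and> (3 * v + d, 3 * v + c) \<in> E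
        then 0 else 1) \<Longrightarrow> Q (R', M)"
  shows "wp B cycle_prog Q (R, M)"
proof -
  define bad where "bad v c d \<longleftrightarrow> c \<noteq> d \<and> (3 * v + c, 3 * v + d) \<in> E \<and> (3 * v + d, 3 * v + c) \<in> E" for v c d
  \<comment> \<open>The triples are scanned lexicographically. This says that a contradictory pair
    occurs before the position \<open>(v, c, d)\<close>.\<close>
  define found where "found v c d \<longleftrightarrow> (\<exists>v' c' d'. c' < 3 \<and> d' < 3 \<and> bad v' c' d' \<and>
    (v' < v \<or> v' = v \<and> (c' < c \<or> c' = c \<and> d' < d)))" for v c d :: nat
  define F where "F v c d R' M' \<longleftrightarrow> M' = M \<and> (\<forall>y. y \<notin> {5, 6, 7, 8} \<longrightarrow> R' y = R y) \<and>
    R' 7 = (if found v c d then 0 else 1)" for v c d and R' M' :: "nat \<Rightarrow> nat"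
  have F_upd: "F v c d R' M' \<Longrightarrow> y \<in> {5, 6, 8} \<Longrightarrow> F v c d (R'(y := i)) M'" for v c d R' M' y i
    by (auto simp: F_def)
  have F0: "F v c d R' M' \<Longrightarrow> R' 0 = n" for v c d R' M' using R by (simp add: F_def)
  have rows: "F v c 3 R' M' \<Longrightarrow> F v (Suc c) 0 R' M'" "F v 3 0 R' M' \<Longrightarrow> F (Suc v) 0 0 R' M'" for v c R' M'
  proof -
    have "found v c 3 = found v (Suc c) 0" "found v 3 0 = found (Suc v) 0 0"
      by (auto simp: found_def less_Suc_eq)
    then show "F v c 3 R' M' \<Longrightarrow> F v (Suc c) 0 R' M'" "F v 3 0 R' M' \<Longrightarrow> F (Suc v) 0 0 R' M'"
      by (auto simp: F_def)
  qed
  let ?e = "Times (Var 7) (complement (Times (complement (Eq (Var 6) (Var 8)))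
       (Times (Mem (imp_addr (literal (Var 5) (Var 6)) (literal (Var 5) (Var 8))))
         (Mem (imp_addr (literal (Var 5) (Var 8)) (literal (Var 5) (Var 6)))))))"
  have "wp B (For 5 (Var 0) (For 6 (Num 3) (For 8 (Num 3) (Assign 7 ?e)))) Q (R(7 := 1), M)"
  proof (rule wp_For[where N = n and I = "\<lambda>v. F v 0 0"])
    fix v R1 M1 assume v: "v < n" and I1: "F v 0 0 R1 M1"
    show "wp B (For 6 (Num 3) (For 8 (Num 3) (Assign 7 ?e))) (\<lambda>(R, M). F (Suc v) 0 0 R M) (R1(5 := v), M1)"
    proof (rule wp_For[where N = 3 and I = "\<lambda>c R M. F v c 0 R M \<and> R 5 = v"])
      fix c R2 M2 assume c: "c < 3" and I2: "F v c 0 R2 M2 \<and> R2 5 = v"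
      show "wp B (For 8 (Num 3) (Assign 7 ?e)) (\<lambda>(R, M). F v (Suc c) 0 R M \<and> R 5 = v) (R2(6 := c), M2)"
      proof (rule wp_For[where N = 3 and I = "\<lambda>d R M. F v c d R M \<and> R 5 = v \<and> R 6 = c"])
        fix d R3 M3 assume d: "d < 3" and I3: "F v c d R3 M3 \<and> R3 5 = v \<and> R3 6 = c"
        have n: "R3 0 = n" using F0 I3 by blast
        have M3: "M3 = M" using I3 by (simp add: F_def)
        have "cell M (3 * v + c) (3 * v + d) = (if (3 * v + c, 3 * v + d) \<in> E then 1 else 0)"
          "cell M (3 * v + d) (3 * v + c) = (if (3 * v + d, 3 * v + c) \<in> E then 1 else 0)"
          using M literal_less[OF v c] literal_less[OF v d] by (simp_all add: stores_def)
        then have e: "eval ?e (R3(8 := d), M3) = R3 7 * (if bad v c d then 0 else 1)"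
          using I3 n M3 by (simp add: eval_addrs bad_def cell_def)
        have "found v c (Suc d) \<longleftrightarrow> found v c d \<or> bad v c d"
          using c d by (auto simp: found_def less_Suc_eq)
        then have "eval ?e (R3(8 := d), M3) = (if found v c (Suc d) then 0 else 1)"
          unfolding e using I3 by (simp add: F_def)
        then show "wp B (Assign 7 ?e) (\<lambda>(R, M). F v c (Suc d) R M \<and> R 5 = v \<and> R 6 = c) (R3(8 := d), M3)"
          unfolding wp_Assign using I3 B by (simp add: F_def)
      qed (use I2 F_upd B rows in auto)
    qed (use I1 F_upd B rows in auto)
  next
    show "F 0 0 0 (R(7 := 1)) M" by (auto simp: F_def found_def)
  next
    fix R' M' assume I: "F n 0 0 R' M'"
    have "found n 0 0 \<longleftrightarrow> (\<exists>v<n. \<exists>c<3. \<exists>d<3. bad v c d)" by (auto simp: found_def)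
    then show "Q (R', M')" using I post[of R'] unfolding F_def bad_def by auto
  qed (use R B in auto)
  then show ?thesis using B by (simp add: cycle_prog_def wp_simps)
qed

lemma wp_leaf:
  assumes R: "R 0 = n" "R 1 \<le> 1" and M: "holds_state g M" and B: "3 * n + 3 \<le> B"
    and post: "\<And>R' M'. (\<And>y. y \<notin> {1, 5, 6, 7, 8} \<Longrightarrow> R' y = R y) \<Longrightarrow> same_outside M M' \<Longrightarrow>
      R' 1 = (if two_list_test g then 1 else R 1) \<Longrightarrow> Q (R', M')"
  shows "wp B leaf_prog Q (R, M)"
  unfolding leaf_prog_def wp_Sq
proof (rule wp_imp[where R = R, OF R(1) M], goal_cases)
  case (2 R1 M1)
  have sub: "implications g \<subseteq> {..<3 * n} \<times> {..<3 * n}" by (auto simp: implications_def)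
  show ?case
  proof (rule wp_closure[where R = R1, OF _ 2(3) sub], goal_cases)
    case (4 R2 M2)
    show ?case
    proof (rule wp_cycle[where R = R2, OF _ 4(3)], goal_cases)
      case (3 R3)
      have "R3 7 = (if \<not> two_list_test g then 0 else 1)"
        using 3(2) unfolding two_list_test_def not_not .
      then have val: "eval (Ite (Var 7) (Num 1) (Var 1)) (R3, M2) = (if two_list_test g then 1 else R 1)"
        using 3(1) 4(1) 2(1) by simp
      have "same_outside M M2" using 2(2) 4(2) by (simp add: same_outside_def)
      then have "Q (R3(1 := if two_list_test g then 1 else R 1), M2)"
        by (intro post) (use 3(1) 4(1) 2(1) in auto)
      then show ?case unfolding wp_Assign val using R(2) B by simp
    qed (use R 2 4 B in auto)
  qed (use R 2 B in auto)
qed (use B in auto)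

lemma children_eq_Nil_iff:
  "select g = (b, v) \<Longrightarrow> valid g \<Longrightarrow> children g = [] \<longleftrightarrow> b = 0 \<and> unset g = {}"
proof -
  assume s: "select g = (b, v)" and g: "valid g"
  have "unset g = {} \<Longrightarrow> b = 0"
    using select_upto_spec[OF s] score_pos[of g v] by (cases b) (auto simp: udeg_def)
  then show ?thesis using children_Nil_iff[OF g] by blast
qed

text \<open>\<open>3 * n + 8\<close> covers loop bounds, table entries and counters, and
  \<open>p + 8\<close> the height after pushing up to eight children. A linear bound suffices, since
  addresses are never stored.\<close>

lemma wp_node:
  assumes R: "R 0 = n" "R 2 = Suc p" "R 1 \<le> 1" and M: "adj_ok M" "valid (block M p)"
    and B: "3 * n + 8 \<le> B" "p + 8 \<le> B"
    and post: "\<And>R' M'. R' 0 = n \<Longrightarrow> R' 2 = p + length (children (block M p)) \<Longrightarrow>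
      R' 1 = (if children (block M p) = [] \<and> two_list_test (block M p) then 1 else R 1) \<Longrightarrow>
      adj_ok M' \<Longrightarrow> (\<And>q. q < p \<Longrightarrow> block M' q = block M q) \<Longrightarrow>
      (\<And>j. j < length (children (block M p)) \<Longrightarrow> block M' (p + j) = children (block M p) ! j) \<Longrightarrow>
      Q (R', M')"
  shows "wp B node_prog Q (R, M)"
  unfolding node_prog_def wp_Sq
proof (rule wp_pop[where R = R, OF R(1,2) M], goal_cases)
  case (3 R1 M1)
  define g where "g = block M p"
  have g: "valid g" using M(2) by (simp add: g_def)
  have h1: "holds_state g M1" using 3(4) by (simp add: g_def)
  have blocks1: "block M1 q = block M q" for q
    unfolding block_def by (rule map_cong[OF refl]) (simp add: 3(3))
  show ?case
  proof (rule wp_select[where R = R1, OF _ h1], goal_cases)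
    case sel: (3 R2)
    have regs: "R2 0 = n" "R2 1 = R 1" "R2 2 = p" using sel(1) 3 R by auto
    show ?case
    proof (cases "0 < R2 3")
      case True
      have v: "R2 4 < n" using select_upto_spec[OF sel(2)] True by auto
      have ch: "children g = map (star_child g (R2 4)) (star_colours g)"
        using sel(2) True by (simp add: children_def)
      have "wp B star_prog Q (R2, M1)"
      proof (rule wp_star[where R = R2, OF regs(1,3) sel(2) v h1 g], goal_cases)
        case (3 R3 M3)
        have ne: "children g \<noteq> []" using children_eq_Nil_iff[OF sel(2) g] True by simp
        have "holds_state g M3" by (rule holds_state_cong[OF h1]) (rule 3(3)[OF base_less(1)])
        then have ad: "adj_ok M3" by (simp add: holds_state_def)
        show ?case
          by (rule post; (fold g_def)?) (use 3 ad regs ch blocks1 ne in auto)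
      qed (use B in auto)
      then show ?thesis using True by (simp add: wp_Ifnz)
    next
      case b0: False
      have "wp B (Sq count_prog (Ifnz (Var 7) cover_prog leaf_prog)) Q (R2, M1)"
        unfolding wp_Sq
      proof (rule wp_count[where R = R2, OF regs(1) h1], goal_cases)
        case c: (2 R3)
        have regs3: "R3 0 = n" "R3 1 = R 1" "R3 2 = p" using c(1) regs by auto
        show ?case
        proof (cases "unset g = {}")
          case True
          then have nil: "children g = []" using children_eq_Nil_iff[OF sel(2) g] b0 by simp
          have "wp B leaf_prog Q (R3, M1)"
          proof (rule wp_leaf[where R = R3, OF regs3(1) _ h1], goal_cases)
            case (3 R4 M4)
            have "adj_ok M4" using holds_state_outside[OF h1 3(2)] by (simp add: holds_state_def)
            moreover have "block M4 q = block M1 q" for q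
              unfolding block_def using 3(2) by (intro map_cong) (auto simp: same_outside_def)
            ultimately show ?case
              by (intro post; (fold g_def)?) (use 3 regs3 nil blocks1 in auto)
          qed (use R regs3 B in auto)
          then show ?thesis using c True by (simp add: wp_Ifnz)
        next
          case False
          have ch: "children g = map (cover_child g) [0..<8]"
            using sel(2) False b0 by (simp add: children_def)
          have "wp B cover_prog Q (R3, M1)"
          proof (rule wp_cover[where R = R3, OF regs3(1,3) h1 g], goal_cases)
            case (3 R4 M4)
            have "holds_state g M4" by (rule holds_state_cong[OF h1]) (rule 3(3)[OF base_less(1)])
            then have ad: "adj_ok M4" by (simp add: holds_state_def)
            show ?case
              by (rule post; (fold g_def)?) (use 3 ad regs3 ch blocks1 in auto)
          qed (use B in auto)
          then show ?thesis using c False by (simp add: wp_Ifnz)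
        qed
      qed (use B in auto)
      then show ?thesis using b0 by (simp add: wp_Ifnz)
    qed
  qed (use 3 R B in auto)
qed (use B in auto)

end

section \<open>Running time\<close>

context coloring
begin

definition stack :: "(nat \<Rightarrow> nat) \<Rightarrow> nat \<Rightarrow> nat list list" where
  "stack M m = map (block M) [0..<m]"

lemma length_children: "length (children g) \<le> 8"
  using length_star_colours[of g] by (auto simp: children_def split: prod.splits)

lemma feasible_node:
  assumes "valid g"
  shows "feasible g \<longleftrightarrow> children g = [] \<and> two_list_test g \<or> (\<exists>h\<in>set (children g). feasible h)"
proof (cases "children g = []")
  case True
  then have "unset g = {}" using children_Nil_iff[OF assms] by simp
  then have "g ! i < 3" if "i < n" for i
    using that assms unfolding valid_def unset_def by (metis (mono_tags) empty_Collect_eq le_neq_implies_less)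
  then show ?thesis using True feasible_iff_two_list_test[of g] by simp
qed (use feasible_children in auto)

text \<open>The second condition bounds the height of the stack during the depth-first search.\<close>

definition stack_ok :: "nat list list \<Rightarrow> bool" where
  "stack_ok gs \<longleftrightarrow> (\<forall>g\<in>set gs. valid g) \<and>
     (\<forall>q<length gs. q + 7 * card (unset (gs ! q)) \<le> 7 * n)"

text \<open>The top entry gives way to at most eight children, so positions rise by at most 7, while
  each child has an unset vertex less. The 7 units freed by that vertex pay for the rise.\<close>

lemma stack_ok_expand:
  assumes "stack_ok (gs @ [g])"
  shows "stack_ok (gs @ children g)"
proof -
  have g: "valid g" "length gs + 7 * card (unset g) \<le> 7 * n"
    using assms by (auto simp: stack_ok_def nth_append dest: spec[of _ "length gs"])
  have old: "q + 7 * card (unset (gs ! q)) \<le> 7 * n" if "q < length gs" for q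
    using assms that by (auto simp: stack_ok_def nth_append dest: spec[of _ q])
  have new: "length gs + j + 7 * card (unset (children g ! j)) \<le> 7 * n"
    if j: "j < length (children g)" for j
  proof -
    have "card (unset (children g ! j)) < card (unset g)" using children_unset nth_mem[OF j] by blast
    moreover have "j \<le> 7" using j length_children[of g] by linarith
    ultimately show ?thesis using g(2) by linarith
  qed
  have "q + 7 * card (unset ((gs @ children g) ! q)) \<le> 7 * n"
    if "q < length (gs @ children g)" for q
  proof (cases "q < length gs")
    case False
    then show ?thesis using new[of "q - length gs"] that by (simp add: nth_append)
  qed (use old in \<open>simp add: nth_append\<close>)
  moreover have "\<forall>h\<in>set (gs @ children g). valid h"
    using assms children_valid[OF g(1)] by (auto simp: stack_ok_def)
  ultimately show ?thesis by (simp add: stack_ok_def)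
qed

text \<open>Induction on the total size of the subtrees waiting on the stack. A round replaces a
  state by its children and so lowers this number by exactly one. The invariant for the answer is
  that it has been found already or some waiting state is feasible. A popped state sits at a
  position of at most \<open>7 * n\<close>, which explains \<open>B\<close>.\<close>

lemma exec_search:
  assumes B: "B = 7 * n + 8"
    and "R 0 = n" "R 1 \<le> 1" "R 2 = m" "\<And>x. x < 12 \<Longrightarrow> R x \<le> B" "\<And>x. M x \<le> B"
    and "adj_ok M" "stack_ok (stack M m)" "sum_list (map nodes (stack M m)) = k"
    and "R 1 = 1 \<or> (\<exists>g\<in>set (stack M m). feasible g) \<longleftrightarrow> C"
  shows "\<exists>t R' M'. exec (While (Less (Const 0) (Reg 2)) (compile 12 node_prog)) (R, M) t (R', M') \<and>
    R' 1 = (if C then 1 else 0) \<and> t \<le> 1 + B + k * (cost node_prog B + (1 + B))"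
  using assms(2-)
proof (induction k arbitrary: R M m rule: less_induct)
  case (less k)
  let ?w = "Less (Const 0) (Reg 2)"
  have tc: "test_cost ?w R \<le> 1 + B" using len_le[of "R 2"] less.prems(4)[of 2] by (simp add: len_0_1)
  show ?case
  proof (cases m)
    case 0
    then have "exec (While ?w (compile 12 node_prog)) (R, M) (test_cost ?w (fst (R, M))) (R, M)"
      using less.prems by (intro WhileFalse) simp
    then show ?thesis
    proof (rule exec_witness3)
      show "R 1 = (if C then 1 else 0) \<and>
          test_cost ?w (fst (R, M)) \<le> 1 + B + k * (cost node_prog B + (1 + B))"
        using tc less.prems(2,9) 0 by (auto simp: stack_def)
    qed
  next
    case (Suc p)
    define g where "g = block M p"
    define gs where "gs = stack M p"
    have st: "stack M m = gs @ [g]" by (simp add: Suc stack_def g_def gs_def)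
    have ok: "stack_ok (gs @ [g])" using less.prems(7) st by simp
    have lgs: "length gs = p" by (simp add: gs_def stack_def)
    have g: "valid g" "p + 7 * card (unset g) \<le> 7 * n"
      using ok lgs by (auto simp: stack_ok_def nth_append dest: spec[of _ p])
    define J where "J R' M' \<longleftrightarrow> R' 0 = n \<and> R' 2 = p + length (children g) \<and>
      R' 1 = (if children g = [] \<and> two_list_test g then 1 else R 1) \<and> adj_ok M' \<and>
      stack M' (p + length (children g)) = gs @ children g" for R' M' :: "nat \<Rightarrow> nat"
    have "wp B node_prog (\<lambda>(R', M'). J R' M') (R, M)"
    proof (rule wp_node[where R = R and M = M and p = p])
      show "p + 8 \<le> B" using g(2) B by linarith
    next
      fix R' M'
      assume *: "\<And>q. q < p \<Longrightarrow> block M' q = block M q"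
        "\<And>j. j < length (children (block M p)) \<Longrightarrow> block M' (p + j) = children (block M p) ! j"
      have "stack M' (p + length (children g)) = gs @ children g"
      proof (rule nth_equalityI)
        fix i assume "i < length (stack M' (p + length (children g)))"
        then have i: "i < p + length (children g)" by (simp add: stack_def)
        show "stack M' (p + length (children g)) ! i = (gs @ children g) ! i"
        proof (cases "i < p")
          case False
          then show ?thesis using *(2)[of "i - p"] i
            by (simp add: stack_def gs_def g_def nth_append)
        qed (use * i in \<open>simp add: stack_def gs_def nth_append\<close>)
      qed (simp add: stack_def gs_def)
      then show "R' 0 = n \<Longrightarrow> R' 2 = p + length (children (block M p)) \<Longrightarrow>
        R' 1 = (if children (block M p) = [] \<and> two_list_test (block M p) then 1 else R 1) \<Longrightarrow>
        adj_ok M' \<Longrightarrow> case (R', M') of (R', M') \<Rightarrow> J R' M'"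
        by (simp add: J_def g_def)
    qed (use less.prems Suc g B in \<open>auto simp: g_def\<close>)
    then have safe: "safe B node_prog (R, M)" and J: "J (fst (run node_prog (R, M))) (snd (run node_prog (R, M)))"
      by (auto simp: wp_def split: prod.splits)
    obtain t R1 M1 where 1: "exec (compile 12 node_prog) (R, M) t (R1, M1)" "M1 = snd (run node_prog (R, M))"
      "\<forall>x<12. R1 x = fst (run node_prog (R, M)) x" "\<forall>x<12. R1 x \<le> B" "\<forall>x. M1 x \<le> B"
      "t \<le> cost node_prog B"
      using exec_compile[OF vars_node_prog order_refl _ safe, of R] less.prems(4,5) by blast
    have J1: "J R1 M1" using J 1(2,3) by (simp add: J_def)
    define k' where "k' = sum_list (map nodes (gs @ children g))"
    have k: "k = Suc k'" using less.prems(8) st by (simp add: k'_def nodes.simps[of g])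
    have st1: "stack M1 (p + length (children g)) = gs @ children g" using J1 by (simp add: J_def)
    have C: "R1 1 = 1 \<or> (\<exists>g\<in>set (gs @ children g). feasible g) \<longleftrightarrow> C"
      using less.prems(9) J1 feasible_node[OF g(1)] unfolding st by (auto simp: J_def)
    have "\<exists>t R' M'. exec (While ?w (compile 12 node_prog)) (R1, M1) t (R', M') \<and>
      R' 1 = (if C then 1 else 0) \<and> t \<le> 1 + B + k' * (cost node_prog B + (1 + B))"
      by (rule less.IH[where m = "p + length (children g)"])
        (use k J1 1 less.prems(2) stack_ok_expand[OF ok] C st1 in \<open>auto simp: J_def k'_def\<close>)
    then obtain u R2 M2 where 2: "exec (While ?w (compile 12 node_prog)) (R1, M1) u (R2, M2)"
      "R2 1 = (if C then 1 else 0)" "u \<le> 1 + B + k' * (cost node_prog B + (1 + B))"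
      by blast
    have "exec (While ?w (compile 12 node_prog)) (R, M) (test_cost ?w (fst (R, M)) + t + u) (R2, M2)"
      using less.prems Suc by (intro WhileTrue[OF _ 1(1) 2(1)]) simp
    then show ?thesis
    proof (rule exec_witness3)
      show "R2 1 = (if C then 1 else 0) \<and>
          test_cost ?w (fst (R, M)) + t + u \<le> 1 + B + k * (cost node_prog B + (1 + B))"
        using 2(2,3) 1(6) tc unfolding k by simp
    qed
  qed
qed

lemma feasible_start: "feasible (replicate n 3) \<longleftrightarrow> (\<exists>f. proper f)"
proof
  assume "\<exists>f. proper f"
  then obtain f where f: "proper f" by blast
  then have "f i \<noteq> replicate n 3 ! i" if "i < n" for i using that by (auto simp: proper_def)
  then show "feasible (replicate n 3)" using f by (auto simp: feasible_def)
qed (auto simp: feasible_def)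

lemma exec_main:
  assumes R: "R = (\<lambda>x. 0)(0 := n)" and M: "adj_ok M" "\<And>x. M x \<le> 1"
    and B: "B = 7 * n + 8" and k: "k = nodes (replicate n 3)"
  shows "\<exists>t R' M'. exec main_prog (R, M) t (R', M') \<and> R' 0 = (if \<exists>f. proper f then 1 else 0) \<and>
    t \<le> 2 * k * (cost init_prog B + cost node_prog B + B + 4)"
proof -
  define J where "J R' M' \<longleftrightarrow> R' 0 = n \<and> R' 1 = 0 \<and> R' 2 = 1 \<and> adj_ok M' \<and>
      stack M' 1 = [replicate n 3]" for R' M' :: "nat \<Rightarrow> nat"
  have "wp B init_prog (\<lambda>(R', M'). J R' M') (R, M)"
    unfolding init_prog_def wp_Sq
  proof (rule wp_fill[where R = R and n = n and A = stack_base and f = "\<lambda>_. 3"], goal_cases)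
    case (3 j R' M')
    then have "R' 0 = n" using R by simp
    then show ?case using 3 B by (simp add: eval_addrs)
  next
    case (4 R' M')
    have "adj_ok M'"
      by (rule adj_ok_cong[OF M(1)]) (use 4(2) in \<open>auto simp: cur_base_def stack_base_def\<close>)
    moreover have "block M' 0 = replicate n 3" by (rule block_eqI) (use 4(3) in auto)
    ultimately show ?case using 4(1) R B by (simp add: wp_Assign J_def stack_def)
  qed (use R B in auto)
  then have safe: "safe B init_prog (R, M)" and J: "J (fst (run init_prog (R, M))) (snd (run init_prog (R, M)))"
    by (auto simp: wp_def split: prod.splits)
  have "\<And>x. x < 12 \<Longrightarrow> R x \<le> B" using R B by simp
  moreover have "\<And>x. M x \<le> B" using M(2) B by (metis le_trans le_add2 one_le_numeral)
  ultimately obtain t R1 M1 where 1: "exec (compile 12 init_prog) (R, M) t (R1, M1)"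
    "M1 = snd (run init_prog (R, M))" "\<forall>x<12. R1 x = fst (run init_prog (R, M)) x"
    "\<forall>x<12. R1 x \<le> B" "\<forall>x. M1 x \<le> B" "t \<le> cost init_prog B"
    using exec_compile[OF vars_init_prog order_refl _ safe, of R] by blast
  have J1: "J R1 M1" using J 1(2,3) by (simp add: J_def)
  have "card (unset (replicate n 3)) \<le> card {..<n}" by (intro card_mono) (auto simp: unset_def)
  then have ok: "stack_ok [replicate n 3]" by (simp add: stack_ok_def valid_def)
  have "\<exists>t R' M'. exec (While (Less (Const 0) (Reg 2)) (compile 12 node_prog)) (R1, M1) t (R', M') \<and>
    R' 1 = (if \<exists>f. proper f then 1 else 0) \<and> t \<le> 1 + B + k * (cost node_prog B + (1 + B))"
    by (rule exec_search[OF B, where m = 1]) (use J1 1 ok k feasible_start in \<open>auto simp: J_def\<close>)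
  then obtain u R2 M2 where 2: "exec (While (Less (Const 0) (Reg 2)) (compile 12 node_prog)) (R1, M1) u (R2, M2)"
    "R2 1 = (if \<exists>f. proper f then 1 else 0)" "u \<le> 1 + B + k * (cost node_prog B + (1 + B))" by blast
  have mv: "exec (Move 0 (Reg 1)) (R2, M2) (1 + len (R2 1)) (R2(0 := R2 1), M2)"
    using Move[of 0 "Reg 1" R2 M2] by simp
  have ex: "exec main_prog (R, M) (t + (u + (1 + len (R2 1)))) (R2(0 := R2 1), M2)"
    unfolding main_prog_def by (rule Seq[OF 1(1) Seq[OF 2(1) mv]])
  have "t + (u + (1 + len (R2 1))) \<le> 2 * k * (cost init_prog B + cost node_prog B + B + 4)"
  proof -
    have "len (R2 1) \<le> 1" using 2(2) by (simp add: len_0_1)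
    then have "t + (u + (1 + len (R2 1))) \<le>
        (cost init_prog B + B + 3) + k * (cost node_prog B + (1 + B))" using 1(6) 2(3) by linarith
    \<comment> \<open>The tree has a root, so the fixed costs can be charged to the nodes.\<close>
    also have "1 \<le> k" using k by (simp add: nodes.simps)
    then have "cost init_prog B + B + 3 \<le> k * (cost init_prog B + B + 3)" by simp
    then have "(cost init_prog B + B + 3) + k * (cost node_prog B + (1 + B)) \<le>
        k * (cost init_prog B + B + 3) + k * (cost node_prog B + (1 + B))" by simp
    also have "\<dots> = k * (cost init_prog B + cost node_prog B + 2 * B + 4)"
      by (simp add: algebra_simps)
    also have "\<dots> \<le> k * (2 * (cost init_prog B + cost node_prog B + B + 4))"
      by (intro mult_le_mono2) simp
    finally show ?thesis by (simp only: mult.assoc mult.left_commute[of k 2])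
  qed
  then show ?thesis using 2(2) by (intro exec_witness3[OF ex] conjI) simp_all
qed

end

text \<open>With \<open>q\<close> the root of \<open>s\<close> of order \<open>e + 1\<close>, the
  product is a power of \<open>(n + 1) * q ^ n\<close>, which is bounded because
  \<open>n * q ^ n\<close> tends to 0.\<close>

lemma poly_times_geometric_bounded:
  fixes s :: real
  assumes s: "0 < s" "s < 1"
  shows "\<exists>c. \<forall>n. (real n + 1) ^ Suc e * s ^ n \<le> c"
proof -
  define q where "q = s powr (1 / real (Suc e))"
  have q: "0 < q" "q < 1"
    using s powr_less_mono2[of "1 / real (Suc e)" s 1] by (simp_all add: q_def)
  have qs: "q ^ Suc e = s"
    unfolding q_def using s(1) by (subst powr_realpow[symmetric]) (simp_all add: powr_powr del: power_Suc)
  have "(\<lambda>n. of_nat n * q ^ n) \<longlonglongrightarrow> 0" using q by (intro powser_times_n_limit_0) simp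
  then have "Bseq (\<lambda>n. of_nat n * q ^ n)" by (intro convergent_imp_Bseq convergentI)
  then obtain K where K: "\<And>n. norm (of_nat n * q ^ n) \<le> K" by (auto simp: Bseq_def)
  have "(real n + 1) ^ Suc e * s ^ n \<le> (K + 1) ^ Suc e" for n
  proof -
    have "(real n + 1) * q ^ n \<le> K + 1"
      using K[of n] power_le_one[of q n] q by (simp add: distrib_right)
    moreover have "0 \<le> (real n + 1) * q ^ n" using q by simp
    ultimately have "((real n + 1) * q ^ n) ^ Suc e \<le> (K + 1) ^ Suc e" by (intro power_mono)
    moreover have "(q ^ n) ^ Suc e = s ^ n" by (simp only: power_commutes power_mult[symmetric] mult.commute[of n] power_mult qs)
    ultimately show ?thesis by (simp only: power_mult_distrib)
  qed
  then show ?thesis by blast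
qed

text \<open>Put \<open>x = n - 0.73 * D\<close>. The left exponential is at most
  \<open>(r * 1.32) powr x\<close> with \<open>r < 1\<close>, and \<open>x \<ge> 0.27 * n\<close>
  turns \<open>r powr x\<close> into a geometric decay in \<open>n\<close>, which outweighs the
  polynomial.\<close>

lemma absorb_polynomial:
  fixes K :: real
  assumes "0 \<le> K"
  shows "\<exists>c. \<forall>n D. D \<le> n \<longrightarrow> K * (real n + 1) ^ Suc e * 2 powr (0.4 * real n - 0.3 * real D) \<le>
    c * 1.32 powr (real n - 0.73 * real D)"
proof -
  define r :: real where "r = 2 powr 0.4 / 1.32"
  have "(2::real) powr 0.4 < 1.32"
  proof -
    have "(4::real) = 2 powr 2" by simp
    then have "(2::real) powr 0.4 = 4 powr 0.2" by (simp only: powr_powr) simp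
    \<comment> \<open>The decisive numerical fact is \<open>4 < 1.32 ^ 5\<close>, where the right
      side is about 4.007.\<close>
    also have "\<dots> < (1.32 ^ 5) powr 0.2" by (intro powr_less_mono2) (simp_all add: power_divide)
    also have "(1.32 ^ 5 :: real) = 1.32 powr 5" by (simp add: powr_numeral)
    also have "(1.32 powr 5) powr 0.2 = (1.32::real)" by (simp only: powr_powr) simp
    finally show ?thesis .
  qed
  then have r: "0 < r" "r < 1" by (simp_all add: r_def)
  define s where "s = r powr 0.27"
  have s: "0 < s" "s < 1" using r powr_less_mono2[of "0.27" r 1] by (simp_all add: s_def)
  obtain c where c: "\<And>n. (real n + 1) ^ Suc e * s ^ n \<le> c"
    using poly_times_geometric_bounded[OF s, of e] by blast
  have "K * (real n + 1) ^ Suc e * 2 powr (0.4 * real n - 0.3 * real D) \<le>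
    (K * c) * 1.32 powr (real n - 0.73 * real D)" if D: "D \<le> n" for n D
  proof -
    define x where "x = real n - 0.73 * real D"
    have x: "0.27 * real n \<le> x" using D by (simp add: x_def)
    \<comment> \<open>The search yields the coefficient \<open>0.3 / 0.4 = 0.75\<close> of
      \<open>D\<close>; passing to 0.73 keeps one and the same \<open>x\<close> for both
      bases.\<close>
    have "2 powr (0.4 * real n - 0.3 * real D) \<le> 2 powr (0.4 * x)"
      by (intro powr_mono) (simp_all add: x_def)
    also have "\<dots> = (2 powr 0.4) powr x" by (simp add: powr_powr)
    also have "\<dots> = (r * 1.32) powr x" by (simp add: r_def)
    also have "\<dots> = r powr x * 1.32 powr x" by (rule powr_mult)
    also have "\<dots> \<le> r powr (0.27 * real n) * 1.32 powr x"
      using r x by (intro mult_right_mono powr_mono') auto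
    also have "r powr (0.27 * real n) = s ^ n"
      using s by (simp add: s_def powr_powr powr_realpow[symmetric])
    finally have "2 powr (0.4 * real n - 0.3 * real D) \<le> s ^ n * 1.32 powr x" .
    then have "K * (real n + 1) ^ Suc e * 2 powr (0.4 * real n - 0.3 * real D) \<le>
        K * (real n + 1) ^ Suc e * (s ^ n * 1.32 powr x)"
      using assms by (intro mult_left_mono) auto
    also have "\<dots> = K * ((real n + 1) ^ Suc e * s ^ n) * 1.32 powr x" by (simp only: mult_ac)
    also have "\<dots> \<le> K * c * 1.32 powr x"
      using assms c[of n] by (intro mult_right_mono mult_left_mono) auto
    finally show ?thesis by (simp only: x_def)
  qed
  then show ?thesis by blast
qed

text \<open>The map from \<open>j\<close> to \<open>{v, j}\<close> is a bijection from the
  neighbours of \<open>v\<close> to its edges, as edges have exactly two elements.\<close>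

lemma degree_eq_card_neighbours:
  assumes "simple_graph {..<n} E" "v < n"
  shows "degree E v = card {j. j < n \<and> {v, j} \<in> E}"
proof -
  have E: "e \<subseteq> {..<n}" "card e = 2" if "e \<in> E" for e
    using assms(1) that by (auto simp: simple_graph_def)
  have inj: "inj_on (\<lambda>j. {v, j}) {j. j < n \<and> {v, j} \<in> E}" by (auto simp: inj_on_def doubleton_eq_iff)
  have image: "(\<lambda>j. {v, j}) ` {j. j < n \<and> {v, j} \<in> E} = {e \<in> E. v \<in> e}"
  proof (intro equalityI subsetI)
    fix e assume e: "e \<in> {e \<in> E. v \<in> e}"
    then obtain x y where "e = {x, y}" using E(2)[of e] by (auto simp: card_2_iff)
    then obtain j where "e = {v, j}" using e by auto
    moreover have "j < n" using E(1)[of e] e \<open>e = {v, j}\<close> by auto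
    ultimately show "e \<in> (\<lambda>j. {v, j}) ` {j. j < n \<and> {v, j} \<in> E}" using e by auto
  qed auto
  show ?thesis using card_image[OF inj] unfolding degree_def image .
qed

section \<open>The time bound for input graphs\<close>

theorem theorem2:
  "\<exists>(p :: com) (c :: real). \<forall>(n :: nat) (E :: nat set set).
     simple_graph {..<n} E \<and> min_degree {..<n} E \<ge> 7 \<longrightarrow>
       decides_in_time p (input n E) (three_colorable {..<n} E)
         (c * 1.32 powr (real n - 0.73 * real (max_degree {..<n} E)))"
proof -
  define f where "f B = cost init_prog B + cost node_prog B + B + 4" for B
  have "poly_bounded f"
    unfolding f_def by (intro poly_bounded_intros poly_bounded_cost)
  then obtain C d where Cd: "\<And>B. f B \<le> C * (B + 1) ^ d" unfolding poly_bounded_def by blast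
  \<comment> \<open>The factor 50 is 2 from the cost per node times 25 from the number of nodes, and
    9 comes from \<open>7 * n + 8 + 1 \<le> 9 * (n + 1)\<close>.\<close>
  define K where "K = 50 * real C * 9 ^ d"
  obtain c where c: "\<And>n D. D \<le> n \<Longrightarrow>
      K * (real n + 1) ^ Suc d * 2 powr (0.4 * real n - 0.3 * real D) \<le>
      c * 1.32 powr (real n - 0.73 * real D)"
    using absorb_polynomial[of K d] by (auto simp: K_def)
  show ?thesis
  proof (intro exI[of _ main_prog] exI[of _ c] allI impI)
    fix n :: nat and E :: "nat set set" assume "simple_graph {..<n} E \<and> min_degree {..<n} E \<ge> 7"
    then have G: "simple_graph {..<n} E" and min: "min_degree {..<n} E \<ge> 7" by auto
    have E: "e \<subseteq> {..<n}" "card e = 2" if "e \<in> E" for e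
      using G that by (auto simp: simple_graph_def)
    have n: "n \<noteq> 0" using G by (auto simp: simple_graph_def)
    interpret coloring n "\<lambda>i j. {i, j} \<in> E"
    proof
      show "{j, i} \<in> E" if "{i, j} \<in> E" for i j using that by (simp add: insert_commute)
      show "{i, i} \<notin> E" for i using E(2)[of "{i, i}"] by auto
    qed
    define D where "D = max_degree {..<n} E"
    have deg: "7 \<le> card {j. j < n \<and> {v, j} \<in> E}" if "v < n" for v
    proof -
      have "min_degree {..<n} E \<le> degree E v"
        unfolding min_degree_def using that by (intro Min_le) auto
      then show ?thesis using min degree_eq_card_neighbours[OF G that] by simp
    qed
    have "D \<in> degree E ` {..<n}"
      unfolding D_def max_degree_def using n by (intro Max_in) auto
    then obtain u where u: "u < n" "D = card {j. j < n \<and> {u, j} \<in> E}"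
      using degree_eq_card_neighbours[OF G] by auto
    have "D \<le> n" unfolding u(2) by (rule card_upto_le)
    have col: "three_colorable {..<n} E \<longleftrightarrow> (\<exists>f. proper f)"
    proof
      assume "three_colorable {..<n} E"
      then obtain f where f: "f ` {..<n} \<subseteq> {0, 1, 2 :: nat}" "\<And>u v. {u, v} \<in> E \<Longrightarrow> f u \<noteq> f v"
        by (auto simp: three_colorable_def)
      have "f i < 3" if "i < n" for i
      proof -
        have "f i \<in> {0, 1, 2}" using f(1) that by blast
        then show ?thesis by auto
      qed
      then show "\<exists>f. proper f" using f(2) by (auto simp: proper_def)
    next
      assume "\<exists>f. proper f"
      then obtain f where f: "proper f" by blast
      have "f i \<in> {0, 1, 2}" if "i < n" for i
      proof -
        have "f i < 3" using f that by (simp add: proper_def)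
        then show ?thesis by auto
      qed
      moreover have "f u \<noteq> f v" if "{u, v} \<in> E" for u v
        using E(1)[OF that] f that by (auto simp: proper_def)
      ultimately show "three_colorable {..<n} E"
        unfolding three_colorable_def by (intro exI[of _ f] conjI image_subsetI allI impI) simp_all
    qed
    define R where "R = ((\<lambda>x. 0)(0 := n) :: nat \<Rightarrow> nat)"
    define M where "M = snd (input n E)"
    have inp: "input n E = (R, M)" by (simp add: R_def M_def input_def)
    have "adj_ok M" unfolding adj_ok_def M_def using input_matrix by blast
    moreover have "M x \<le> 1" for x by (simp add: M_def input_def)
    ultimately obtain t R' M' where run: "exec main_prog (R, M) t (R', M')"
      "R' 0 = (if \<exists>f. proper f then 1 else 0)"
      "t \<le> 2 * nodes (replicate n 3) * f (7 * n + 8)"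
      using exec_main[OF R_def _ _ refl refl, of M] unfolding f_def by blast
    have "f (7 * n + 8) \<le> C * (9 * (n + 1)) ^ d"
    proof -
      have "C * (7 * n + 8 + 1) ^ d \<le> C * (9 * (n + 1)) ^ d"
        by (intro mult_le_mono2 power_mono) auto
      then show ?thesis using Cd[of "7 * n + 8"] by linarith
    qed
    then have "real (f (7 * n + 8)) \<le> real (C * (9 * (n + 1)) ^ d)" by (simp only: of_nat_le_iff)
    also have "\<dots> = real C * 9 ^ d * (real n + 1) ^ d"
      by (simp only: of_nat_mult of_nat_power of_nat_add of_nat_1 of_nat_numeral
          power_mult_distrib mult.assoc)
    finally have fB: "real (f (7 * n + 8)) \<le> real C * 9 ^ d * (real n + 1) ^ d" .
    have "real t \<le> real (2 * nodes (replicate n 3) * f (7 * n + 8))" using run(3) by (simp only: of_nat_le_iff)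
    also have "\<dots> = 2 * real (nodes (replicate n 3)) * real (f (7 * n + 8))" by simp
    also have "\<dots> \<le> 2 * (25 * (real n + 1) * 2 powr (0.4 * real n - 0.3 * real D)) *
        (real C * 9 ^ d * (real n + 1) ^ d)"
      using nodes_start[OF deg, of D u] u fB by (intro mult_mono) auto
    also have "\<dots> = K * (real n + 1) ^ Suc d * 2 powr (0.4 * real n - 0.3 * real D)"
      by (simp add: K_def)
    also have "\<dots> \<le> c * 1.32 powr (real n - 0.73 * real D)" using c[OF \<open>D \<le> n\<close>] .
    finally show "decides_in_time main_prog (input n E) (three_colorable {..<n} E)
        (c * 1.32 powr (real n - 0.73 * real (max_degree {..<n} E)))"
      using run(1,2) unfolding decides_in_time_def inp col D_def by blast
  qed
qed

end
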